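(* Let $\mathbb{G}$ be a compact group and let $E=\prod_{j\in J}F_j$ be a product, over an arbitrary index set $J$, of Fréchet spaces, equipped with the product topology. Every locally $\mathbb{G}$-finite representation of $\mathbb{G}$ on $E$ is a finite direct sum of isotypic components, i.e. only finitely many of its isotypic components are non-zero and $E$ is their direct sum.
   Context: Topological groups and topological vector spaces (over $\mathbb{R}$ or $\mathbb{C}$) are assumed Hausdorff. A Fréchet space is a complete metrizable locally convex topological vector space. A representation of a topological group $\mathbb{G}$ on a topological vector space $E$ is a homomorphism from $\mathbb{G}$ to the group $GL(E)$ of linear topological automorphisms of $E$ that is continuous for the topology of pointwise convergence; equivalently, the action $\mathbb{G}\times E\to E$ is separately continuous. It is locally $\mathbb{G}$-finite if $\dim\operatorname{span}\,\mathbb{G}v<\infty$ for every $v\in E$. For $\mathbb{G}$ compact and $\alpha$ an isomorphism class of irreducible (finite-dimensional) $\mathbb{G}$-representations over the ground field, the isotypic component $E_\alpha$ is the space of vectors generating finite-dimensional subrepresentations that are direct sums of copies of $\alpha$. *)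

theory Defs
  imports "HOL-Analysis.Analysis" "HOL-Library.Function_Algebras"
begin

section \<open>The ground field\<close>

text \<open>Exactly the normed fields isometrically isomorphic to the reals or to the complex numbers.\<close>

class real_or_complex = real_normed_field +
  assumes real_or_complex:
    "\<exists>\<phi> :: 'a \<Rightarrow> complex.
       (\<forall>x y. \<phi> (x + y) = \<phi> x + \<phi> y) \<and> (\<forall>x y. \<phi> (x * y) = \<phi> x * \<phi> y) \<and>
       (\<forall>r x. \<phi> (r *\<^sub>R x) = r *\<^sub>R \<phi> x) \<and> (\<forall>x. norm (\<phi> x) = norm x) \<and>
       (range \<phi> = \<real> \<or> range \<phi> = UNIV)"

instance real :: real_or_complex
  by standard (rule exI[of _ complex_of_real], simp add: Reals_def scaleR_conv_of_real)

instance complex :: real_or_complex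
  by standard (rule exI[of _ id], simp)


section \<open>Topological vector spaces\<close>

text \<open>
  A topological vector space is given by a topology \<open>T\<close> whose underlying set
  \<open>topspace T\<close> is a linear subspace of an ambient vector space with scalar multiplication
  \<open>smul\<close>. The ambient space carries no topology. It serves to let the members of a family of
  vector spaces vary freely: every family embeds into one ambient space, its direct sum.
\<close>

definition tvs :: "('k::real_or_complex \<Rightarrow> 'v::ab_group_add \<Rightarrow> 'v) \<Rightarrow> 'v topology \<Rightarrow> bool" where
  "tvs smul T \<longleftrightarrow>
     vector_space smul \<and> module.subspace smul (topspace T) \<and> Hausdorff_space T \<and>
     continuous_map (prod_topology T T) T (\<lambda>(x, y). x + y) \<and>
     continuous_map (prod_topology euclidean T) T (\<lambda>(c, x). smul c x)"

definition convex_set :: "('k::real_or_complex \<Rightarrow> 'v::ab_group_add \<Rightarrow> 'v) \<Rightarrow> 'v set \<Rightarrow> bool" where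
  "convex_set smul C \<longleftrightarrow>
     (\<forall>x\<in>C. \<forall>y\<in>C. \<forall>t\<in>{0..1::real}. smul (of_real (1 - t)) x + smul (of_real t) y \<in> C)"

definition locally_convex :: "('k::real_or_complex \<Rightarrow> 'v::ab_group_add \<Rightarrow> 'v) \<Rightarrow> 'v topology \<Rightarrow> bool" where
  "locally_convex smul T \<longleftrightarrow>
     (\<forall>U. openin T U \<and> 0 \<in> U \<longrightarrow>
        (\<exists>C V. convex_set smul C \<and> openin T V \<and> 0 \<in> V \<and> V \<subseteq> C \<and> C \<subseteq> U))"

text \<open>Completeness refers to the translation-invariant uniformity of \<open>T\<close>.\<close>

definition tvs_cauchy_filter :: "'v::ab_group_add topology \<Rightarrow> 'v filter \<Rightarrow> bool" where
  "tvs_cauchy_filter T \<F> \<longleftrightarrow>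
     \<F> \<noteq> bot \<and> \<F> \<le> principal (topspace T) \<and>
     (\<forall>U. openin T U \<and> 0 \<in> U \<longrightarrow> (\<forall>\<^sub>F (x, y) in \<F> \<times>\<^sub>F \<F>. x - y \<in> U))"

definition tvs_complete :: "'v::ab_group_add topology \<Rightarrow> bool" where
  "tvs_complete T \<longleftrightarrow> (\<forall>\<F>. tvs_cauchy_filter T \<F> \<longrightarrow> (\<exists>l. limitin T (\<lambda>x. x) l \<F>))"

definition frechet_space :: "('k::real_or_complex \<Rightarrow> 'v::ab_group_add \<Rightarrow> 'v) \<Rightarrow> 'v topology \<Rightarrow> bool" where
  "frechet_space smul T \<longleftrightarrow>
     tvs smul T \<and> locally_convex smul T \<and> metrizable_space T \<and> tvs_complete T"

text \<open>
  The product of the spaces \<open>F j\<close> over \<open>j \<in> J\<close>. As in the library's \<open>Euclidean_space\<close>, its elements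
  are functions that vanish off \<open>J\<close>, so that they form a linear subspace of the function space; the
  coordinates off \<open>J\<close> range over a one-point space. The lemmas below identify it with
  \<open>product_topology F J\<close>.
\<close>

definition prod_tvs :: "'j set \<Rightarrow> ('j \<Rightarrow> 'v::zero topology) \<Rightarrow> ('j \<Rightarrow> 'v) topology" where
  "prod_tvs J F = product_topology (\<lambda>j. if j \<in> J then F j else discrete_topology {0}) UNIV"

definition scale_fun :: "('k \<Rightarrow> 'v \<Rightarrow> 'v) \<Rightarrow> 'k \<Rightarrow> ('j \<Rightarrow> 'v) \<Rightarrow> 'j \<Rightarrow> 'v" where
  "scale_fun smul c x = (\<lambda>j. smul c (x j))"

lemma topspace_prod_tvs:
  "topspace (prod_tvs J F) = {x. (\<forall>j\<in>J. x j \<in> topspace (F j)) \<and> (\<forall>j. j \<notin> J \<longrightarrow> x j = 0)}"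
proof -
  have "x j \<in> topspace (if j \<in> J then F j else discrete_topology {0}) \<longleftrightarrow>
      (if j \<in> J then x j \<in> topspace (F j) else x j = 0)" for x :: "'a \<Rightarrow> 'b" and j
    by simp
  then show ?thesis
    unfolding prod_tvs_def topspace_product_topology PiE_UNIV_domain Pi_def o_def by auto
qed

lemma homeomorphic_map_prod_tvs:
  "homeomorphic_map (prod_tvs J F) (product_topology F J) (\<lambda>x. restrict x J)"
proof -
  let ?g = "\<lambda>y j. if j \<in> J then y j else 0"
  have 1: "continuous_map (prod_tvs J F) (F j) (\<lambda>x. x j)" if "j \<in> J" for j
    using continuous_map_product_projection
      [of j UNIV "\<lambda>j. if j \<in> J then F j else discrete_topology {0}"] that
    by (simp add: prod_tvs_def)
  have 2: "continuous_map (product_topology F J) (if j \<in> J then F j else discrete_topology {0})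
      (\<lambda>y. ?g y j)" for j
    by (cases "j \<in> J") (simp_all add: continuous_map_product_projection)
  have 3: "continuous_map (prod_tvs J F) (product_topology F J) (\<lambda>x. restrict x J)"
    unfolding continuous_map_componentwise
  proof (intro conjI ballI)
    fix k assume "k \<in> J"
    then show "continuous_map (prod_tvs J F) (F k) (\<lambda>x. restrict x J k)"
      using 1 by simp
  qed auto
  have 4: "continuous_map (product_topology F J) (prod_tvs J F) ?g"
    unfolding prod_tvs_def continuous_map_componentwise_UNIV using 2 by blast
  have 5: "?g (restrict x J) = x" if "x \<in> topspace (prod_tvs J F)" for x
    using that unfolding topspace_prod_tvs by (auto simp: fun_eq_iff)
  have 6: "restrict (?g y) J = y" if "y \<in> topspace (product_topology F J)" for y
    using that by (auto simp: PiE_iff extensional_def fun_eq_iff)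
  have "homeomorphic_maps (prod_tvs J F) (product_topology F J) (\<lambda>x. restrict x J) ?g"
    unfolding homeomorphic_maps_def using 3 4 5 6 by blast
  then show ?thesis
    unfolding homeomorphic_map_maps by blast
qed


section \<open>Representations\<close>

definition linear_between ::
  "('k \<Rightarrow> 'v::plus \<Rightarrow> 'v) \<Rightarrow> 'v set \<Rightarrow> ('k \<Rightarrow> 'w::plus \<Rightarrow> 'w) \<Rightarrow> ('v \<Rightarrow> 'w) \<Rightarrow> bool" where
  "linear_between smul V smul' f \<longleftrightarrow>
     (\<forall>x\<in>V. \<forall>y\<in>V. f (x + y) = f x + f y) \<and> (\<forall>c. \<forall>x\<in>V. f (smul c x) = smul' c (f x))"

text \<open>
  The group is written additively, as in the library's class of topological groups, but it need not
  be commutative. The values of \<open>\<rho> g\<close> off \<open>topspace T\<close> are irrelevant throughout.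
\<close>

definition representation ::
  "('k::real_or_complex \<Rightarrow> 'v::ab_group_add \<Rightarrow> 'v) \<Rightarrow> 'v topology \<Rightarrow>
   ('g::topological_group_add \<Rightarrow> 'v \<Rightarrow> 'v) \<Rightarrow> bool" where
  "representation smul T \<rho> \<longleftrightarrow>
     (\<forall>g. linear_between smul (topspace T) smul (\<rho> g) \<and> homeomorphic_map T T (\<rho> g)) \<and>
     (\<forall>g h. \<forall>x\<in>topspace T. \<rho> (g + h) x = \<rho> g (\<rho> h x)) \<and>
     (\<forall>x\<in>topspace T. continuous_map euclidean T (\<lambda>g. \<rho> g x))"

definition orbit_span ::
  "('k::real_or_complex \<Rightarrow> 'v::ab_group_add \<Rightarrow> 'v) \<Rightarrow> ('g \<Rightarrow> 'v \<Rightarrow> 'v) \<Rightarrow> 'v \<Rightarrow> 'v set" where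
  "orbit_span smul \<rho> v = module.span smul (range (\<lambda>g. \<rho> g v))"

definition finite_dimensional ::
  "('k::real_or_complex \<Rightarrow> 'v::ab_group_add \<Rightarrow> 'v) \<Rightarrow> 'v set \<Rightarrow> bool" where
  "finite_dimensional smul V \<longleftrightarrow> (\<exists>B. finite B \<and> V = module.span smul B)"

definition locally_finite_rep ::
  "('k::real_or_complex \<Rightarrow> 'v::ab_group_add \<Rightarrow> 'v) \<Rightarrow> 'v topology \<Rightarrow> ('g \<Rightarrow> 'v \<Rightarrow> 'v) \<Rightarrow> bool" where
  "locally_finite_rep smul T \<rho> \<longleftrightarrow>
     (\<forall>v\<in>topspace T. finite_dimensional smul (orbit_span smul \<rho> v))"

definition subrepresentation ::
  "('k::real_or_complex \<Rightarrow> 'v::ab_group_add \<Rightarrow> 'v) \<Rightarrow> 'v topology \<Rightarrow> ('g \<Rightarrow> 'v \<Rightarrow> 'v) \<Rightarrow> 'v set \<Rightarrow> bool" where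
  "subrepresentation smul T \<rho> V \<longleftrightarrow>
     V \<subseteq> topspace T \<and> module.subspace smul V \<and> (\<forall>g. \<rho> g ` V \<subseteq> V)"

definition irreducible_rep ::
  "('k::real_or_complex \<Rightarrow> 'v::ab_group_add \<Rightarrow> 'v) \<Rightarrow> 'v topology \<Rightarrow> ('g \<Rightarrow> 'v \<Rightarrow> 'v) \<Rightarrow> bool" where
  "irreducible_rep smul T \<rho> \<longleftrightarrow>
     topspace T \<noteq> {0} \<and>
     (\<forall>V. subrepresentation smul T \<rho> V \<longrightarrow> V = {0} \<or> V = topspace T)"

definition isomorphic_rep ::
  "('k::real_or_complex \<Rightarrow> 'v::ab_group_add \<Rightarrow> 'v) \<Rightarrow> 'v topology \<Rightarrow> ('g \<Rightarrow> 'v \<Rightarrow> 'v) \<Rightarrow>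
   ('k \<Rightarrow> 'w::ab_group_add \<Rightarrow> 'w) \<Rightarrow> 'w topology \<Rightarrow> ('g \<Rightarrow> 'w \<Rightarrow> 'w) \<Rightarrow> bool" where
  "isomorphic_rep smul T \<rho> smul' T' \<rho>' \<longleftrightarrow>
     (\<exists>f. linear_between smul (topspace T) smul' f \<and> homeomorphic_map T T' f \<and>
        (\<forall>g. \<forall>x\<in>topspace T. f (\<rho> g x) = \<rho>' g (f x)))"

text \<open>
  Finite internal direct sums of representations on topological vector spaces: addition is a
  homeomorphism from the product of the summands, hence in particular bijective (the algebraic
  direct sum property).
\<close>

definition internal_direct_sum ::
  "('k::real_or_complex \<Rightarrow> 'v::ab_group_add \<Rightarrow> 'v) \<Rightarrow> 'v topology \<Rightarrow> ('g \<Rightarrow> 'v \<Rightarrow> 'v) \<Rightarrow>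
   'i set \<Rightarrow> ('i \<Rightarrow> 'v set) \<Rightarrow> bool" where
  "internal_direct_sum smul T \<rho> I V \<longleftrightarrow>
     finite I \<and> (\<forall>i\<in>I. subrepresentation smul T \<rho> (V i)) \<and>
     homeomorphic_map (product_topology (\<lambda>i. subtopology T (V i)) I) T (\<lambda>x. \<Sum>i\<in>I. x i)"


section \<open>Isotypic components\<close>

text \<open>
  Every finite-dimensional Hausdorff topological vector space is isomorphic to a coordinate space,
  so the isomorphism classes of irreducible finite-dimensional representations are the classes of
  those on coordinate spaces. A pair \<open>(n, \<sigma>)\<close> stands for the representation \<open>\<sigma>\<close> on the space of
  \<open>n\<close>-tuples.
\<close>

abbreviation coord_scale :: "'k::real_or_complex \<Rightarrow> (nat \<Rightarrow> 'k) \<Rightarrow> nat \<Rightarrow> 'k" where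
  "coord_scale \<equiv> scale_fun (*)"

abbreviation coord_space :: "nat \<Rightarrow> (nat \<Rightarrow> 'k::real_or_complex) topology" where
  "coord_space n \<equiv> prod_tvs {..<n} (\<lambda>_. euclidean)"

type_synonym ('g, 'k) coord_rep = "nat \<times> ('g \<Rightarrow> (nat \<Rightarrow> 'k) \<Rightarrow> nat \<Rightarrow> 'k)"

definition irreps :: "('g::topological_group_add, 'k::real_or_complex) coord_rep set" where
  "irreps = {(n, \<sigma>). representation coord_scale (coord_space n) \<sigma> \<and>
                     irreducible_rep coord_scale (coord_space n) \<sigma>}"

definition irrep_iso :: "('g::topological_group_add, 'k::real_or_complex) coord_rep rel" where
  "irrep_iso = {((n, \<sigma>), (m, \<tau>)). (n, \<sigma>) \<in> irreps \<and> (m, \<tau>) \<in> irreps \<and>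
     isomorphic_rep coord_scale (coord_space n) \<sigma> coord_scale (coord_space m) \<tau>}"

definition irrep_classes :: "('g::topological_group_add, 'k::real_or_complex) coord_rep set set" where
  "irrep_classes = irreps // irrep_iso"

definition isotypic_component ::
  "('k::real_or_complex \<Rightarrow> 'v::ab_group_add \<Rightarrow> 'v) \<Rightarrow> 'v topology \<Rightarrow>
   ('g::topological_group_add \<Rightarrow> 'v \<Rightarrow> 'v) \<Rightarrow> ('g, 'k) coord_rep set \<Rightarrow> 'v set" where
  "isotypic_component smul T \<rho> \<alpha> =
     {v \<in> topspace T.
        finite_dimensional smul (orbit_span smul \<rho> v) \<and>
        (\<exists>(m::nat) V.
           internal_direct_sum smul (subtopology T (orbit_span smul \<rho> v)) \<rho> {..<m} V \<and>
           (\<forall>i<m. \<exists>(n, \<sigma>)\<in>\<alpha>.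
              isomorphic_rep smul (subtopology T (V i)) \<rho> coord_scale (coord_space n) \<sigma>))}"

definition nonzero_isotypic_classes ::
  "('k::real_or_complex \<Rightarrow> 'v::ab_group_add \<Rightarrow> 'v) \<Rightarrow> 'v topology \<Rightarrow>
   ('g::topological_group_add \<Rightarrow> 'v \<Rightarrow> 'v) \<Rightarrow> ('g, 'k) coord_rep set set" where
  "nonzero_isotypic_classes smul T \<rho> =
     {\<alpha> \<in> irrep_classes. isotypic_component smul T \<rho> \<alpha> \<noteq> {0}}"

end

theory Submission
  imports Defs
begin

text \<open>
  The whole argument rests on complete reducibility and on a Baire category argument.

  Complete reducibility of finite-dimensional subrepresentations is usually derived from Haar measure. Here
  an invariant complement is found by convexity instead: the projections of \<open>U\<close> onto an invariant subspace
  \<open>V\<close> form an affine set on which the group acts by conjugation, the action has bounded matrix entries, and the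
  function \<open>x \<mapsto> sup\<^sub>g \<bar>g x\<bar>\<^sup>2\<close> is invariant and uniformly convex. Its unique minimiser is an equivariant
  projection (\<open>bounded_matrix_group_fixed_point\<close>, \<open>equivariant_projection\<close>). Since every vector generates a
  finite-dimensional subrepresentation, the space is algebraically the direct sum of its isotypic components,
  and a sum of vectors from distinct components generates each of its summands
  (\<open>component_in_orbit_span\<close>).

  Only finitely many components are non-zero. The vectors whose orbit spans at most \<open>k\<close> dimensions form a
  closed set, because linear dependence of finitely many vectors is a closed condition in a Hausdorff topological
  vector space. These sets exhaust the space, and a product of Frechet spaces is a Baire space
  (\<open>product_closed_cover_has_interior\<close>). So one of them has an interior point, and translating and rescaling shows
  that the orbit of every vector spans at most \<open>2k\<close> dimensions (\<open>bounded_orbit_dim\<close>). A sum of non-zero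
  vectors from \<open>m\<close> distinct components generates all of them, whence \<open>m \<le> 2k\<close>.

  The direct sum is topological because the projection onto a component is a finite linear combination of the
  operators of the representation, and therefore continuous. To find the coefficients, choose an irreducible
  subrepresentation for every non-zero component, and collect bases of all of them into one vector \<open>b\<close> of a finite
  power of the representation. The part of \<open>b\<close> that belongs to one class lies in the span of the orbit of \<open>b\<close>. This
  expresses the part as a combination of translates of \<open>b\<close>, and its coefficients are the required ones
  (\<open>separating_group_ring_op\<close>): they project every copy of the chosen irreducible representations, hence
  every vector.
\<close>

section \<open>The ground field\<close>

lemma real_or_complex_embedding:
  obtains \<phi> :: "'k::real_or_complex \<Rightarrow> complex"
  where "\<And>x y. \<phi> (x + y) = \<phi> x + \<phi> y" "\<And>x y. \<phi> (x - y) = \<phi> x - \<phi> y"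
    "\<And>x. norm (\<phi> x) = norm x" "closed (range \<phi>)"
proof -
  obtain \<phi> :: "'k \<Rightarrow> complex" where \<phi>: "\<forall>x y. \<phi> (x + y) = \<phi> x + \<phi> y" "\<forall>x. norm (\<phi> x) = norm x"
    "range \<phi> = \<real> \<or> range \<phi> = UNIV"
    using real_or_complex by metis
  have "\<phi> (x - y) = \<phi> x - \<phi> y" for x y
    using \<phi>(1)[rule_format, of "x - y" y] by simp
  moreover have "closed (range \<phi>)"
    using \<phi>(3) closed_complex_Reals by auto
  ultimately show thesis using that \<phi> by blast
qed

lemma parallelogram_real_or_complex:
  fixes a b :: "'k::real_or_complex"
  shows "(norm (a + b))\<^sup>2 + (norm (a - b))\<^sup>2 = 2 * (norm a)\<^sup>2 + 2 * (norm b)\<^sup>2"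
proof -
  obtain \<phi> :: "'k \<Rightarrow> complex" where \<phi>: "\<And>x y. \<phi> (x + y) = \<phi> x + \<phi> y"
    "\<And>x y. \<phi> (x - y) = \<phi> x - \<phi> y" "\<And>x. norm (\<phi> x) = norm x"
    using real_or_complex_embedding by metis
  have "(norm (\<phi> a + \<phi> b))\<^sup>2 + (norm (\<phi> a - \<phi> b))\<^sup>2 = 2 * (norm (\<phi> a))\<^sup>2 + 2 * (norm (\<phi> b))\<^sup>2"
    unfolding power2_norm_eq_inner by (simp add: inner_simps inner_commute)
  then show ?thesis using \<phi> by metis
qed

lemma compact_cball_real_or_complex: "compact (cball (0::'k::real_or_complex) r)"
proof -
  obtain \<phi> :: "'k \<Rightarrow> complex" where \<phi>: "\<And>x y. \<phi> (x - y) = \<phi> x - \<phi> y"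
    "\<And>x. norm (\<phi> x) = norm x" "closed (range \<phi>)"
    using real_or_complex_embedding by metis
  have dist: "dist (\<phi> x) (\<phi> y) = dist x y" for x y
    by (metis \<phi>(1,2) dist_norm)
  then have inj: "inj \<phi>" by (metis dist_eq_0_iff injI)
  define S where "S = range \<phi> \<inter> cball 0 r"
  have "compact S"
    unfolding S_def using \<phi>(3) by (simp add: closed_Int_compact)
  moreover have "continuous_on S (inv \<phi>)"
    unfolding continuous_on_iff
  proof (intro ballI allI impI)
    fix a e assume "a \<in> S" "(e::real) > 0"
    then have "\<forall>b\<in>S. dist b a < e \<longrightarrow> dist (inv \<phi> b) (inv \<phi> a) < e"
      unfolding S_def using dist inj by (auto simp: inv_f_f)
    then show "\<exists>d>0. \<forall>b\<in>S. dist b a < d \<longrightarrow> dist (inv \<phi> b) (inv \<phi> a) < e"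
      using \<open>e > 0\<close> by blast
  qed
  ultimately have "compact (inv \<phi> ` S)"
    using compact_continuous_image by blast
  moreover have "inv \<phi> ` S = cball 0 r"
  proof safe
    fix y assume "y \<in> S" then show "inv \<phi> y \<in> cball 0 r"
      unfolding S_def using \<phi>(2) inj by (auto simp: inv_f_f)
  next
    fix y :: 'k assume "y \<in> cball 0 r"
    then have "\<phi> y \<in> S" unfolding S_def using \<phi>(2) by auto
    then show "y \<in> inv \<phi> ` S" using inj by (metis image_eqI inv_f_f)
  qed
  ultimately show ?thesis by simp
qed

lemma Cauchy_convergent_real_or_complex:
  fixes X :: "nat \<Rightarrow> 'k::real_or_complex"
  assumes "Cauchy X"
  shows "convergent X"
proof -
  obtain r where "range X \<subseteq> cball 0 r"
    using cauchy_imp_bounded[OF assms] by (auto simp: bounded_iff subset_iff)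
  moreover have "complete (cball (0::'k) r)"
    using compact_cball_real_or_complex compact_imp_complete by blast
  ultimately obtain l where "X \<longlonglongrightarrow> l"
    using assms unfolding complete_def by blast
  then show ?thesis unfolding convergent_def by blast
qed


section \<open>A fixed point theorem for bounded groups of matrices\<close>

text \<open>
  The group need not act isometrically, but \<open>N x = sup\<^sub>g \<bar>g x\<bar>\<^sup>2\<close> is invariant and finite. It inherits
  a quantitative form of strict convexity from the parallelogram law, because \<open>\<bar>g x\<bar>\<close> is bounded below by a fixed
  multiple of \<open>\<bar>x\<bar>\<close>. Hence a minimising sequence of \<open>N\<close> in \<open>K\<close> is a Cauchy sequence, and two minimisers coincide. The
  group permutes the minimisers, so it fixes the only one.
\<close>

theorem bounded_matrix_group_fixed_point:
  fixes A :: "'g::group_add \<Rightarrow> 'i \<Rightarrow> 'i \<Rightarrow> 'k::real_or_complex"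
  defines "\<Phi> \<equiv> \<lambda>I g x i. if i \<in> I then \<Sum>j\<in>I. A g i j * x j else 0"
  assumes I: "finite I"
    and A_add: "\<And>g h i j. i \<in> I \<Longrightarrow> j \<in> I \<Longrightarrow> A (g + h) i j = (\<Sum>l\<in>I. A g i l * A h l j)"
    and A_0: "\<And>i j. i \<in> I \<Longrightarrow> j \<in> I \<Longrightarrow> A 0 i j = (if i = j then 1 else 0)"
    and A_le: "\<And>g i j. i \<in> I \<Longrightarrow> j \<in> I \<Longrightarrow> norm (A g i j) \<le> M"
    and K_ne: "K \<noteq> {}"
    and K_supp: "\<And>x i. x \<in> K \<Longrightarrow> i \<notin> I \<Longrightarrow> x i = 0"
    and K_mid: "\<And>x y. x \<in> K \<Longrightarrow> y \<in> K \<Longrightarrow> (\<lambda>i. (x i + y i) / 2) \<in> K"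
    and K_closed: "\<And>X x. (\<And>n. X n \<in> K) \<Longrightarrow> (\<And>i. (\<lambda>n. X n i) \<longlonglongrightarrow> x i) \<Longrightarrow> x \<in> K"
    and K_inv: "\<And>g x. x \<in> K \<Longrightarrow> \<Phi> I g x \<in> K"
  shows "\<exists>x\<in>K. \<forall>g. \<Phi> I g x = x"
proof -
  define P where "P = \<Phi> I"
  define q where "q = (\<lambda>x::'i \<Rightarrow> 'k. \<Sum>i\<in>I. (norm (x i))\<^sup>2)"
  \<comment> \<open>\<open>C\<close> bounds the squared Hilbert-Schmidt norms of the matrices; adding 1 makes it positive.\<close>
  define C where "C = real (card I) * (M\<^sup>2 * real (card I)) + 1"
  define N where "N = (\<lambda>x. SUP g. q (P g x))"
  have q_nonneg: "q x \<ge> 0" for x unfolding q_def by (simp add: sum_nonneg)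
  have C_pos: "C > 0" unfolding C_def by (smt (verit) mult_nonneg_nonneg of_nat_0_le_iff zero_le_power2)
  have P_diff: "P g (\<lambda>i. x i - y i) = (\<lambda>i. P g x i - P g y i)" for g x y
    unfolding P_def \<Phi>_def by (auto simp: fun_eq_iff right_diff_distrib sum_subtractf)
  have P_mid: "P g (\<lambda>i. (x i + y i) / 2) = (\<lambda>i. (P g x i + P g y i) / 2)" for g x y
    unfolding P_def \<Phi>_def
    by (auto simp: fun_eq_iff add_divide_distrib distrib_left sum.distrib sum_divide_distrib)
  have P_add: "P (g + h) x = P g (P h x)" for g h x
  proof
    fix i
    show "P (g + h) x i = P g (P h x) i"
    proof (cases "i \<in> I")
      case True
      then have "P (g + h) x i = (\<Sum>j\<in>I. (\<Sum>l\<in>I. A g i l * A h l j) * x j)"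
        unfolding P_def \<Phi>_def using A_add by auto
      also have "\<dots> = (\<Sum>l\<in>I. \<Sum>j\<in>I. A g i l * A h l j * x j)"
        unfolding sum_distrib_right by (rule sum.swap)
      also have "\<dots> = P g (P h x) i"
        unfolding P_def \<Phi>_def using True by (simp add: sum_distrib_left mult.assoc)
      finally show ?thesis .
    qed (simp add: P_def \<Phi>_def)
  qed
  have P_0: "P 0 x = x" if "\<And>i. i \<notin> I \<Longrightarrow> x i = 0" for x
  proof
    fix i
    have "(\<Sum>j\<in>I. A 0 i j * x j) = (\<Sum>j\<in>I. if i = j then x j else 0)" if "i \<in> I"
      using that A_0 by (intro sum.cong) auto
    then show "P 0 x i = x i" unfolding P_def \<Phi>_def using that I by auto
  qed
  have P_q: "q (P g x) \<le> C * q x" for g x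
  proof (cases "I = {}")
    case True then show ?thesis by (simp add: q_def)
  next
    case False
    then obtain i0 where i0: "i0 \<in> I" by blast
    have "0 \<le> M" using A_le[OF i0 i0] norm_ge_zero order_trans by blast
    have entry: "(norm (P g x i))\<^sup>2 \<le> M\<^sup>2 * real (card I) * q x" if "i \<in> I" for i
    proof -
      have "norm (P g x i) \<le> (\<Sum>j\<in>I. norm (A g i j * x j))"
        unfolding P_def \<Phi>_def using that norm_sum by auto
      also have "\<dots> \<le> (\<Sum>j\<in>I. M * norm (x j))"
        using A_le that by (intro sum_mono) (auto simp: norm_mult intro: mult_right_mono)
      also have "\<dots> = M * (\<Sum>j\<in>I. norm (x j))" by (simp add: sum_distrib_left)
      finally have "(norm (P g x i))\<^sup>2 \<le> (M * (\<Sum>j\<in>I. norm (x j)))\<^sup>2"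
        by (rule power_mono) simp
      also have "\<dots> = M\<^sup>2 * (\<Sum>j\<in>I. norm (x j))\<^sup>2" by (simp add: power_mult_distrib)
      also have "(\<Sum>j\<in>I. norm (x j))\<^sup>2 \<le> real (card I) * q x"
        unfolding q_def using sum_squared_le_sum_of_squares[of "\<lambda>j. norm (x j)" I] by (simp add: mult.commute)
      finally show ?thesis by (simp add: mult_left_mono mult.assoc)
    qed
    have "q (P g x) = (\<Sum>i\<in>I. (norm (P g x i))\<^sup>2)" by (simp add: q_def)
    also have "\<dots> \<le> (\<Sum>i\<in>I. M\<^sup>2 * real (card I) * q x)"
      using entry by (rule sum_mono)
    also have "\<dots> \<le> C * q x"
      unfolding C_def using q_nonneg[of x] by (simp add: algebra_simps)
    finally show ?thesis .
  qed
  have q_par: "q (\<lambda>i. (x i + y i) / 2) = (q x + q y) / 2 - q (\<lambda>i. x i - y i) / 4" for x y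
  proof -
    have "(norm ((a + b) / 2))\<^sup>2 = (norm a)\<^sup>2 / 2 + (norm b)\<^sup>2 / 2 - (norm (a - b))\<^sup>2 / 4" for a b :: 'k
      using parallelogram_real_or_complex[of a b] by (simp add: norm_divide power_divide)
    then have "q (\<lambda>i. (x i + y i) / 2) =
        (\<Sum>i\<in>I. (norm (x i))\<^sup>2 / 2 + (norm (y i))\<^sup>2 / 2 - (norm (x i - y i))\<^sup>2 / 4)"
      unfolding q_def by presburger
    also have "\<dots> = (q x + q y) / 2 - q (\<lambda>i. x i - y i) / 4"
      unfolding q_def sum.distrib sum_subtractf sum_divide_distrib[symmetric] by (simp add: add_divide_distrib)
    finally show ?thesis .
  qed
  have bdd: "bdd_above (range (\<lambda>g. q (P g x)))" for x
    using P_q by (intro bdd_aboveI2[where M = "C * q x"]) auto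
  have N_ge: "q (P g x) \<le> N x" for g x
    unfolding N_def by (rule cSUP_upper[OF UNIV_I bdd])
  have N_le: "N x \<le> c" if "\<And>g. q (P g x) \<le> c" for x c
    unfolding N_def using that by (simp add: cSUP_least)
  have N_nonneg: "N x \<ge> 0" for x using N_ge[of 0 x] q_nonneg order_trans by blast
  have N_inv: "N (P h x) \<le> N x" for h x
    using N_ge[of "_ + h" x] P_add by (intro N_le) simp
  \<comment> \<open>Applying \<open>- g\<close> bounds \<open>q (x - y)\<close> by \<open>C\<close> times its value on the images under \<open>g\<close>. So the parallelogram law
    for the images yields a gap that does not depend on \<open>g\<close>.\<close>
  have strict: "q (\<lambda>i. x i - y i) \<le> 4 * C * ((N x + N y) / 2 - N (\<lambda>i. (x i + y i) / 2))"
    if "x \<in> K" "y \<in> K" for x y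
  proof -
    have "q (P g (\<lambda>i. (x i + y i) / 2)) \<le> (N x + N y) / 2 - q (\<lambda>i. x i - y i) / (4 * C)" for g
    proof -
      have "(\<lambda>i. x i - y i) = P (- g) (P g (\<lambda>i. x i - y i))"
        using P_0[of "\<lambda>i. x i - y i"] K_supp[OF that(1)] K_supp[OF that(2)] P_add[of "- g" g] by simp
      then have "q (\<lambda>i. x i - y i) \<le> C * q (\<lambda>i. P g x i - P g y i)"
        using P_q P_diff by metis
      then have "q (\<lambda>i. x i - y i) / (4 * C) \<le> q (\<lambda>i. P g x i - P g y i) / 4"
        using C_pos by (simp add: field_simps)
      moreover have "q (P g x) \<le> N x" "q (P g y) \<le> N y" using N_ge by auto
      ultimately show ?thesis unfolding P_mid q_par by argo
    qed
    then have "N (\<lambda>i. (x i + y i) / 2) \<le> (N x + N y) / 2 - q (\<lambda>i. x i - y i) / (4 * C)"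
      by (rule N_le)
    then show ?thesis using C_pos by (simp add: field_simps)
  qed
  define m where "m = (INF x\<in>K. N x)"
  have m_le: "m \<le> N x" if "x \<in> K" for x
    unfolding m_def using that N_nonneg by (intro cINF_lower bdd_belowI2[where m = 0]) auto
  have close: "q (\<lambda>i. x i - y i) \<le> 4 * C * ((N x + N y) / 2 - m)" if "x \<in> K" "y \<in> K" for x y
  proof -
    have "q (\<lambda>i. x i - y i) \<le> 4 * C * ((N x + N y) / 2 - N (\<lambda>i. (x i + y i) / 2))"
      using strict that by blast
    also have "\<dots> \<le> 4 * C * ((N x + N y) / 2 - m)"
      using C_pos m_le[OF K_mid[OF that]] by (intro mult_left_mono) auto
    finally show ?thesis .
  qed
  have "\<exists>x\<in>K. N x < m + 1 / real (Suc n)" for n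
  proof -
    have "Inf (N ` K) < m + 1 / real (Suc n)" unfolding m_def by simp
    then show ?thesis using K_ne cInf_lessD[of "N ` K"] by auto
  qed
  then obtain X where X: "\<And>n. X n \<in> K" "\<And>n. N (X n) < m + 1 / real (Suc n)" by metis
  have "convergent (\<lambda>n. X n i)" for i
  proof (cases "i \<in> I")
    case True
    have "Cauchy (\<lambda>n. X n i)"
      unfolding Cauchy_def
    proof (intro allI impI)
      fix e :: real assume e: "e > 0"
      then have "e\<^sup>2 / (4 * C) > 0" using C_pos by simp
      then obtain n0 where n0: "1 / real (Suc n0) < e\<^sup>2 / (4 * C)"
        using nat_approx_posE by metis
      have "dist (X k i) (X l i) < e" if "k \<ge> n0" "l \<ge> n0" for k l
      proof -
        have small: "N (X k) < m + 1 / real (Suc n0)" if "k \<ge> n0" for k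
          using that X(2)[of k] by (smt (verit) Suc_le_mono frac_le of_nat_0_less_iff of_nat_mono zero_less_Suc)
        have small': "(N (X k) + N (X l)) / 2 - m < e\<^sup>2 / (4 * C)"
          using small[OF that(1)] small[OF that(2)] n0 by argo
        have "(norm (X k i - X l i))\<^sup>2 \<le> q (\<lambda>i. X k i - X l i)"
          unfolding q_def using True I by (intro member_le_sum[of i I "\<lambda>i. (norm (X k i - X l i))\<^sup>2"]) auto
        also have "\<dots> \<le> 4 * C * ((N (X k) + N (X l)) / 2 - m)" using close X(1) by blast
        also have "\<dots> < 4 * C * (e\<^sup>2 / (4 * C))"
          using small' C_pos by (intro mult_strict_left_mono) auto
        also have "\<dots> = e\<^sup>2" using C_pos by simp
        finally show ?thesis using e by (simp add: dist_norm power2_less_imp_less)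
      qed
      then show "\<exists>M. \<forall>k\<ge>M. \<forall>n\<ge>M. dist (X k i) (X n i) < e" by blast
    qed
    then show ?thesis by (rule Cauchy_convergent_real_or_complex)
  next
    case False
    then show ?thesis using K_supp[OF X(1)] by (simp add: convergent_const)
  qed
  then obtain x where x: "\<And>i. (\<lambda>n. X n i) \<longlonglongrightarrow> x i"
    unfolding convergent_def by metis
  have xK: "x \<in> K" using K_closed X(1) x by blast
  have "N x \<le> m"
  proof (rule N_le)
    fix g
    have "(\<lambda>n. q (P g (X n))) \<longlonglongrightarrow> q (P g x)"
      unfolding q_def P_def \<Phi>_def by (auto intro!: tendsto_intros x simp: cong: sum.cong)
    moreover have "(\<lambda>n. m + 1 / real (Suc n)) \<longlonglongrightarrow> m + 0"
      by (intro tendsto_intros LIMSEQ_Suc[OF lim_1_over_n])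
    moreover have "\<forall>n. q (P g (X n)) \<le> m + 1 / real (Suc n)"
      using N_ge X(2) by (meson less_imp_le order_trans)
    ultimately show "q (P g x) \<le> m"
      using LIMSEQ_le by fastforce
  qed
  have "P g x = x" for g
  proof
    fix i
    have gK: "P g x \<in> K" using K_inv xK unfolding P_def by blast
    have "q (\<lambda>i. x i - P g x i) \<le> 4 * C * ((N x + N (P g x)) / 2 - m)"
      using close xK gK by blast
    also have "\<dots> \<le> 0"
      using N_inv[of g x] \<open>N x \<le> m\<close> C_pos by (intro mult_nonneg_nonpos) auto
    finally have "(\<Sum>i\<in>I. (norm (x i - P g x i))\<^sup>2) = 0"
      using q_nonneg[of "\<lambda>i. x i - P g x i"] by (simp add: q_def)
    then have "\<forall>i\<in>I. x i = P g x i" using I by (simp add: sum_nonneg_eq_0_iff)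
    then show "P g x i = x i" using K_supp xK gK by metis
  qed
  then show ?thesis using xK unfolding P_def by blast
qed


section \<open>Linear maps on subspaces\<close>

context
  fixes smul :: "'k::real_or_complex \<Rightarrow> 'v::ab_group_add \<Rightarrow> 'v"
    and smul' :: "'k \<Rightarrow> 'w::ab_group_add \<Rightarrow> 'w"
    and V :: "'v set" and f :: "'v \<Rightarrow> 'w"
  assumes smul: "vector_space smul" and smul': "vector_space smul'"
    and V: "module.subspace smul V" and f: "linear_between smul V smul' f"
begin

interpretation A: vector_space smul by (rule smul)
interpretation B: vector_space smul' by (rule smul')

lemma linear_between_add: "x \<in> V \<Longrightarrow> y \<in> V \<Longrightarrow> f (x + y) = f x + f y"
  using f unfolding linear_between_def by blast

lemma linear_between_scale: "x \<in> V \<Longrightarrow> f (smul c x) = smul' c (f x)"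
  using f unfolding linear_between_def by blast

lemma linear_between_0: "f 0 = 0"
  using linear_between_add[of 0 0] A.subspace_0[OF V] by simp

lemma linear_between_diff: "x \<in> V \<Longrightarrow> y \<in> V \<Longrightarrow> f (x - y) = f x - f y"
  using linear_between_add[of "x - y" y] A.subspace_diff[OF V] by simp

lemma linear_between_sum:
  "(\<And>i. i \<in> I \<Longrightarrow> x i \<in> V) \<Longrightarrow> f (\<Sum>i\<in>I. x i) = (\<Sum>i\<in>I. f (x i))"
  by (induction I rule: infinite_finite_induct)
     (simp_all add: linear_between_0 linear_between_add A.subspace_sum[OF V])

lemma linear_between_lincomb:
  assumes "\<And>i. i \<in> I \<Longrightarrow> x i \<in> V"
  shows "f (\<Sum>i\<in>I. smul (c i) (x i)) = (\<Sum>i\<in>I. smul' (c i) (f (x i)))"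
  using assms by (simp add: linear_between_sum A.subspace_scale[OF V] linear_between_scale)

lemma linear_between_image_span:
  assumes "B \<subseteq> V"
  shows "f ` A.span B = B.span (f ` B)"
proof -
  have sub: "A.span B \<subseteq> V" using assms V by (rule A.span_minimal)
  show ?thesis
  proof (rule B.span_unique[symmetric])
    show "f ` B \<subseteq> f ` A.span B" using A.span_superset by blast
    show "B.subspace (f ` A.span B)"
    proof (rule B.subspaceI)
      show "0 \<in> f ` A.span B" using linear_between_0 A.span_zero by (metis image_eqI)
    next
      fix x y assume "x \<in> f ` A.span B" "y \<in> f ` A.span B"
      then obtain a b where ab: "a \<in> A.span B" "b \<in> A.span B" "x = f a" "y = f b" by blast
      then have "x + y = f (a + b)" using sub linear_between_add by (metis subsetD)
      then show "x + y \<in> f ` A.span B" using ab A.span_add by blast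
    next
      fix c x assume "x \<in> f ` A.span B"
      then obtain a where a: "a \<in> A.span B" "x = f a" by blast
      then have "smul' c x = f (smul c a)" using sub linear_between_scale by (metis subsetD)
      then show "smul' c x \<in> f ` A.span B" using a A.span_scale by blast
    qed
  next
    fix W assume W: "f ` B \<subseteq> W" "B.subspace W"
    have "A.span B \<subseteq> {x \<in> V. f x \<in> W}"
    proof (rule A.span_minimal)
      show "B \<subseteq> {x \<in> V. f x \<in> W}" using W assms by blast
      show "A.subspace {x \<in> V. f x \<in> W}"
        using W(2) V linear_between_0 linear_between_add linear_between_scale
        unfolding A.subspace_def B.subspace_def by auto
    qed
    then show "f ` A.span B \<subseteq> W" by blast
  qed
qed

end

lemma linear_between_subset: "linear_between smul V smul' f \<Longrightarrow> W \<subseteq> V \<Longrightarrow> linear_between smul W smul' f"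
  unfolding linear_between_def by blast

lemma linear_between_compose:
  "linear_between s1 V s2 f \<Longrightarrow> linear_between s2 W s3 g \<Longrightarrow> f ` V \<subseteq> W
    \<Longrightarrow> linear_between s1 V s3 (\<lambda>x. g (f x))"
  unfolding linear_between_def by (simp add: image_subset_iff)

lemma linear_between_inv_into:
  assumes "vector_space s1" "module.subspace s1 V" "linear_between s1 V s2 f" "bij_betw f V W"
  shows "linear_between s2 W s1 (inv_into V f)"
proof -
  interpret vector_space s1 by fact
  have inj: "inj_on f V" and W: "f ` V = W" using assms(4) by (auto simp: bij_betw_def)
  have "inv_into V f (f x + f y) = x + y" if "x \<in> V" "y \<in> V" for x y
    using that assms(3) inj subspace_add[OF assms(2)]
    by (metis inv_into_f_f linear_between_def)
  moreover have "inv_into V f (s2 c (f x)) = s1 c x" if "x \<in> V" for x c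
    using that assms(3) inj subspace_scale[OF assms(2)]
    by (metis inv_into_f_f linear_between_def)
  ultimately show ?thesis
    unfolding linear_between_def using W inj by (auto simp: inv_into_f_f)
qed

text \<open>
  The predicate \<open>finite_dimensional\<close> is available only over the real and complex numbers, which is why its
  consequences need a locale of their own.
\<close>

locale rc_vector_space = vector_space smul
  for smul :: "'k::real_or_complex \<Rightarrow> 'v::ab_group_add \<Rightarrow> 'v"
begin

lemma finite_dimensional_basis:
  assumes "finite_dimensional smul V"
  obtains B where "finite B" "independent B" "span B = V" "B \<subseteq> V"
proof -
  obtain S where S: "finite S" "V = span S" using assms unfolding finite_dimensional_def by blast
  obtain B where B: "B \<subseteq> S" "independent B" "S \<subseteq> span B" by (rule maximal_independent_subset)
  then have "span B = V" using S by (metis span_mono span_span subset_antisym)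
  then show thesis using that B S by (metis finite_subset span_superset)
qed

lemma finite_dimensional_subspace:
  assumes "finite_dimensional smul V" "subspace W" "W \<subseteq> V"
  shows "finite_dimensional smul W"
proof -
  obtain S where S: "finite S" "V = span S" using assms(1) unfolding finite_dimensional_def by blast
  obtain B where B: "B \<subseteq> W" "independent B" "W \<subseteq> span B" by (rule maximal_independent_subset)
  have "finite B" using independent_span_bound[OF S(1) B(2)] B(1) assms(3) S(2) by blast
  moreover have "W = span B" using B assms(2) by (metis span_minimal subset_antisym)
  ultimately show ?thesis unfolding finite_dimensional_def by blast
qed

lemma subspace_of_finite_dimensional: "finite_dimensional smul V \<Longrightarrow> subspace V"
  unfolding finite_dimensional_def by auto

lemma dim_le_finite_dimensional:
  assumes "finite_dimensional smul V" "W \<subseteq> V"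
  shows "dim W \<le> dim V"
proof -
  obtain B where "finite B" "independent B" "span B = V" "B \<subseteq> V"
    by (rule finite_dimensional_basis[OF assms(1)])
  then show ?thesis using dim_le_card[of W B] assms(2) dim_eq_card_independent dim_span by metis
qed

lemma dim_less_finite_dimensional:
  assumes "finite_dimensional smul V" "subspace W" "W \<subseteq> V" "W \<noteq> V"
  shows "dim W < dim V"
proof -
  obtain B where B: "finite B" "independent B" "span B = W" "B \<subseteq> W"
    by (rule finite_dimensional_basis[OF finite_dimensional_subspace[OF assms(1-3)]])
  obtain v where v: "v \<in> V" "v \<notin> W" using assms by blast
  have "independent (insert v B)" using B v by (simp add: independent_insertI)
  moreover have "v \<notin> B" using B v by blast
  ultimately have "dim (insert v B) = Suc (card B)" using B by (simp add: dim_eq_card_independent)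
  moreover have "dim (insert v B) \<le> dim V"
    using assms v B by (intro dim_le_finite_dimensional) auto
  moreover have "dim W = card B" using B dim_span_eq_card_independent by metis
  ultimately show ?thesis by simp
qed

lemma finite_dimensional_span_Un:
  assumes "finite_dimensional smul V" "finite_dimensional smul W"
  shows "finite_dimensional smul (span (V \<union> W))" "dim (span (V \<union> W)) \<le> dim V + dim W"
proof -
  obtain A where A: "finite A" "independent A" "span A = V" "A \<subseteq> V"
    by (rule finite_dimensional_basis[OF assms(1)])
  obtain B where B: "finite B" "independent B" "span B = W" "B \<subseteq> W"
    by (rule finite_dimensional_basis[OF assms(2)])
  have eq: "span (A \<union> B) = span (V \<union> W)"
  proof -
    have "span V = V" "span W = W" using A B span_span by metis+
    then show ?thesis by (simp only: span_Un A(3) B(3))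
  qed
  then show "finite_dimensional smul (span (V \<union> W))"
    unfolding finite_dimensional_def using A B by (metis finite_UnI)
  have "dim (span (V \<union> W)) \<le> card (A \<union> B)"
    using eq A B by (metis dim_le_card finite_UnI order_refl)
  also have "\<dots> \<le> card A + card B" by (rule card_Un_le)
  also have "\<dots> = dim V + dim W" using A B dim_span_eq_card_independent by metis
  finally show "dim (span (V \<union> W)) \<le> dim V + dim W" .
qed

lemma independent_familyI:
  assumes A: "finite A" and indep: "\<And>c a. (\<Sum>a\<in>A. smul (c a) (x a)) = 0 \<Longrightarrow> a \<in> A \<Longrightarrow> c a = 0"
  shows "inj_on x A" "independent (x ` A)"
proof -
  show inj: "inj_on x A"
  proof (rule inj_onI, rule ccontr)
    fix a b assume ab: "a \<in> A" "b \<in> A" "x a = x b" "a \<noteq> b"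
    define c where "c = (\<lambda>i. if i = a then 1 else if i = b then -1 else (0::'k))"
    have "(\<Sum>i\<in>A. smul (c i) (x i)) = (\<Sum>i\<in>{a, b}. smul (c i) (x i))"
      using ab A by (intro sum.mono_neutral_right) (auto simp: c_def)
    also have "\<dots> = 0" using ab by (simp add: c_def)
    finally have "c a = 0" using indep ab(1) by blast
    then show False by (simp add: c_def)
  qed
  show "independent (x ` A)"
  proof (rule independent_if_scalars_zero)
    show "finite (x ` A)" using A by simp
    fix f v assume f: "(\<Sum>v\<in>x ` A. smul (f v) v) = 0" and "v \<in> x ` A"
    then obtain a where a: "a \<in> A" "v = x a" by blast
    have "(\<Sum>a\<in>A. smul (f (x a)) (x a)) = 0" using f inj by (simp add: sum.reindex)
    then show "f v = 0" using indep[of "\<lambda>a. f (x a)" a] a by simp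
  qed
qed

lemma independent_familyD:
  assumes "finite A" "inj_on x A" "independent (x ` A)" "(\<Sum>a\<in>A. smul (c a) (x a)) = 0" "a \<in> A"
  shows "c a = 0"
proof -
  define f where "f = (\<lambda>v. c (inv_into A x v))"
  have "(\<Sum>v\<in>x ` A. smul (f v) v) = (\<Sum>a\<in>A. smul (c a) (x a))"
    using assms(2) by (simp add: sum.reindex f_def)
  then have "f (x a) = 0"
    using independentD[OF assms(3) _ order_refl, of f "x a"] assms by simp
  then show ?thesis using assms unfolding f_def by simp
qed

lemma card_independent_le_dim:
  assumes "finite_dimensional smul W" "independent S" "S \<subseteq> W"
  shows "card S \<le> dim W"
  using dim_le_finite_dimensional[OF assms(1,3)] dim_eq_card_independent[OF assms(2)] by simp

lemma span_range_explicit: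
  assumes "v \<in> span (range h)"
  obtains S c where "finite S" "v = (\<Sum>g\<in>S. smul (c g) (h g))"
proof -
  obtain t r where t: "finite t" "t \<subseteq> range h" "v = (\<Sum>a\<in>t. smul (r a) a)"
    using assms unfolding span_alt span_explicit' span_explicit by blast
  obtain S where S: "inj_on h S" "t = h ` S" using t(2) subset_image_inj by metis
  have "finite S" using t(1) S finite_imageD by blast
  moreover have "v = (\<Sum>g\<in>S. smul (r (h g)) (h g))" using t(3) S by (simp add: sum.reindex)
  ultimately show thesis by (rule that)
qed

end


section \<open>Topological vector spaces\<close>

locale top_vec_space = rc_vector_space smul
  for smul :: "'k::real_or_complex \<Rightarrow> 'v::ab_group_add \<Rightarrow> 'v" +
  fixes T :: "'v topology"
  assumes tvs: "tvs smul T"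
begin

lemma subspace_topspace: "subspace (topspace T)"
  using tvs unfolding tvs_def by blast

lemma Hausdorff: "Hausdorff_space T"
  using tvs unfolding tvs_def by blast

lemma zero_topspace [simp]: "0 \<in> topspace T"
  using subspace_topspace subspace_0 by blast

lemma closedin_0: "closedin T {0}"
  by (simp add: closedin_Hausdorff_singleton Hausdorff)

lemma continuous_map_add:
  assumes "continuous_map X T f" "continuous_map X T g"
  shows "continuous_map X T (\<lambda>x. f x + g x)"
proof -
  have *: "continuous_map (prod_topology T T) T (\<lambda>(x, y). x + y)" using tvs unfolding tvs_def by blast
  have "continuous_map X (prod_topology T T) (\<lambda>x. (f x, g x))"
    using assms by (simp add: continuous_map_paired)
  from continuous_map_compose[OF this *] show ?thesis by (simp add: o_def)
qed

lemma continuous_map_scale: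
  assumes "continuous_map X euclidean c" "continuous_map X T f"
  shows "continuous_map X T (\<lambda>x. smul (c x) (f x))"
proof -
  have *: "continuous_map (prod_topology euclidean T) T (\<lambda>(c, x). smul c x)" using tvs unfolding tvs_def by blast
  have "continuous_map X (prod_topology euclidean T) (\<lambda>x. (c x, f x))"
    using assms by (simp add: continuous_map_paired)
  from continuous_map_compose[OF this *] show ?thesis by (simp add: o_def)
qed

lemma continuous_map_Sum:
  assumes "\<And>i. i \<in> I \<Longrightarrow> continuous_map X T (f i)"
  shows "continuous_map X T (\<lambda>x. \<Sum>i\<in>I. f i x)"
  using assms
  by (induction I rule: infinite_finite_induct) (simp_all add: continuous_map_add)

text \<open>
  The projection along the compact space of admissible coefficients is a closed map.
\<close>

lemma closedin_combination:
  assumes D: "finite D" and K: "\<And>d. d \<in> D \<Longrightarrow> compact (K d)"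
    and h: "\<And>d. d \<in> D \<Longrightarrow> continuous_map X T (h d)"
  shows "closedin X {x \<in> topspace X. \<exists>c. (\<forall>d\<in>D. c d \<in> K d) \<and> (\<Sum>d\<in>D. smul (c d) (h d x)) = 0}"
proof -
  define P where "P = product_topology (\<lambda>d. top_of_set (K d)) D"
  define F where "F = (\<lambda>(c, x). \<Sum>d\<in>D. smul (c d) (h d x))"
  have "compact_space (top_of_set (K d))" if "d \<in> D" for d
    using K[OF that] by (simp add: compact_space_subtopology)
  then have P: "compact_space P" unfolding P_def by (simp add: compact_space_product_topology)
  have c: "continuous_map (prod_topology P X) euclidean (\<lambda>p. fst p d)" if "d \<in> D" for d
  proof -
    have "continuous_map P (top_of_set (K d)) (\<lambda>c. c d)"
      unfolding P_def using that by (rule continuous_map_product_projection)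
    then have "continuous_map P euclidean (\<lambda>c. c d)" by (rule continuous_map_into_fulltopology)
    from continuous_map_compose[OF continuous_map_fst[of P X] this] show ?thesis by (simp add: o_def)
  qed
  have x: "continuous_map (prod_topology P X) T (\<lambda>p. h d (snd p))" if "d \<in> D" for d
    using continuous_map_compose[OF continuous_map_snd[of P X] h[OF that]] by (simp add: o_def)
  have "continuous_map (prod_topology P X) T F"
    unfolding F_def case_prod_beta by (rule continuous_map_Sum) (rule continuous_map_scale[OF c x])
  then have "closedin (prod_topology P X) {p \<in> topspace (prod_topology P X). F p \<in> {0}}"
    using closedin_0 by (rule closedin_continuous_map_preimage)
  then have "closedin X (snd ` {p \<in> topspace (prod_topology P X). F p \<in> {0}})"
    using closed_map_snd[OF P] unfolding closed_map_def by blast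
  also have "snd ` {p \<in> topspace (prod_topology P X). F p \<in> {0}} =
      {x \<in> topspace X. \<exists>c. (\<forall>d\<in>D. c d \<in> K d) \<and> (\<Sum>d\<in>D. smul (c d) (h d x)) = 0}" (is "?L = ?R")
  proof (intro set_eqI iffI)
    fix x assume "x \<in> ?L"
    then show "x \<in> ?R" unfolding P_def F_def by (auto simp: PiE_iff)
  next
    fix x assume "x \<in> ?R"
    then obtain c where c: "x \<in> topspace X" "\<forall>d\<in>D. c d \<in> K d" "(\<Sum>d\<in>D. smul (c d) (h d x)) = 0"
      by blast
    have "(restrict c D, x) \<in> {p \<in> topspace (prod_topology P X). F p \<in> {0}}"
      unfolding P_def F_def using c by (auto simp: PiE_iff)
    then show "x \<in> ?L" by (metis (no_types, lifting) image_eqI snd_conv)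
  qed
  finally show ?thesis .
qed

text \<open>
  A non-trivial relation may be divided by its largest coefficient. The coefficients then range over a
  compact set that does not contain the zero family, which reduces the claim to \<open>closedin_combination\<close>.
\<close>

lemma closedin_dependent_family:
  assumes D: "finite D" and h: "\<And>d. d \<in> D \<Longrightarrow> continuous_map X T (h d)"
  shows "closedin X {x \<in> topspace X. \<exists>c. (\<exists>d\<in>D. c d \<noteq> 0) \<and> (\<Sum>d\<in>D. smul (c d) (h d x)) = 0}"
proof -
  let ?K = "\<lambda>e d. if d = e then {1} else cball (0::'k) 1"
  let ?S = "\<lambda>e. {x \<in> topspace X. \<exists>c. (\<forall>d\<in>D. c d \<in> ?K e d) \<and> (\<Sum>d\<in>D. smul (c d) (h d x)) = 0}"
  have "closedin X (?S e)" for e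
    using D h by (intro closedin_combination) (auto simp: compact_cball_real_or_complex)
  then have "closedin X (\<Union>e\<in>D. ?S e)" using D by (intro closedin_Union) auto
  also have "(\<Union>e\<in>D. ?S e) =
      {x \<in> topspace X. \<exists>c. (\<exists>d\<in>D. c d \<noteq> 0) \<and> (\<Sum>d\<in>D. smul (c d) (h d x)) = 0}" (is "?L = ?R")
  proof (intro set_eqI iffI)
    fix x assume "x \<in> ?L"
    then obtain e c where c: "e \<in> D" "x \<in> topspace X" "\<forall>d\<in>D. c d \<in> ?K e d"
      "(\<Sum>d\<in>D. smul (c d) (h d x)) = 0" by blast
    then have "c e = 1" by force
    then show "x \<in> ?R" using c by (metis (mono_tags, lifting) mem_Collect_eq zero_neq_one)
  next
    fix x assume "x \<in> ?R"
    then obtain c d where c: "x \<in> topspace X" "d \<in> D" "c d \<noteq> 0" "(\<Sum>d\<in>D. smul (c d) (h d x)) = 0"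
      by blast
    have "Max ((\<lambda>d. norm (c d)) ` D) \<in> (\<lambda>d. norm (c d)) ` D"
      using D c by (intro Max_in) auto
    then obtain e where e: "e \<in> D" "norm (c e) = Max ((\<lambda>d. norm (c d)) ` D)" by auto
    have le: "norm (c d') \<le> norm (c e)" if "d' \<in> D" for d'
      using that D e by simp
    have "norm (c e) > 0" using le[OF c(2)] c(3) by (smt (verit) norm_le_zero_iff)
    then have ne: "c e \<noteq> 0" by auto
    have "(\<Sum>d\<in>D. smul (c d / c e) (h d x)) = smul (1 / c e) (\<Sum>d\<in>D. smul (c d) (h d x))"
      by (simp add: scale_sum_right)
    moreover have "\<forall>d\<in>D. c d / c e \<in> ?K e d"
      using le ne by (auto simp: norm_divide divide_le_eq)
    ultimately have "x \<in> ?S e"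
      using c by (intro CollectI conjI exI[of _ "\<lambda>d. c d / c e"]) auto
    then show "x \<in> ?L" using e by blast
  qed
  finally show ?thesis .
qed

lemma continuous_map_diff:
  assumes "continuous_map X T f" "continuous_map X T g"
  shows "continuous_map X T (\<lambda>x. f x - g x)"
  using continuous_map_add[OF assms(1) continuous_map_scale[OF _ assms(2), of "\<lambda>_. -1"]] by simp

text \<open>
  A finite-dimensional subspace carries its usual topology. The vectors with some coordinate of modulus at least
  1 are those \<open>u\<close> such that \<open>t u\<close>, for some \<open>\<bar>t\<bar> \<le> 1\<close>, has a coordinate \<open>-1\<close> and none of larger modulus.
  By compactness of the coefficients these vectors form a closed set. So all coordinates are small near 0, and
  by translation and scaling they are continuous everywhere.
\<close>

lemma continuous_coordinate:
  assumes B: "finite B" "independent B" "B \<subseteq> topspace T"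
  shows "continuous_map (subtopology T (span B)) euclidean (\<lambda>u. representation B u b)"
proof -
  define X where "X = subtopology T (span B)"
  have sub: "span B \<subseteq> topspace T" using B(3) subspace_topspace by (rule span_minimal)
  then have X: "topspace X = span B" unfolding X_def by auto
  have id: "continuous_map X T (\<lambda>u. u)" unfolding X_def
    by (simp add: continuous_map_from_subtopology)
  have zero: "0 \<notin> B" using B(2) dependent_zero by blast
  have rep: "(\<Sum>b\<in>B. smul (representation B u b) b) = u" if "u \<in> span B" for u
    using sum_representation_eq[OF B(2) that B(1) order_refl] .
  \<comment> \<open>The index 0, which is not in \<open>B\<close>, stands for the vector \<open>u\<close> itself.
    The set \<open>S e\<close> consists of the \<open>u\<close> for which some \<open>t u\<close> has
    all coordinates of modulus at most 1 and coordinate \<open>-1\<close> at \<open>e\<close>.\<close>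
  define S where "S = (\<lambda>e. {u \<in> topspace X. \<exists>c.
    (\<forall>d\<in>insert 0 B. c d \<in> (if d = e then {1} else cball (0::'k) 1)) \<and>
    (\<Sum>d\<in>insert 0 B. smul (c d) (if d = 0 then u else d)) = 0})"
  have S_closed: "closedin X (S e)" for e
    unfolding S_def
  proof (rule closedin_combination)
    fix d assume d: "d \<in> insert 0 B"
    show "compact (if d = e then {1} else cball (0::'k) 1)"
      by (simp add: compact_cball_real_or_complex)
    show "continuous_map X T (\<lambda>u. if d = 0 then u else d)"
      using d id B(3) by auto
  qed (use B in auto)
  have S_sum: "(\<Sum>d\<in>insert 0 B. smul (c d) (if d = 0 then u else d)) = smul (c 0) u + (\<Sum>d\<in>B. smul (c d) d)" for c u
  proof -
    have "(\<Sum>d\<in>B. smul (c d) (if d = 0 then u else d)) = (\<Sum>d\<in>B. smul (c d) d)"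
      using zero by (intro sum.cong) auto
    then show ?thesis using zero B(1) by simp
  qed
  have S_0: "0 \<notin> S e" if "e \<in> B" for e
  proof
    assume "0 \<in> S e"
    then obtain c where c: "\<forall>d\<in>insert 0 B. c d \<in> (if d = e then {1} else cball (0::'k) 1)"
      "smul (c 0) 0 + (\<Sum>d\<in>B. smul (c d) d) = 0"
      unfolding S_def S_sum by blast
    then have "c e = 0" using independentD[OF B(2) B(1) order_refl, of c e] that by simp
    moreover have "c e = 1" using c(1) that by force
    ultimately show False by simp
  qed
  have S_ge: "\<exists>e\<in>B. u \<in> S e" if u: "u \<in> span B" "d \<in> B" "norm (representation B u d) \<ge> 1" for u d
  proof -
    have "Max ((\<lambda>d. norm (representation B u d)) ` B) \<in> (\<lambda>d. norm (representation B u d)) ` B"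
      using B(1) u by (intro Max_in) auto
    then obtain e where e: "e \<in> B" "norm (representation B u e) = Max ((\<lambda>d. norm (representation B u d)) ` B)"
      by auto
    have le: "norm (representation B u d') \<le> norm (representation B u e)" if "d' \<in> B" for d'
      using that B(1) e by simp
    define s where "s = representation B u e"
    have s: "norm s \<ge> 1" "s \<noteq> 0" using le[OF u(2)] u(3) unfolding s_def by auto
    define c where "c = (\<lambda>d. if d = 0 then - (1 / s) else representation B u d / s)"
    have "(\<Sum>d\<in>B. smul (c d) d) = (\<Sum>d\<in>B. smul (1 / s) (smul (representation B u d) d))"
      unfolding c_def using zero by (intro sum.cong) auto
    also have "\<dots> = smul (1 / s) u"
      by (simp only: scale_sum_right[symmetric] rep[OF u(1)])
    finally have "smul (c 0) u + (\<Sum>d\<in>B. smul (c d) d) = 0" unfolding c_def by simp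
    moreover have "\<forall>d\<in>insert 0 B. c d \<in> (if d = e then {1} else cball 0 1)"
      using le s e(1) zero s_def unfolding c_def by (auto simp: norm_divide divide_le_eq)
    ultimately have "u \<in> S e" unfolding S_def S_sum using u(1) X by blast
    then show ?thesis using e(1) by blast
  qed
  define W where "W = topspace X - (\<Union>e\<in>B. S e)"
  have "closedin X (\<Union>e\<in>B. S e)" using S_closed B(1) by (intro closedin_Union) auto
  then have W_open: "openin X W" unfolding W_def by (simp add: openin_diff)
  have W_0: "0 \<in> W" unfolding W_def using S_0 X by (auto simp: span_zero)
  have W_small: "norm (representation B u d) < 1" if "u \<in> W" "d \<in> B" for u d
    using S_ge[of u d] that X unfolding W_def by force
  have "continuous_map X euclidean (\<lambda>u. representation B u b)"
  proof (cases "b \<in> B")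
    case False
    then have "representation B u b = 0" for u using representation_ne_zero by blast
    then show ?thesis by simp
  next
    case True
    show ?thesis
      unfolding continuous_map_eq_topcontinuous_at topcontinuous_at_def
    proof (intro ballI conjI allI impI)
      fix u0 V assume u0: "u0 \<in> topspace X"
        and V: "openin euclidean V \<and> representation B u0 b \<in> V"
      then obtain e where e: "e > 0" "ball (representation B u0 b) e \<subseteq> V"
        by (metis open_contains_ball open_openin)
      define f where "f = (\<lambda>u. smul (of_real (1 / e)) (u - u0))"
      have f_span: "f u \<in> span B" if "u \<in> topspace X" for u
        unfolding f_def using that u0 X by (simp add: span_scale span_diff)
      have "continuous_map X T f"
        unfolding f_def using id u0 sub X by (intro continuous_map_scale continuous_map_diff) auto
      then have f: "continuous_map X X f"
        using f_span X unfolding X_def by (auto simp: continuous_map_in_subtopology)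
      have "openin X {u \<in> topspace X. f u \<in> W}"
        using f W_open by (rule openin_continuous_map_preimage)
      moreover have "u0 \<in> {u \<in> topspace X. f u \<in> W}"
        using u0 W_0 unfolding f_def by simp
      moreover have "representation B u b \<in> V" if u: "u \<in> {u \<in> topspace X. f u \<in> W}" for u
      proof -
        have "norm (representation B (f u) b) < 1" using W_small u True by blast
        moreover have "representation B (f u) b = of_real (1 / e) * (representation B u b - representation B u0 b)"
          unfolding f_def using u u0 X B(2)
          by (simp add: representation_scale representation_diff span_diff)
        ultimately have "norm (representation B u b - representation B u0 b) < e"
          using e(1) by (simp add: norm_mult norm_divide field_simps)
        then show ?thesis using e(2) by (auto simp: dist_norm norm_minus_commute)
      qed
      ultimately show "\<exists>U. openin X U \<and> u0 \<in> U \<and> (\<forall>y\<in>U. representation B y b \<in> V)" by blast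
    qed auto
  qed
  then show ?thesis unfolding X_def .
qed

text \<open>
  The values of a linear map are combinations of finitely many fixed vectors with the continuous coordinates as
  coefficients.
\<close>

lemma linear_between_continuous:
  assumes T': "tvs smul' T'" and V: "finite_dimensional smul V" "V \<subseteq> topspace T"
    and f: "linear_between smul V smul' f" "f ` V \<subseteq> topspace T'"
  shows "continuous_map (subtopology T V) T' f"
proof -
  interpret B: top_vec_space smul' T'
    using T' unfolding top_vec_space_def top_vec_space_axioms_def rc_vector_space_def tvs_def by blast
  obtain B where B: "finite B" "independent B" "span B = V" "B \<subseteq> V"
    by (rule finite_dimensional_basis[OF V(1)])
  have "continuous_map (subtopology T V) T' (\<lambda>u. \<Sum>b\<in>B. smul' (representation B u b) (f b))"
  proof (rule B.continuous_map_Sum, rule B.continuous_map_scale)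
    fix b assume b: "b \<in> B"
    show "continuous_map (subtopology T V) euclidean (\<lambda>u. representation B u b)"
      using continuous_coordinate[OF B(1,2)] B(3,4) V(2) by blast
    show "continuous_map (subtopology T V) T' (\<lambda>u. f b)" using b f(2) B(4) by auto
  qed
  moreover have "(\<Sum>b\<in>B. smul' (representation B u b) (f b)) = f u" if "u \<in> V" for u
  proof -
    have "f (\<Sum>b\<in>B. smul (representation B u b) b) = (\<Sum>b\<in>B. smul' (representation B u b) (f b))"
      using linear_between_lincomb[OF vector_space_axioms B.vector_space_axioms
          subspace_of_finite_dimensional[OF V(1)] f(1), of B "\<lambda>b. b" "representation B u"] B(4) by blast
    then show ?thesis using sum_representation_eq[OF B(2) _ B(1)] that B(3) by simp
  qed
  ultimately show ?thesis by (rule continuous_map_eq) auto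
qed

lemma tvs_subtopology:
  assumes "subspace U" "U \<subseteq> topspace T"
  shows "tvs smul (subtopology T U)"
proof -
  let ?X = "subtopology T U"
  have top: "topspace ?X = U" using assms(2) by auto
  have incl: "continuous_map ?X T (\<lambda>x. x)" by (simp add: continuous_map_from_subtopology)
  have "continuous_map (prod_topology ?X ?X) T (\<lambda>p. fst p + snd p)"
    using continuous_map_compose[OF continuous_map_fst[of ?X ?X] incl]
      continuous_map_compose[OF continuous_map_snd[of ?X ?X] incl]
    by (intro continuous_map_add) (simp_all add: o_def)
  moreover have "(\<lambda>p. fst p + snd p) \<in> topspace (prod_topology ?X ?X) \<rightarrow> U"
  proof
    fix p assume "p \<in> topspace (prod_topology ?X ?X)"
    then have "fst p \<in> U" "snd p \<in> U" using top by (auto simp: mem_Times_iff)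
    then show "fst p + snd p \<in> U" by (rule subspace_add[OF assms(1)])
  qed
  ultimately have 1: "continuous_map (prod_topology ?X ?X) ?X (\<lambda>(x, y). x + y)"
    unfolding case_prod_beta by (rule continuous_map_into_subtopology)
  have "continuous_map (prod_topology euclidean ?X) T (\<lambda>p. smul (fst p) (snd p))"
    using continuous_map_compose[OF continuous_map_snd[of euclidean ?X] incl]
    by (intro continuous_map_scale continuous_map_fst) (simp_all add: o_def)
  moreover have "(\<lambda>p. smul (fst p) (snd p)) \<in> topspace (prod_topology euclidean ?X) \<rightarrow> U"
  proof
    fix p :: "'k \<times> 'v" assume "p \<in> topspace (prod_topology euclidean ?X)"
    then have "snd p \<in> U" using top by (auto simp: mem_Times_iff)
    then show "smul (fst p) (snd p) \<in> U" by (rule subspace_scale[OF assms(1)])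
  qed
  ultimately have 2: "continuous_map (prod_topology euclidean ?X) ?X (\<lambda>(c, x). smul c x)"
    unfolding case_prod_beta by (rule continuous_map_into_subtopology)
  show ?thesis unfolding tvs_def
    using assms(1) top 1 2 vector_space_axioms Hausdorff by (simp add: Hausdorff_space_subtopology)
qed

text \<open>
  The continuous projections are the components of the inverse of the addition map.
\<close>

lemma internal_direct_sumI:
  assumes I: "finite I" and V: "\<And>i. i \<in> I \<Longrightarrow> subrepresentation smul T \<rho> (V i)"
    and p: "\<And>i. i \<in> I \<Longrightarrow> continuous_map T T (p i)" "\<And>i x. i \<in> I \<Longrightarrow> x \<in> topspace T \<Longrightarrow> p i x \<in> V i"
    and p_sum: "\<And>x. x \<in> topspace T \<Longrightarrow> (\<Sum>i\<in>I. p i x) = x"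
    and indep: "\<And>x i. (\<And>i. i \<in> I \<Longrightarrow> x i \<in> V i) \<Longrightarrow> (\<Sum>i\<in>I. x i) = 0 \<Longrightarrow> i \<in> I \<Longrightarrow> x i = 0"
  shows "internal_direct_sum smul T \<rho> I V"
proof -
  let ?P = "product_topology (\<lambda>i. subtopology T (V i)) I"
  have sub: "subspace (V i)" "V i \<subseteq> topspace T" if "i \<in> I" for i
    using V[OF that] unfolding subrepresentation_def by auto
  have topP: "x i \<in> V i" if "x \<in> topspace ?P" "i \<in> I" for x i using that by auto
  have "continuous_map ?P T (\<lambda>x. x i)" if "i \<in> I" for i
    using continuous_map_product_projection[OF that, of "\<lambda>i. subtopology T (V i)"]
    by (simp add: continuous_map_in_subtopology)
  then have 1: "continuous_map ?P T (\<lambda>x. \<Sum>i\<in>I. x i)" by (rule continuous_map_Sum)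
  have 2: "continuous_map T ?P (\<lambda>x. \<lambda>i\<in>I. p i x)"
    unfolding continuous_map_componentwise using p
    by (auto simp: continuous_map_in_subtopology)
  have 3: "(\<lambda>i\<in>I. p i (\<Sum>i\<in>I. x i)) = x" if x: "x \<in> topspace ?P" for x
  proof
    fix i
    have xV: "x i \<in> V i" if "i \<in> I" for i using topP[OF x that] .
    have s: "(\<Sum>i\<in>I. x i) \<in> topspace T"
      using xV sub by (intro subspace_sum[OF subspace_topspace]) auto
    have "p i (\<Sum>i\<in>I. x i) - x i = 0" if "i \<in> I" for i
      using p(2)[OF _ s] xV sub p_sum[OF s] that
      by (intro indep[of "\<lambda>i. p i (\<Sum>i\<in>I. x i) - x i"]) (auto simp: subspace_diff sum_subtractf)
    then show "(\<lambda>i\<in>I. p i (\<Sum>i\<in>I. x i)) i = x i"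
      using x by (auto simp: PiE_iff extensional_def)
  qed
  have "homeomorphic_maps ?P T (\<lambda>x. \<Sum>i\<in>I. x i) (\<lambda>x. \<lambda>i\<in>I. p i x)"
    unfolding homeomorphic_maps_def using 1 2 3 p_sum by auto
  then have "homeomorphic_map ?P T (\<lambda>x. \<Sum>i\<in>I. x i)" using homeomorphic_map_maps by blast
  then show ?thesis unfolding internal_direct_sum_def using I V by blast
qed

end

lemma top_vec_spaceI: "tvs smul T \<Longrightarrow> top_vec_space smul T"
  unfolding top_vec_space_def top_vec_space_axioms_def rc_vector_space_def tvs_def by blast


section \<open>Products of topological vector spaces\<close>

lemma vector_space_scale_fun: "vector_space smul \<Longrightarrow> vector_space (scale_fun smul)"
  unfolding vector_space_def scale_fun_def by (auto simp: fun_eq_iff)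

lemma sum_fun_apply: "(\<Sum>i\<in>I. f i) x = (\<Sum>i\<in>I. f i x)"
  by (induction I rule: infinite_finite_induct) auto

lemma tvs_product_topology:
  assumes F: "\<And>j. tvs smul (F j)"
  shows "tvs (scale_fun smul) (product_topology F UNIV)"
proof -
  let ?P = "product_topology F UNIV"
  have smul: "vector_space smul" using F unfolding tvs_def by blast
  interpret A: vector_space smul by fact
  interpret P: vector_space "scale_fun smul" using smul by (rule vector_space_scale_fun)
  have F': "top_vec_space smul (F j)" for j using F by (rule top_vec_spaceI)
  have proj: "continuous_map ?P (F j) (\<lambda>x. x j)" for j
    by (rule continuous_map_product_projection) simp
  have "P.subspace (topspace ?P)"
    unfolding P.subspace_def topspace_product_topology scale_fun_def
    using top_vec_space.subspace_topspace[OF F'] by (auto simp: PiE_iff A.subspace_def)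
  moreover have "Hausdorff_space ?P"
    using top_vec_space.Hausdorff[OF F'] by (simp add: Hausdorff_space_product_topology)
  moreover have "continuous_map (prod_topology ?P ?P) ?P (\<lambda>(x, y). x + y)"
    unfolding continuous_map_componentwise_UNIV
  proof
    fix k
    have "continuous_map (prod_topology ?P ?P) (F k) (\<lambda>p. fst p k + snd p k)"
      using continuous_map_compose[OF continuous_map_fst[of ?P ?P] proj[of k]]
        continuous_map_compose[OF continuous_map_snd[of ?P ?P] proj[of k]]
      by (intro top_vec_space.continuous_map_add[OF F']) (simp_all add: o_def)
    then show "continuous_map (prod_topology ?P ?P) (F k) (\<lambda>p. (case p of (x, y) \<Rightarrow> x + y) k)"
      by (simp add: case_prod_beta)
  qed
  moreover have "continuous_map (prod_topology euclidean ?P) ?P (\<lambda>(c, x). scale_fun smul c x)"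
    unfolding continuous_map_componentwise_UNIV
  proof
    fix k
    have "continuous_map (prod_topology euclidean ?P) (F k) (\<lambda>p. smul (fst p) (snd p k))"
      using continuous_map_compose[OF continuous_map_snd[of euclidean ?P] proj[of k]]
      by (intro top_vec_space.continuous_map_scale[OF F'] continuous_map_fst) (simp_all add: o_def)
    then show "continuous_map (prod_topology euclidean ?P) (F k) (\<lambda>p. (case p of (c, x) \<Rightarrow> scale_fun smul c x) k)"
      by (simp add: case_prod_beta scale_fun_def)
  qed
  ultimately show ?thesis unfolding tvs_def using P.vector_space_axioms by blast
qed

lemma continuous_map_into_zero_space:
  "(\<And>x. x \<in> topspace X \<Longrightarrow> f x = 0) \<Longrightarrow> continuous_map X (discrete_topology {0}) f"
  by (rule continuous_map_eq[where f = "\<lambda>_. 0"]) auto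

lemma tvs_zero_space:
  assumes "vector_space smul"
  shows "tvs smul (discrete_topology {0})"
proof -
  interpret vector_space smul by fact
  show ?thesis unfolding tvs_def using assms
    by (auto simp: Hausdorff_space_discrete_topology intro!: continuous_map_into_zero_space)
qed

lemma tvs_prod_tvs:
  assumes "vector_space smul" "\<And>j. j \<in> J \<Longrightarrow> tvs smul (F j)"
  shows "tvs (scale_fun smul) (prod_tvs J F)"
  unfolding prod_tvs_def using assms tvs_zero_space[OF assms(1)] by (intro tvs_product_topology) auto

lemma tvs_euclidean: "tvs (*) (euclidean :: 'k::real_or_complex topology)"
proof -
  have "vector_space ((*) :: 'k \<Rightarrow> 'k \<Rightarrow> 'k)" by unfold_locales (auto simp: algebra_simps)
  moreover have "continuous_map euclidean (euclidean :: 'k topology) (\<lambda>(x, y). x + y)"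
    "continuous_map euclidean (euclidean :: 'k topology) (\<lambda>(x, y). x * y)"
    unfolding continuous_map_iff_continuous2 case_prod_beta by (intro continuous_intros)+
  ultimately show ?thesis
    unfolding tvs_def by (auto simp: euclidean_product_topology module.subspace_UNIV module_iff_vector_space prod_topology_euclidean)
qed

lemma tvs_coord_space: "tvs coord_scale (coord_space n)"
  using tvs_euclidean by (intro tvs_prod_tvs) (auto simp: tvs_def)


section \<open>Representations of compact groups\<close>

locale compact_rep = top_vec_space smul T
  for smul :: "'k::real_or_complex \<Rightarrow> 'v::ab_group_add \<Rightarrow> 'v" and T +
  fixes \<rho> :: "'g::topological_group_add \<Rightarrow> 'v \<Rightarrow> 'v"
  assumes compact_group: "compact (UNIV :: 'g set)"
    and rep: "Defs.representation smul T \<rho>"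
begin

abbreviation subrep :: "'v set \<Rightarrow> bool" where
  "subrep \<equiv> subrepresentation smul T \<rho>"

abbreviation fd :: "'v set \<Rightarrow> bool" where
  "fd \<equiv> finite_dimensional smul"

lemma rep_linear: "linear_between smul (topspace T) smul (\<rho> g)"
  using rep unfolding Defs.representation_def by blast

lemma rep_homeomorphic: "homeomorphic_map T T (\<rho> g)"
  using rep unfolding Defs.representation_def by blast

lemma rep_continuous: "continuous_map T T (\<rho> g)"
  using rep_homeomorphic homeomorphic_imp_continuous_map by blast

lemma rep_orbit_continuous: "x \<in> topspace T \<Longrightarrow> continuous_map euclidean T (\<lambda>g. \<rho> g x)"
  using rep unfolding Defs.representation_def by blast

lemma rep_in: "x \<in> topspace T \<Longrightarrow> \<rho> g x \<in> topspace T"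
  using rep_continuous continuous_map_image_subset_topspace by blast

lemma rep_add: "x \<in> topspace T \<Longrightarrow> \<rho> (g + h) x = \<rho> g (\<rho> h x)"
  using rep unfolding Defs.representation_def by blast

lemma rep_0: "x \<in> topspace T \<Longrightarrow> \<rho> 0 x = x"
proof -
  assume x: "x \<in> topspace T"
  have "inj_on (\<rho> 0) (topspace T)" using rep_homeomorphic homeomorphic_imp_injective_map by blast
  moreover have "\<rho> 0 (\<rho> 0 x) = \<rho> 0 x" using rep_add[OF x, of 0 0] by simp
  ultimately show ?thesis using x rep_in by (meson inj_onD)
qed

lemma rep_minus: "x \<in> topspace T \<Longrightarrow> \<rho> (- g) (\<rho> g x) = x" "x \<in> topspace T \<Longrightarrow> \<rho> g (\<rho> (- g) x) = x"
  using rep_add[of x "- g" g] rep_add[of x g "- g"] rep_0 by simp_all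

lemmas rep_lincomb = linear_between_lincomb[OF vector_space_axioms vector_space_axioms subspace_topspace rep_linear]
lemmas rep_plus = linear_between_add[OF vector_space_axioms vector_space_axioms subspace_topspace rep_linear]
lemmas rep_scale = linear_between_scale[OF vector_space_axioms vector_space_axioms subspace_topspace rep_linear]
lemmas rep_zero = linear_between_0[OF vector_space_axioms vector_space_axioms subspace_topspace rep_linear]

lemma subrep_subspace: "subrep V \<Longrightarrow> subspace V"
  unfolding subrepresentation_def by blast

lemma subrep_topspace: "subrep V \<Longrightarrow> V \<subseteq> topspace T"
  unfolding subrepresentation_def by blast

lemma subrep_invariant: "subrep V \<Longrightarrow> x \<in> V \<Longrightarrow> \<rho> g x \<in> V"
  unfolding subrepresentation_def by blast

lemma subrep_span:
  assumes "S \<subseteq> topspace T" "\<And>g x. x \<in> S \<Longrightarrow> \<rho> g x \<in> span S"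
  shows "subrep (span S)"
  unfolding subrepresentation_def
proof (intro conjI allI)
  show "span S \<subseteq> topspace T" using assms(1) subspace_topspace by (rule span_minimal)
  fix g
  have "\<rho> g ` span S = span (\<rho> g ` S)"
    using linear_between_image_span[OF vector_space_axioms vector_space_axioms subspace_topspace rep_linear assms(1)] .
  also have "\<dots> \<subseteq> span S" using assms(2) by (intro span_minimal) auto
  finally show "\<rho> g ` span S \<subseteq> span S" .
qed simp

lemma subrep_orbit_span:
  assumes "v \<in> topspace T"
  shows "subrep (orbit_span smul \<rho> v)"
  unfolding orbit_span_def
proof (rule subrep_span)
  fix g x assume "x \<in> range (\<lambda>g. \<rho> g v)"
  then obtain h where "x = \<rho> h v" by blast
  then have "\<rho> g x = \<rho> (g + h) v" using assms rep_add by simp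
  then show "\<rho> g x \<in> span (range (\<lambda>g. \<rho> g v))" by (simp add: span_base)
qed (use assms rep_in in auto)

lemma orbit_span_self: "v \<in> topspace T \<Longrightarrow> v \<in> orbit_span smul \<rho> v"
  unfolding orbit_span_def using rep_0[of v] by (metis rangeI span_base)

lemma orbit_span_minimal: "subrep V \<Longrightarrow> v \<in> V \<Longrightarrow> orbit_span smul \<rho> v \<subseteq> V"
  unfolding orbit_span_def using subrep_invariant subrep_subspace by (intro span_minimal) auto

text \<open>
  Matrices \<open>x\<close> over bases \<open>C\<close> of \<open>V\<close> and \<open>B \<supseteq> C\<close> of \<open>U\<close> encode linear maps \<open>p x\<close> from \<open>U\<close> to \<open>V\<close>. The group acts on
  them by conjugation, and \<open>A g\<close> below is the matrix of this action. Its entries are continuous functions on a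
  compact group, hence bounded. The projections onto \<open>V\<close> form a non-empty invariant closed affine set \<open>K\<close>.
  A fixed point of the group in \<open>K\<close> is an equivariant projection.
\<close>

theorem equivariant_projection:
  assumes U: "subrep U" "fd U" and V: "subrep V" "V \<subseteq> U"
  obtains p where "linear_between smul U smul p" "p ` U \<subseteq> V" "\<And>v. v \<in> V \<Longrightarrow> p v = v"
    "\<And>g u. u \<in> U \<Longrightarrow> p (\<rho> g u) = \<rho> g (p u)"
proof -
  note U_top = subrep_topspace[OF U(1)]
  obtain C where C: "finite C" "independent C" "span C = V" "C \<subseteq> V"
    by (rule finite_dimensional_basis[OF finite_dimensional_subspace[OF U(2) subrep_subspace[OF V(1)] V(2)]])
  obtain B where B: "C \<subseteq> B" "B \<subseteq> U" "independent B" "U \<subseteq> span B"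
    using maximal_independent_subset_extend[of C U] C V(2) by blast
  have span_B: "span B = U" using B subrep_subspace[OF U(1)] by (metis span_minimal subset_antisym)
  have fin_B: "finite B"
  proof -
    obtain S where "finite S" "U = span S" using U(2) unfolding finite_dimensional_def by blast
    then show ?thesis using independent_span_bound B by blast
  qed
  define r where "r = representation B"
  have r_sum: "r (\<Sum>i\<in>I. smul (c i) (u i)) b = (\<Sum>i\<in>I. c i * r (u i) b)"
    if "\<And>i. i \<in> I \<Longrightarrow> u i \<in> U" for I :: "'v set" and c u b
  proof -
    have "representation B (\<Sum>i\<in>I. smul (c i) (u i)) = (\<lambda>b. \<Sum>i\<in>I. representation B (smul (c i) (u i)) b)"
      using that B(3) span_B by (intro representation_sum) (auto intro: span_scale)
    then show ?thesis using that B(3) span_B unfolding r_def by (simp add: representation_scale)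
  qed
  have expand_U: "u = (\<Sum>b\<in>B. smul (r u b) b)" if "u \<in> U" for u
    unfolding r_def using sum_representation_eq[OF B(3) _ fin_B order_refl] that span_B by simp
  have expand_V: "v = (\<Sum>c\<in>C. smul (r v c) c)" if "v \<in> V" for v
  proof -
    have "r v = representation C v"
      unfolding r_def using representation_extend[OF B(3) _ B(1)] that C(3) by blast
    then show ?thesis using sum_representation_eq[OF C(2) _ C(1) order_refl] that C(3) by simp
  qed
  have r_basis: "r b d = (if d = b then 1 else 0)" if "b \<in> B" for b d
    unfolding r_def using representation_basis[OF B(3) that] by simp
  have r_V: "r v b = 0" if "v \<in> V" "b \<notin> C" for v b
    unfolding r_def using representation_extend[OF B(3) _ B(1), of v] that C(3)
      representation_ne_zero[of C v b] by auto
  have CV: "c \<in> V" "c \<in> U" "c \<in> B" if "c \<in> C" for c using that C B V by auto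
  have BU: "b \<in> U" if "b \<in> B" for b using that B by auto
  note inU = subrep_invariant[OF U(1)] and inV = subrep_invariant[OF V(1)]
  have coeff_V: "r (\<rho> g v) b = (\<Sum>c\<in>C. r v c * r (\<rho> g c) b)" if "v \<in> V" for g v b
  proof -
    have "\<rho> g (\<Sum>c\<in>C. smul (r v c) c) = (\<Sum>c\<in>C. smul (r v c) (\<rho> g c))"
      using CV U_top by (intro rep_lincomb) auto
    then have "\<rho> g v = (\<Sum>c\<in>C. smul (r v c) (\<rho> g c))" using expand_V[OF that] by simp
    then show ?thesis using r_sum CV inU by simp
  qed
  have coeff_U: "r (\<rho> g u) b = (\<Sum>d\<in>B. r u d * r (\<rho> g d) b)" if "u \<in> U" for g u b
  proof -
    have "\<rho> g (\<Sum>c\<in>B. smul (r u c) c) = (\<Sum>c\<in>B. smul (r u c) (\<rho> g c))"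
      using BU U_top by (intro rep_lincomb) auto
    then have "\<rho> g u = (\<Sum>c\<in>B. smul (r u c) (\<rho> g c))" using expand_U[OF that] by simp
    then show ?thesis using r_sum BU inU by simp
  qed

  define I where "I = C \<times> B"
  define A where "A = (\<lambda>g i j. r (\<rho> g (fst j)) (fst i) * r (\<rho> (- g) (snd i)) (snd j))"
  define p where "p = (\<lambda>(x :: 'v \<times> 'v \<Rightarrow> 'k) u. \<Sum>c\<in>C. smul (\<Sum>b\<in>B. x (c, b) * r u b) c)"
  define K where "K = {x :: 'v \<times> 'v \<Rightarrow> 'k. (\<forall>i. i \<notin> I \<longrightarrow> x i = 0) \<and>
    (\<forall>b\<in>C. \<forall>c\<in>C. x (c, b) = (if c = b then 1 else 0))}"
  have p_V: "p x u \<in> V" for x u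
    unfolding p_def using CV subrep_subspace[OF V(1)] by (intro subspace_sum subspace_scale) auto
  have r_p: "r (p x u) c = (\<Sum>b\<in>B. x (c, b) * r u b)" if "c \<in> C" for x u c
  proof -
    have "r (p x u) c = (\<Sum>d\<in>C. (\<Sum>b\<in>B. x (d, b) * r u b) * r d c)"
      unfolding p_def using CV by (intro r_sum) auto
    also have "\<dots> = (\<Sum>d\<in>C. if c = d then \<Sum>b\<in>B. x (d, b) * r u b else 0)"
      using CV r_basis by (intro sum.cong) auto
    finally show ?thesis using that C(1) by simp
  qed
  have p_id: "p x v = v" if "x \<in> K" "v \<in> V" for x v
  proof -
    have "(\<Sum>b\<in>B. x (c, b) * r v b) = r v c" if c: "c \<in> C" for c
    proof -
      have "(\<Sum>b\<in>B. x (c, b) * r v b) = (\<Sum>b\<in>C. x (c, b) * r v b)"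
        using B(1) fin_B r_V[OF \<open>v \<in> V\<close>] by (intro sum.mono_neutral_right) auto
      also have "\<dots> = (\<Sum>b\<in>C. if c = b then r v b else 0)"
        using \<open>x \<in> K\<close> c unfolding K_def by (intro sum.cong) auto
      finally show ?thesis using c C(1) by simp
    qed
    then show ?thesis unfolding p_def using expand_V[OF \<open>v \<in> V\<close>] by simp
  qed
  \<comment> \<open>Multiplication by \<open>A g\<close> turns the matrix of \<open>p x\<close> into that of its conjugate by \<open>g\<close>.\<close>
  have \<Phi>: "(if (c, b) \<in> I then \<Sum>j\<in>I. A g (c, b) j * x j else 0) =
      (if (c, b) \<in> I then r (\<rho> g (p x (\<rho> (- g) b))) c else 0)" for g x c b
  proof (cases "(c, b) \<in> I")
    case True
    have "(\<Sum>j\<in>I. A g (c, b) j * x j) =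
        (\<Sum>d\<in>C. \<Sum>e\<in>B. r (\<rho> g d) c * r (\<rho> (- g) b) e * x (d, e))"
      unfolding I_def A_def sum.cartesian_product by (simp add: case_prod_beta)
    also have "\<dots> = (\<Sum>d\<in>C. r (p x (\<rho> (- g) b)) d * r (\<rho> g d) c)"
      by (intro sum.cong) (auto simp: r_p sum_distrib_left sum_distrib_right mult_ac)
    also have "\<dots> = r (\<rho> g (p x (\<rho> (- g) b))) c"
      using coeff_V[OF p_V] by simp
    finally show ?thesis using True by simp
  qed simp
  have "\<exists>x\<in>K. \<forall>g. (\<lambda>i. if i \<in> I then \<Sum>j\<in>I. A g i j * x j else 0) = x"
  proof -
    have "bounded (range (\<lambda>g. r (\<rho> g u) b))" if "u \<in> U" for u b
    proof -
      have "continuous_map euclidean (subtopology T (span B)) (\<lambda>g. \<rho> g u)"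
        using rep_orbit_continuous[of u] that U_top inU span_B
        by (auto simp: continuous_map_in_subtopology)
      from continuous_map_compose[OF this continuous_coordinate[OF fin_B B(3)]]
      have "continuous_on UNIV (\<lambda>g. r (\<rho> g u) b)"
        unfolding r_def using B(2) U_top by (simp add: o_def)
      then show ?thesis using compact_group compact_continuous_image compact_imp_bounded by blast
    qed
    then have "\<exists>M. \<forall>g. norm (r (\<rho> g u) b) \<le> M" if "u \<in> U" for u b
      using that unfolding bounded_iff by auto
    then obtain N where N: "\<And>u b g. u \<in> U \<Longrightarrow> norm (r (\<rho> g u) b) \<le> N u b" by metis
    have N_nonneg: "N u b \<ge> 0" if "u \<in> U" for u b
      using N[OF that] norm_ge_zero order_trans by blast
    define M where "M = (\<Sum>i\<in>I. \<Sum>j\<in>I. N (fst j) (fst i) * N (snd i) (snd j))"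
    have I: "finite I" unfolding I_def using C(1) fin_B by simp
    show ?thesis
    proof (rule bounded_matrix_group_fixed_point[OF I, of A M K])
      fix g h i j assume "i \<in> I" "j \<in> I"
      then obtain c b c' b' where ij: "i = (c, b)" "j = (c', b')" "c \<in> C" "b \<in> B" "c' \<in> C" "b' \<in> B"
        unfolding I_def by auto
      have 1: "r (\<rho> (g + h) c') c = (\<Sum>d\<in>C. r (\<rho> h c') d * r (\<rho> g d) c)"
      proof -
        have "\<rho> (g + h) c' = \<rho> g (\<rho> h c')" using ij CV U_top rep_add by blast
        then show ?thesis using coeff_V[OF inV] ij CV by simp
      qed
      have 2: "r (\<rho> (- (g + h)) b) b' = (\<Sum>e\<in>B. r (\<rho> (- g) b) e * r (\<rho> (- h) e) b')"
      proof -
        have "\<rho> (- (g + h)) b = \<rho> (- h) (\<rho> (- g) b)"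
          using ij BU U_top rep_add[of b "- h" "- g"] by (auto simp: minus_add)
        then show ?thesis using coeff_U[OF inU] ij BU by simp
      qed
      show "A (g + h) i j = (\<Sum>l\<in>I. A g i l * A h l j)"
        unfolding A_def ij fst_conv snd_conv 1 2 unfolding I_def sum_product sum.cartesian_product
        by (intro sum.cong) (auto simp: mult_ac)
    next
      fix i j assume "i \<in> I" "j \<in> I"
      then obtain c b c' b' where ij: "i = (c, b)" "j = (c', b')" "c \<in> C" "b \<in> B" "c' \<in> C" "b' \<in> B"
        unfolding I_def by auto
      then have "c' \<in> topspace T" "b \<in> topspace T" using CV BU U_top by auto
      then show "A 0 i j = (if i = j then 1 else 0)"
        unfolding A_def using ij rep_0 CV r_basis by auto
    next
      fix g i j assume ij: "i \<in> I" "j \<in> I"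
      then have U': "fst i \<in> U" "fst j \<in> U" "snd i \<in> U" "snd j \<in> U" using CV BU unfolding I_def by auto
      have nonneg: "N (fst j) (fst i) * N (snd i) (snd j) \<ge> 0" if "i \<in> I" "j \<in> I" for i j
        using that CV BU unfolding I_def by (intro mult_nonneg_nonneg N_nonneg) auto
      have "norm (A g i j) \<le> N (fst j) (fst i) * N (snd i) (snd j)"
        unfolding A_def norm_mult using U' N N_nonneg by (intro mult_mono) auto
      also have "\<dots> \<le> (\<Sum>j\<in>I. N (fst j) (fst i) * N (snd i) (snd j))"
        using ij I nonneg by (intro member_le_sum) auto
      also have "\<dots> \<le> M"
        unfolding M_def using ij I nonneg by (intro member_le_sum[of i I]) (auto intro: sum_nonneg)
      finally show "norm (A g i j) \<le> M" .
    next
      have "(\<lambda>i. if i \<in> I \<and> fst i = snd i then 1 else 0) \<in> K"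
        unfolding K_def I_def using B(1) by auto
      then show "K \<noteq> {}" by blast
    next
      fix x i assume "x \<in> K" "i \<notin> I" then show "x i = 0" unfolding K_def by blast
    next
      fix x y assume "x \<in> K" "y \<in> K" then show "(\<lambda>i. (x i + y i) / 2) \<in> K" unfolding K_def by auto
    next
      fix X x assume X: "\<And>n. X n \<in> K" and lim: "\<And>i. (\<lambda>n. X n i) \<longlonglongrightarrow> x i"
      have "x i = a" if "\<And>n. X n i = a" for i a
        using lim[of i] that LIMSEQ_unique tendsto_const by fastforce
      then show "x \<in> K" using X unfolding K_def by auto
    next
      fix g x assume x: "x \<in> K"
      have "r (\<rho> g (p x (\<rho> (- g) b))) c = (if c = b then 1 else 0)" if "b \<in> C" "c \<in> C" for b c
      proof -
        have "b \<in> topspace T" using that CV U_top by auto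
        then show ?thesis using p_id[OF x inV] rep_minus that CV r_basis by simp
      qed
      then show "(\<lambda>i. if i \<in> I then \<Sum>j\<in>I. A g i j * x j else 0) \<in> K"
        unfolding K_def mem_Collect_eq \<Phi> using B(1) by (auto simp: I_def)
    qed
  qed
  then obtain x where x: "x \<in> K" and fixed_x: "\<forall>g. (\<lambda>i. if i \<in> I then \<Sum>j\<in>I. A g i j * x j else 0) = x"
    by blast
  have fixed: "(if i \<in> I then \<Sum>j\<in>I. A g i j * x j else 0) = x i" for g i
    using fun_cong[OF fixed_x[rule_format, of g], of i] by simp
  have p_lin: "linear_between smul U smul (p x)"
    unfolding linear_between_def
  proof (intro conjI ballI allI)
    fix u v assume uv: "u \<in> U" "v \<in> U"
    then have "r (u + v) b = r u b + r v b" for b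
      unfolding r_def using B(3) span_B by (simp add: representation_add)
    then show "p x (u + v) = p x u + p x v"
      unfolding p_def by (simp add: distrib_left sum.distrib scale_left_distrib)
  next
    fix c u assume u: "u \<in> U"
    then have "r (smul c u) b = c * r u b" for b
      unfolding r_def using B(3) span_B by (simp add: representation_scale)
    then show "p x (smul c u) = smul c (p x u)"
      unfolding p_def by (simp add: scale_sum_right sum_distrib_left mult.left_commute)
  qed
  have equiv: "p x (\<rho> g u) = \<rho> g (p x u)" if u: "u \<in> U" for g u
  proof -
    have p_U: "p x v \<in> topspace T" for v using p_V V(2) U_top by blast
    have basis: "p x (\<rho> g b) = \<rho> g (p x b)" if b: "b \<in> B" for g b
    proof -
      have bU: "b \<in> U" "b \<in> topspace T" using b BU U_top by auto
      have coeff: "r (p x b) c = r (\<rho> (- g) (p x (\<rho> g b))) c" if "c \<in> C" for c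
      proof -
        have "r (p x b) c = (\<Sum>d\<in>B. if b = d then x (c, d) else 0)"
          using r_p[OF that] r_basis[OF b] by (auto intro!: sum.cong)
        also have "\<dots> = x (c, b)" using b fin_B by simp
        also have "\<dots> = r (\<rho> (- g) (p x (\<rho> g b))) c"
          using fixed[of "(c, b)" "- g"] \<Phi>[of c b "- g" x] that b unfolding I_def by simp
        finally show ?thesis .
      qed
      have "p x b = (\<Sum>c\<in>C. smul (r (p x b) c) c)" by (rule expand_V[OF p_V])
      also have "\<dots> = (\<Sum>c\<in>C. smul (r (\<rho> (- g) (p x (\<rho> g b))) c) c)"
        using coeff by simp
      also have "\<dots> = \<rho> (- g) (p x (\<rho> g b))" by (rule expand_V[OF inV[OF p_V], symmetric])
      finally show ?thesis using rep_minus(2)[OF p_U] by metis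
    qed
    have "p x (\<rho> g u) = p x (\<Sum>b\<in>B. smul (r u b) (\<rho> g b))"
      using rep_lincomb[of B "\<lambda>b. b" g "r u"] expand_U[OF u] BU U_top by (metis subsetD)
    also have "\<dots> = (\<Sum>b\<in>B. smul (r u b) (p x (\<rho> g b)))"
      using BU inU by (intro linear_between_lincomb[OF vector_space_axioms vector_space_axioms subrep_subspace[OF U(1)] p_lin]) auto
    also have "\<dots> = (\<Sum>b\<in>B. smul (r u b) (\<rho> g (p x b)))" using basis by simp
    also have "\<dots> = \<rho> g (\<Sum>b\<in>B. smul (r u b) (p x b))" using p_U by (simp add: rep_lincomb)
    also have "(\<Sum>b\<in>B. smul (r u b) (p x b)) = p x (\<Sum>b\<in>B. smul (r u b) b)"
      using BU by (intro linear_between_lincomb[OF vector_space_axioms vector_space_axioms subrep_subspace[OF U(1)] p_lin, symmetric]) auto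
    also have "\<dots> = p x u" using expand_U[OF u] by simp
    finally show ?thesis .
  qed
  show thesis using that[OF p_lin] p_V p_id[OF x] equiv by blast
qed

end


section \<open>Isomorphic representations\<close>

lemma isomorphic_rep_sym:
  assumes iso: "isomorphic_rep smul T \<rho> smul' T' \<rho>'"
    and smul: "vector_space smul" "module.subspace smul (topspace T)"
    and inv: "\<And>g x. x \<in> topspace T \<Longrightarrow> \<rho> g x \<in> topspace T"
  shows "isomorphic_rep smul' T' \<rho>' smul T \<rho>"
proof -
  obtain f where f: "linear_between smul (topspace T) smul' f" "homeomorphic_map T T' f"
    "\<And>g x. x \<in> topspace T \<Longrightarrow> f (\<rho> g x) = \<rho>' g (f x)"
    using iso unfolding isomorphic_rep_def by blast
  have bij: "bij_betw f (topspace T) (topspace T')"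
    using f(2) by (simp add: bij_betw_def homeomorphic_imp_injective_map homeomorphic_imp_surjective_map)
  define h where "h = inv_into (topspace T) f"
  have hf: "h (f x) = x" if "x \<in> topspace T" for x
    unfolding h_def using bij that by (simp add: bij_betw_inv_into_left)
  have fh: "f (h y) = y" "h y \<in> topspace T" if "y \<in> topspace T'" for y
    unfolding h_def using bij that by (auto simp: bij_betw_inv_into_right bij_betw_def inv_into_into)
  have "linear_between smul' (topspace T') smul h"
    unfolding h_def by (rule linear_between_inv_into[OF smul f(1) bij])
  moreover have "homeomorphic_map T' T h"
  proof -
    obtain h' where h': "homeomorphic_maps T T' f h'" using f(2) homeomorphic_map_maps by blast
    then have "homeomorphic_map T' T h'" using homeomorphic_maps_map by blast
    moreover have "h' y = h y" if "y \<in> topspace T'" for y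
      using h' fh[OF that] unfolding homeomorphic_maps_def by metis
    ultimately show ?thesis using homeomorphic_map_eq by blast
  qed
  moreover have "h (\<rho>' g y) = \<rho> g (h y)" if "y \<in> topspace T'" for g y
    using f(3)[of "h y" g] fh[OF that] hf inv by metis
  ultimately show ?thesis unfolding isomorphic_rep_def by blast
qed

lemma isomorphic_rep_trans:
  assumes "isomorphic_rep s1 T1 \<rho>1 s2 T2 \<rho>2" "isomorphic_rep s2 T2 \<rho>2 s3 T3 \<rho>3"
  shows "isomorphic_rep s1 T1 \<rho>1 s3 T3 \<rho>3"
proof -
  obtain f where f: "linear_between s1 (topspace T1) s2 f" "homeomorphic_map T1 T2 f"
    "\<And>g x. x \<in> topspace T1 \<Longrightarrow> f (\<rho>1 g x) = \<rho>2 g (f x)"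
    using assms(1) unfolding isomorphic_rep_def by blast
  obtain h where h: "linear_between s2 (topspace T2) s3 h" "homeomorphic_map T2 T3 h"
    "\<And>g x. x \<in> topspace T2 \<Longrightarrow> h (\<rho>2 g x) = \<rho>3 g (h x)"
    using assms(2) unfolding isomorphic_rep_def by blast
  have img: "f ` topspace T1 = topspace T2" using f(2) homeomorphic_imp_surjective_map by blast
  have "linear_between s1 (topspace T1) s3 (\<lambda>x. h (f x))"
    by (rule linear_between_compose[OF f(1) h(1)]) (simp add: img)
  moreover have "homeomorphic_map T1 T3 (\<lambda>x. h (f x))"
    using homeomorphic_map_compose[OF f(2) h(2)] by (simp add: o_def)
  moreover have "h (f (\<rho>1 g x)) = \<rho>3 g (h (f x))" if "x \<in> topspace T1" for g x
    using f(3)[OF that] h(3)[of "f x" g] that img by auto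
  ultimately show ?thesis unfolding isomorphic_rep_def
    by (intro exI[of _ "\<lambda>x. h (f x)"]) blast
qed

lemma isomorphic_rep_refl: "isomorphic_rep smul T \<rho> smul T \<rho>"
  unfolding isomorphic_rep_def linear_between_def
  by (intro exI[of _ "\<lambda>x. x"]) (use homeomorphic_map_id[of T] in \<open>simp add: id_def\<close>)

lemma irreducible_rep_isomorphic:
  assumes iso: "isomorphic_rep smul T \<rho> smul' T' \<rho>'" and irr: "irreducible_rep smul' T' \<rho>'"
    and smul: "vector_space smul" "vector_space smul'" "module.subspace smul (topspace T)"
  shows "irreducible_rep smul T \<rho>"
proof -
  interpret A: vector_space smul by fact
  interpret B: vector_space smul' by fact
  obtain f where f: "linear_between smul (topspace T) smul' f" "homeomorphic_map T T' f"
    "\<And>g x. x \<in> topspace T \<Longrightarrow> f (\<rho> g x) = \<rho>' g (f x)"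
    using iso unfolding isomorphic_rep_def by blast
  have inj: "inj_on f (topspace T)" and img: "f ` topspace T = topspace T'"
    using f(2) homeomorphic_imp_injective_map homeomorphic_imp_surjective_map by blast+
  have f0: "f 0 = 0" by (rule linear_between_0[OF smul f(1)])
  have T0: "0 \<in> topspace T" using smul(3) A.subspace_0 by blast
  have "topspace T \<noteq> {0}" using irr img f0 unfolding irreducible_rep_def by auto
  moreover have "V = {0} \<or> V = topspace T" if V: "subrepresentation smul T \<rho> V" for V
  proof -
    have V': "V \<subseteq> topspace T" "A.subspace V" "\<And>g x. x \<in> V \<Longrightarrow> \<rho> g x \<in> V"
      using V unfolding subrepresentation_def by auto
    have "f ` A.span V = B.span (f ` V)" by (rule linear_between_image_span[OF smul f(1) V'(1)])
    then have "B.subspace (f ` V)" using V'(2) A.span_eq_iff by (metis B.subspace_span)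
    moreover have "\<rho>' g (f x) \<in> f ` V" if "x \<in> V" for g x
      using f(3)[of x g] that V' by (metis image_eqI subsetD)
    then have "\<rho>' g ` f ` V \<subseteq> f ` V" for g by blast
    ultimately have "subrepresentation smul' T' \<rho>' (f ` V)"
      unfolding subrepresentation_def using image_mono[OF V'(1), of f] img by blast
    then consider "f ` V = {0}" | "f ` V = topspace T'" using irr unfolding irreducible_rep_def by blast
    then show ?thesis
    proof cases
      case 1
      then have "x = 0" if "x \<in> V" for x
        using that inj V'(1) T0 f0 by (metis imageI inj_onD singletonD subsetD)
      then show ?thesis using V'(2) A.subspace_0 by blast
    next
      case 2
      then show ?thesis using inj V'(1) img by (metis inj_on_image_eq_iff order_refl)
    qed
  qed
  ultimately show ?thesis unfolding irreducible_rep_def by blast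
qed

text \<open>
  Linear maps from finite-dimensional spaces are continuous, and so are their inverses.
\<close>

lemma finite_dimensional_linear_homeomorphism:
  assumes T: "tvs smul T" and T': "tvs smul' T'"
    and W: "finite_dimensional smul W" "W \<subseteq> topspace T"
    and W': "W' \<subseteq> topspace T'"
    and f: "linear_between smul W smul' f" "bij_betw f W W'"
  shows "homeomorphic_map (subtopology T W) (subtopology T' W') f" "finite_dimensional smul' W'"
proof -
  interpret A: top_vec_space smul T using T by (rule top_vec_spaceI)
  interpret B: top_vec_space smul' T' using T' by (rule top_vec_spaceI)
  have subW: "A.subspace W" using W(1) by (rule A.subspace_of_finite_dimensional)
  have img: "f ` W = W'" using f(2) by (simp add: bij_betw_def)
  obtain S where S: "finite S" "W = A.span S" using W(1) unfolding finite_dimensional_def by blast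
  have "f ` A.span S = B.span (f ` S)"
    using S(2) A.span_superset
    by (intro linear_between_image_span[OF A.vector_space_axioms B.vector_space_axioms subW f(1)]) auto
  then show W'_fd: "finite_dimensional smul' W'"
    unfolding finite_dimensional_def using S img by (metis finite_imageI)
  define h where "h = inv_into W f"
  have h: "linear_between smul' W' smul h"
    unfolding h_def by (rule linear_between_inv_into[OF A.vector_space_axioms subW f])
  have hf: "h (f x) = x" if "x \<in> W" for x
    unfolding h_def using f(2) that by (simp add: bij_betw_inv_into_left)
  have fh: "f (h y) = y" "h y \<in> W" if "y \<in> W'" for y
    unfolding h_def using f(2) that by (auto simp: bij_betw_inv_into_right bij_betw_def inv_into_into)
  have "continuous_map (subtopology T W) T' f"
    using img W' by (intro A.linear_between_continuous[OF T' W f(1)]) auto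
  moreover have "continuous_map (subtopology T' W') T h"
    using fh W(2) by (intro B.linear_between_continuous[OF T W'_fd W' h]) auto
  ultimately have "homeomorphic_maps (subtopology T W) (subtopology T' W') f h"
    unfolding homeomorphic_maps_def using img hf fh W(2) W'
    by (auto simp: continuous_map_in_subtopology)
  then show "homeomorphic_map (subtopology T W) (subtopology T' W') f"
    using homeomorphic_map_maps by blast
qed

section \<open>Complete reducibility\<close>

context compact_rep
begin

text \<open>
  Irreducibility is required together with finite dimension, so that the projections of
  \<open>equivariant_projection\<close> are available.
\<close>

definition simple :: "'v set \<Rightarrow> bool" where
  "simple W \<longleftrightarrow> subrep W \<and> fd W \<and> irreducible_rep smul (subtopology T W) \<rho>"

lemma subrepresentation_subtopology:
  "U \<subseteq> topspace T \<Longrightarrow> subrepresentation smul (subtopology T U) \<rho> V \<longleftrightarrow> subrep V \<and> V \<subseteq> U"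
  unfolding subrepresentation_def by auto

lemma simple_iff:
  "simple W \<longleftrightarrow> subrep W \<and> fd W \<and> W \<noteq> {0} \<and> (\<forall>V. subrep V \<longrightarrow> V \<subseteq> W \<longrightarrow> V = {0} \<or> V = W)"
proof (cases "subrep W")
  case True
  then have "topspace (subtopology T W) = W" using subrep_topspace by auto
  then show ?thesis
    unfolding simple_def irreducible_rep_def using True subrepresentation_subtopology[OF subrep_topspace[OF True]] by auto
qed (simp add: simple_def)

lemma simpleD: "simple W \<Longrightarrow> subrep W" "simple W \<Longrightarrow> fd W" "simple W \<Longrightarrow> W \<noteq> {0}"
  "simple W \<Longrightarrow> subrep V \<Longrightarrow> V \<subseteq> W \<Longrightarrow> V = {0} \<or> V = W"
  unfolding simple_iff by blast+

definition equivariant :: "'v set \<Rightarrow> ('v \<Rightarrow> 'v) \<Rightarrow> bool" where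
  "equivariant W f \<longleftrightarrow> linear_between smul W smul f \<and> (\<forall>g. \<forall>w\<in>W. f (\<rho> g w) = \<rho> g (f w))"

lemma subrep_kernel:
  assumes W: "subrep W" and f: "equivariant W f"
  shows "subrep {w \<in> W. f w = 0}"
proof -
  have lin: "linear_between smul W smul f" using f unfolding equivariant_def by blast
  note l = vector_space_axioms vector_space_axioms subrep_subspace[OF W] lin
  have "subspace {w \<in> W. f w = 0}"
    using subrep_subspace[OF W] linear_between_0[OF l] linear_between_add[OF l] linear_between_scale[OF l]
    unfolding subspace_def by auto
  then show ?thesis
    using subrep_topspace[OF W] subrep_invariant[OF W] f rep_zero
    unfolding subrepresentation_def equivariant_def by auto
qed

lemma subrep_image:
  assumes W: "subrep W" and f: "equivariant W f" "f ` W \<subseteq> topspace T"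
  shows "subrep (f ` W)"
proof -
  have lin: "linear_between smul W smul f" using f unfolding equivariant_def by blast
  have "f ` span W = span (f ` W)"
    using linear_between_image_span[OF vector_space_axioms vector_space_axioms subrep_subspace[OF W] lin order_refl] .
  then have "subspace (f ` W)" using subrep_subspace[OF W] span_eq_iff by (metis subspace_span)
  moreover have "\<rho> g (f w) \<in> f ` W" if "w \<in> W" for g w
    using f(1) that subrep_invariant[OF W that] unfolding equivariant_def by (metis image_eqI)
  ultimately show ?thesis using f(2) unfolding subrepresentation_def by auto
qed

lemma Schur:
  assumes W: "simple W" and V: "simple V" and f: "equivariant W f" "f ` W \<subseteq> V" and ne: "w \<in> W" "f w \<noteq> 0"
  shows "bij_betw f W V"
proof -
  note W' = simpleD[OF W] and V' = simpleD[OF V]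
  have lin: "linear_between smul W smul f" using f unfolding equivariant_def by blast
  note l = vector_space_axioms vector_space_axioms subrep_subspace[OF W'(1)] lin
  have "{w \<in> W. f w = 0} = {0}"
    using W'(4)[OF subrep_kernel[OF W'(1) f(1)]] ne by blast
  then have "inj_on f W"
    using linear_between_diff[OF l] subspace_diff[OF subrep_subspace[OF W'(1)]]
    by (intro inj_onI) (metis (mono_tags, lifting) eq_iff_diff_eq_0 mem_Collect_eq singletonD)
  moreover have "f ` W = V"
    using V'(4)[OF subrep_image[OF W'(1) f(1)] f(2)] f(2) subrep_topspace[OF V'(1)] ne by blast
  ultimately show ?thesis by (simp add: bij_betw_def)
qed

lemma simple_subrep_exists:
  assumes "subrep U" "fd U" "U \<noteq> {0}"
  obtains V where "simple V" "V \<subseteq> U"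
proof -
  define P where "P = (\<lambda>V. subrep V \<and> V \<subseteq> U \<and> V \<noteq> {0})"
  have "P U" unfolding P_def using assms by blast
  then obtain V where V: "P V" "\<And>W. P W \<Longrightarrow> dim V \<le> dim W"
    using arg_min_nat_lemma[of P U dim] by blast
  have fdV: "fd V" using V(1) assms(2) finite_dimensional_subspace subrep_subspace unfolding P_def by blast
  have "W = {0} \<or> W = V" if "subrep W" "W \<subseteq> V" for W
    using dim_less_finite_dimensional[OF fdV subrep_subspace[OF that(1)] that(2)] V that
    unfolding P_def by (meson leD order_trans)
  then have "simple V" unfolding simple_iff using V(1) fdV unfolding P_def by blast
  then show thesis using that V(1) unfolding P_def by blast
qed

text \<open>
  Split off one irreducible subrepresentation with an equivariant projection, and continue with its kernel. The
  decomposition is stated algebraically, in the form suited to induction on the dimension; its topological form follows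
  in \<open>complete_reducibility\<close>.
\<close>

lemma simple_decomposition:
  assumes "subrep U" "fd U"
  shows "\<exists>(m::nat) V. (\<forall>i<m. simple (V i) \<and> V i \<subseteq> U) \<and>
    (\<forall>u\<in>U. \<exists>x. (\<forall>i<m. x i \<in> V i) \<and> u = (\<Sum>i<m. x i)) \<and>
    (\<forall>x. (\<forall>i<m. x i \<in> V i) \<longrightarrow> (\<Sum>i<m. x i) = 0 \<longrightarrow> (\<forall>i<m. x i = 0))"
  using assms
proof (induction "dim U" arbitrary: U rule: less_induct)
  case less
  show ?case
  proof (cases "U = {0}")
    case True
    then show ?thesis by (intro exI[of _ 0]) auto
  next
    case False
    then obtain V0 where V0: "simple V0" "V0 \<subseteq> U" using simple_subrep_exists less.prems by blast
    obtain p where p: "linear_between smul U smul p" "p ` U \<subseteq> V0" "\<And>v. v \<in> V0 \<Longrightarrow> p v = v"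
      "\<And>g u. u \<in> U \<Longrightarrow> p (\<rho> g u) = \<rho> g (p u)"
      using equivariant_projection[OF less.prems simpleD(1)[OF V0(1)] V0(2)] by metis
    note l = vector_space_axioms vector_space_axioms subrep_subspace[OF less.prems(1)] p(1)
    define K where "K = {u \<in> U. p u = 0}"
    have K: "subrep K"
      unfolding K_def using p less.prems(1) by (intro subrep_kernel) (auto simp: equivariant_def)
    have subV0: "subspace V0" using simpleD(1)[OF V0(1)] by (rule subrep_subspace)
    obtain v where "v \<in> V0" "v \<noteq> 0" using simpleD(3)[OF V0(1)] subV0 subspace_0 by blast
    then have "v \<notin> K" "v \<in> U" unfolding K_def using p(3) V0(2) by auto
    then have "K \<noteq> U" by blast
    then have "dim K < dim U"
      using dim_less_finite_dimensional[OF less.prems(2) subrep_subspace[OF K]] unfolding K_def by blast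
    moreover have "fd K"
      using finite_dimensional_subspace[OF less.prems(2) subrep_subspace[OF K]] unfolding K_def by blast
    ultimately have "\<exists>(m::nat) V. (\<forall>i<m. simple (V i) \<and> V i \<subseteq> K) \<and>
      (\<forall>u\<in>K. \<exists>x. (\<forall>i<m. x i \<in> V i) \<and> u = (\<Sum>i<m. x i)) \<and>
      (\<forall>x. (\<forall>i<m. x i \<in> V i) \<longrightarrow> (\<Sum>i<m. x i) = 0 \<longrightarrow> (\<forall>i<m. x i = 0))"
      by (intro less.hyps K)
    then obtain m :: nat and V where V: "\<forall>i<m. simple (V i) \<and> V i \<subseteq> K"
      "\<forall>u\<in>K. \<exists>x. (\<forall>i<m. x i \<in> V i) \<and> u = (\<Sum>i<m. x i)"
      "\<forall>x. (\<forall>i<m. x i \<in> V i) \<longrightarrow> (\<Sum>i<m. x i) = 0 \<longrightarrow> (\<forall>i<m. x i = 0)"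
      by (elim exE conjE)
    define V' where "V' = V(m := V0)"
    have KU: "K \<subseteq> U" unfolding K_def by blast
    have "\<forall>i<Suc m. simple (V' i) \<and> V' i \<subseteq> U"
      unfolding V'_def using V(1) V0 KU by (auto simp: less_Suc_eq)
    moreover have "\<exists>x. (\<forall>i<Suc m. x i \<in> V' i) \<and> u = (\<Sum>i<Suc m. x i)" if u: "u \<in> U" for u
    proof -
      have pu: "p u \<in> V0" "p u \<in> U" using p(2) u V0(2) by auto
      have "u - p u \<in> K"
        unfolding K_def using u pu p(3) linear_between_diff[OF l] subspace_diff[OF subrep_subspace[OF less.prems(1)]] by simp
      then obtain x where x: "\<forall>i<m. x i \<in> V i" "u - p u = (\<Sum>i<m. x i)" using V(2) by blast
      have "(\<Sum>i<Suc m. (x(m := p u)) i) = u"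
        using x(2) by (simp add: algebra_simps)
      moreover have "\<forall>i<Suc m. (x(m := p u)) i \<in> V' i"
        unfolding V'_def using x(1) pu by (auto simp: less_Suc_eq)
      ultimately show ?thesis by metis
    qed
    moreover have "\<forall>i<Suc m. x i = 0"
      if x: "\<forall>i<Suc m. x i \<in> V' i" and s: "(\<Sum>i<Suc m. x i) = 0" for x
    proof -
      have xV: "x i \<in> V i" if "i < m" for i using x that unfolding V'_def by (auto dest: spec[of _ i])
      have xm: "x m \<in> V0" using x unfolding V'_def by (auto dest: spec[of _ m])
      have xK: "(\<Sum>i<m. x i) \<in> K" using xV V(1) subrep_subspace[OF K] by (intro subspace_sum) auto
      have "x m = p (x m)" using p(3) xm by simp
      also have "\<dots> = p (\<Sum>i<m. x i) + p (x m)" using xK unfolding K_def by simp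
      also have "\<dots> = p (\<Sum>i<Suc m. x i)"
        using linear_between_add[OF l, of "\<Sum>i<m. x i" "x m"] xK KU xm V0(2) by (simp add: subset_iff)
      also have "\<dots> = 0" using s linear_between_0[OF l] by simp
      finally have "x m = 0" .
      then have "(\<Sum>i<m. x i) = 0" using s by simp
      then show ?thesis using V(3) xV \<open>x m = 0\<close> by (auto simp: less_Suc_eq)
    qed
    ultimately show ?thesis by blast
  qed
qed

theorem complete_reducibility:
  assumes "subrep U" "fd U"
  obtains m :: nat and V where "\<And>i. i < m \<Longrightarrow> simple (V i)" "\<And>i. i < m \<Longrightarrow> V i \<subseteq> U"
    "internal_direct_sum smul (subtopology T U) \<rho> {..<m} V"
    "\<And>u. u \<in> U \<Longrightarrow> \<exists>x. (\<forall>i<m. x i \<in> V i) \<and> u = (\<Sum>i<m. x i)"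
proof -
  obtain m :: nat and V where V: "\<forall>i<m. simple (V i) \<and> V i \<subseteq> U"
      "\<forall>u\<in>U. \<exists>x. (\<forall>i<m. x i \<in> V i) \<and> u = (\<Sum>i<m. x i)"
      "\<forall>x. (\<forall>i<m. x i \<in> V i) \<longrightarrow> (\<Sum>i<m. x i) = 0 \<longrightarrow> (\<forall>i<m. x i = 0)"
    using simple_decomposition[OF assms] by (elim exE conjE)
  note U = subrep_topspace[OF assms(1)] and Us = subrep_subspace[OF assms(1)]
  obtain q where q: "\<And>u. u \<in> U \<Longrightarrow> (\<forall>i<m. q u i \<in> V i) \<and> u = (\<Sum>i<m. q u i)" using V(2) by metis
  have Vs: "subspace (V i)" if "i < m" for i using V(1) that simpleD(1) subrep_subspace by blast
  have q_eq: "q u i = x i" if "u \<in> U" "\<And>i. i < m \<Longrightarrow> x i \<in> V i" "u = (\<Sum>i<m. x i)" "i < m" for u x i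
  proof -
    have "\<forall>i<m. q u i - x i \<in> V i" using q[OF that(1)] that(2) Vs subspace_diff by blast
    moreover have "(\<Sum>i<m. q u i - x i) = 0" using q[OF that(1)] that(3) by (simp add: sum_subtractf)
    ultimately have "\<forall>i<m. q u i - x i = 0" using V(3)[rule_format, of "\<lambda>i. q u i - x i"] by blast
    then show ?thesis using that(4) by simp
  qed
  have q_lin: "linear_between smul U smul (\<lambda>u. q u i)" if i: "i < m" for i
    unfolding linear_between_def
  proof (intro conjI ballI allI)
    fix u v assume uv: "u \<in> U" "v \<in> U"
    show "q (u + v) i = q u i + q v i"
      using q[OF uv(1)] q[OF uv(2)] uv Vs i Us
      by (intro q_eq[of "u + v" "\<lambda>i. q u i + q v i"]) (auto simp: subspace_add sum.distrib)
  next
    fix c u assume u: "u \<in> U"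
    show "q (smul c u) i = smul c (q u i)"
    proof (intro q_eq[of "smul c u" "\<lambda>i. smul c (q u i)"] i)
      show "smul c u = (\<Sum>i<m. smul c (q u i))"
        using q[OF u] by (metis scale_sum_right)
    qed (use q[OF u] u Us Vs in \<open>auto simp: subspace_scale\<close>)
  qed
  have X: "tvs smul (subtopology T U)" using Us U by (rule tvs_subtopology)
  have "internal_direct_sum smul (subtopology T U) \<rho> {..<m} V"
  proof (rule top_vec_space.internal_direct_sumI[OF top_vec_spaceI[OF X], where p = "\<lambda>i u. q u i"])
    fix i assume i: "i \<in> {..<m}"
    show "subrepresentation smul (subtopology T U) \<rho> (V i)"
      using V(1) i simpleD(1) subrepresentation_subtopology[OF U] by auto
    have "continuous_map (subtopology T U) T (\<lambda>u. q u i)"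
      using i q q_lin V(1) U by (intro linear_between_continuous[OF tvs assms(2) U]) blast+
    moreover have "q u i \<in> U" if "u \<in> U" for u using q[OF that] V(1) i by auto
    ultimately show "continuous_map (subtopology T U) (subtopology T U) (\<lambda>u. q u i)"
      by (auto simp: continuous_map_in_subtopology)
  next
    fix x i assume "\<And>i. i \<in> {..<m} \<Longrightarrow> x i \<in> V i" "(\<Sum>i<m. x i) = 0" "i \<in> {..<m}"
    then show "x i = 0" using V(3) by auto
  next
    fix x i assume "i \<in> {..<m}" "x \<in> topspace (subtopology T U)"
    then show "q x i \<in> V i" using q[of x] by auto
  next
    fix x assume "x \<in> topspace (subtopology T U)"
    then show "(\<Sum>i<m. q x i) = x" using q[of x] by auto
  qed simp
  then show thesis using that[of m V] V(1,2) by blast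
qed

lemma finite_dimensional_span_Union:
  assumes "finite \<W>" "\<And>W. W \<in> \<W> \<Longrightarrow> fd W"
  shows "fd (span (\<Union>\<W>))"
  using assms
proof (induction \<W>)
  case empty
  then show ?case unfolding finite_dimensional_def by auto
next
  case (insert W \<W>)
  have "span (W \<union> span (\<Union>\<W>)) = span (\<Union>(insert W \<W>))"
    by (simp add: span_Un span_span)
  then show ?case
    using finite_dimensional_span_Un(1)[of W "span (\<Union>\<W>)"] insert by auto
qed

lemma subrep_span_Union:
  assumes "\<And>W. W \<in> \<W> \<Longrightarrow> subrep W"
  shows "subrep (span (\<Union>\<W>))"
  using assms subrep_topspace subrep_invariant by (intro subrep_span) (auto intro!: span_base)

text \<open>
  The finitely many members of \<open>\<W>\<close> needed to express one non-zero vector of \<open>V\<close> already span a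
  subrepresentation that contains all of \<open>V\<close>. An equivariant projection of their span onto \<open>V\<close> is non-zero on one of
  them, which is isomorphic to \<open>V\<close> by Schur's lemma.
\<close>

lemma simple_in_span_Union:
  assumes V: "simple V" "V \<subseteq> span (\<Union>\<W>)" and \<W>: "\<And>W. W \<in> \<W> \<Longrightarrow> simple W"
  obtains W f where "W \<in> \<W>" "equivariant W f" "bij_betw f W V"
proof -
  note V' = simpleD[OF V(1)]
  obtain v where v: "v \<in> V" "v \<noteq> 0" using V'(3) subrep_subspace[OF V'(1)] subspace_0 by blast
  obtain t r where t: "finite t" "t \<subseteq> \<Union>\<W>" "v = (\<Sum>a\<in>t. smul (r a) a)"
    using v(1) V(2) unfolding span_explicit' by (smt (verit) mem_Collect_eq subsetD span_alt span_explicit')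
  obtain w where w: "\<And>a. a \<in> t \<Longrightarrow> w a \<in> \<W> \<and> a \<in> w a" using t(2) by (meson UnionE subsetD)
  define U where "U = span (\<Union>(w ` t))"
  have simple_w: "simple W" if "W \<in> w ` t" for W using that w \<W> by blast
  have U: "subrep U" "fd U"
    unfolding U_def using simple_w simpleD t(1)
    by (auto intro!: subrep_span_Union finite_dimensional_span_Union)
  have "v \<in> U"
    unfolding t(3) U_def using w by (intro span_sum span_scale span_base) blast
  have "V \<inter> U = V"
  proof -
    have "subrep (V \<inter> U)"
      using V'(1) U(1) subspace_inter[of V U] unfolding subrepresentation_def by blast
    then show ?thesis using V'(4)[of "V \<inter> U"] v \<open>v \<in> U\<close> by auto
  qed
  then have VU: "V \<subseteq> U" by blast
  obtain p where p: "linear_between smul U smul p" "p ` U \<subseteq> V" "\<And>v. v \<in> V \<Longrightarrow> p v = v"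
      "\<And>g u. u \<in> U \<Longrightarrow> p (\<rho> g u) = \<rho> g (p u)"
    using equivariant_projection[OF U V'(1) VU] by metis
  have wU: "W \<subseteq> U" if "W \<in> w ` t" for W
    unfolding U_def using that span_superset[of "\<Union>(w ` t)"] by blast
  have "\<exists>a\<in>t. p a \<noteq> 0"
  proof (rule ccontr)
    assume "\<not> (\<exists>a\<in>t. p a \<noteq> 0)"
    moreover have "p v = (\<Sum>a\<in>t. smul (r a) (p a))"
      unfolding t(3) using w wU
      by (intro linear_between_lincomb[OF vector_space_axioms vector_space_axioms subrep_subspace[OF U(1)] p(1)]) blast
    ultimately have "p v = 0" by simp
    then show False using p(3) v by simp
  qed
  then obtain a where a: "a \<in> t" "p a \<noteq> 0" by blast
  have sub: "w a \<subseteq> U" using wU a(1) by blast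
  have "equivariant (w a) p"
    unfolding equivariant_def using linear_between_subset[OF p(1) sub] p(4) sub by blast
  moreover have "bij_betw p (w a) V"
    using Schur[OF _ V(1) calculation, of a] \<W> w[OF a(1)] a(2) p(2) sub by blast
  ultimately show thesis using that w[OF a(1)] by blast
qed

end


section \<open>Isomorphism classes of irreducible representations\<close>

lemma irrepsD:
  assumes "(n, \<sigma>) \<in> irreps"
  shows "Defs.representation coord_scale (coord_space n) \<sigma>" "irreducible_rep coord_scale (coord_space n) \<sigma>"
    "x \<in> topspace (coord_space n) \<Longrightarrow> \<sigma> g x \<in> topspace (coord_space n)"
proof -
  show 1: "Defs.representation coord_scale (coord_space n) \<sigma>" "irreducible_rep coord_scale (coord_space n) \<sigma>"
    using assms unfolding irreps_def by auto
  show "\<sigma> g x \<in> topspace (coord_space n)" if "x \<in> topspace (coord_space n)"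
    using 1(1) that unfolding Defs.representation_def
    by (metis homeomorphic_imp_surjective_map image_eqI)
qed

lemma coord_space_facts:
  "vector_space (coord_scale :: 'k::real_or_complex \<Rightarrow> _)"
  "module.subspace (coord_scale :: 'k \<Rightarrow> _) (topspace (coord_space n))"
  using tvs_coord_space[where ?'a = 'k, of n] unfolding tvs_def by auto

lemma equiv_irrep_iso:
  "equiv (irreps :: ('g::topological_group_add, 'k::real_or_complex) coord_rep set) irrep_iso"
proof (rule equivI)
  show "refl_on irreps (irrep_iso :: ('g, 'k) coord_rep rel)"
    unfolding refl_on_def irrep_iso_def using isomorphic_rep_refl by auto
  show "sym (irrep_iso :: ('g, 'k) coord_rep rel)"
  proof (rule symI)
    fix p q :: "('g, 'k) coord_rep"
    assume "(p, q) \<in> irrep_iso"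
    then obtain n \<sigma> m \<tau> where pq: "p = (n, \<sigma>)" "q = (m, \<tau>)" "(n, \<sigma>) \<in> irreps" "(m, \<tau>) \<in> irreps"
      and iso: "isomorphic_rep coord_scale (coord_space n) \<sigma> coord_scale (coord_space m) \<tau>"
      unfolding irrep_iso_def by blast
    show "(q, p) \<in> irrep_iso"
      unfolding irrep_iso_def using pq isomorphic_rep_sym[OF iso coord_space_facts irrepsD(3)[OF pq(3)]] by simp
  qed
  show "trans (irrep_iso :: ('g, 'k) coord_rep rel)"
    unfolding trans_def irrep_iso_def using isomorphic_rep_trans by blast
qed (auto simp: irrep_iso_def)

lemma irrep_class_subset: "\<alpha> \<in> irrep_classes \<Longrightarrow> \<alpha> \<subseteq> irreps"
  unfolding irrep_classes_def using equiv_irrep_iso in_quotient_imp_subset by blast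

lemma irrep_class_eq:
  assumes "\<alpha> \<in> irrep_classes" "\<beta> \<in> irrep_classes" "(n, \<sigma>) \<in> \<alpha>" "(m, \<tau>) \<in> \<beta>"
    and "isomorphic_rep coord_scale (coord_space n) \<sigma> coord_scale (coord_space m) \<tau>"
  shows "\<alpha> = \<beta>"
proof -
  have "((n, \<sigma>), (m, \<tau>)) \<in> irrep_iso"
    unfolding irrep_iso_def using assms irrep_class_subset by blast
  then show ?thesis
    using assms quotient_eq_iff[OF equiv_irrep_iso] unfolding irrep_classes_def by blast
qed

lemma isomorphic_rep_finite_dimensionalI:
  assumes "tvs smul T" "tvs smul' T'" "finite_dimensional smul W" "W \<subseteq> topspace T" "W' \<subseteq> topspace T'"
    and "linear_between smul W smul' f" "bij_betw f W W'" "\<And>g x. x \<in> W \<Longrightarrow> f (\<rho> g x) = \<rho>' g (f x)"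
  shows "isomorphic_rep smul (subtopology T W) \<rho> smul' (subtopology T' W') \<rho>'"
proof -
  have "topspace (subtopology T W) = W" using assms(4) by auto
  then show ?thesis
    using finite_dimensional_linear_homeomorphism(1)[OF assms(1-7)] assms(6,8)
    unfolding isomorphic_rep_def by (intro exI[of _ f]) simp
qed

context compact_rep
begin

definition has_class :: "'v set \<Rightarrow> ('g, 'k) coord_rep set \<Rightarrow> bool" where
  "has_class W \<alpha> \<longleftrightarrow>
     (\<exists>(n, \<sigma>)\<in>\<alpha>. isomorphic_rep smul (subtopology T W) \<rho> coord_scale (coord_space n) \<sigma>)"

lemma topspace_subrep: "subrep W \<Longrightarrow> topspace (subtopology T W) = W"
  using subrep_topspace by auto

lemma isomorphic_rep_sym_subrep:
  assumes "subrep W" "isomorphic_rep smul (subtopology T W) \<rho> smul' T' \<rho>'"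
  shows "isomorphic_rep smul' T' \<rho>' smul (subtopology T W) \<rho>"
proof -
  have "subspace (topspace (subtopology T W))"
    using assms(1) topspace_subrep subrep_subspace by simp
  moreover have "\<rho> g x \<in> topspace (subtopology T W)" if "x \<in> topspace (subtopology T W)" for g x
    using that assms(1) topspace_subrep subrep_invariant by simp
  ultimately show ?thesis using isomorphic_rep_sym[OF assms(2) vector_space_axioms] by blast
qed

lemma has_class_unique:
  assumes "subrep W" "has_class W \<alpha>" "has_class W \<beta>" "\<alpha> \<in> irrep_classes" "\<beta> \<in> irrep_classes"
  shows "\<alpha> = \<beta>"
proof -
  obtain n \<sigma> where 1: "(n, \<sigma>) \<in> \<alpha>" "isomorphic_rep smul (subtopology T W) \<rho> coord_scale (coord_space n) \<sigma>"
    using assms(2) unfolding has_class_def by blast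
  obtain m \<tau> where 2: "(m, \<tau>) \<in> \<beta>" "isomorphic_rep smul (subtopology T W) \<rho> coord_scale (coord_space m) \<tau>"
    using assms(3) unfolding has_class_def by blast
  have "isomorphic_rep coord_scale (coord_space n) \<sigma> coord_scale (coord_space m) \<tau>"
    using isomorphic_rep_trans[OF isomorphic_rep_sym_subrep[OF assms(1) 1(2)] 2(2)] .
  then show ?thesis using irrep_class_eq 1(1) 2(1) assms(4,5) by blast
qed

lemma has_class_irreducible:
  assumes "subrep W" "has_class W \<alpha>" "\<alpha> \<in> irrep_classes"
  shows "irreducible_rep smul (subtopology T W) \<rho>"
proof -
  obtain n \<sigma> where 1: "(n, \<sigma>) \<in> \<alpha>" "isomorphic_rep smul (subtopology T W) \<rho> coord_scale (coord_space n) \<sigma>"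
    using assms(2) unfolding has_class_def by blast
  have "irreducible_rep coord_scale (coord_space n) \<sigma>"
    using 1(1) irrep_class_subset[OF assms(3)] irrepsD(2) by blast
  then show ?thesis
    using irreducible_rep_isomorphic[OF 1(2) _ vector_space_axioms coord_space_facts(1)]
      subrep_subspace[OF assms(1)] topspace_subrep[OF assms(1)] by simp
qed

lemma has_class_equivariant:
  assumes W: "simple W" "has_class W \<alpha>" and V: "simple V" and f: "equivariant W f" "bij_betw f W V"
  shows "has_class V \<alpha>"
proof -
  note W' = simpleD[OF W(1)] and V' = simpleD[OF V]
  have "isomorphic_rep smul (subtopology T W) \<rho> smul (subtopology T V) \<rho>"
    using f(1) unfolding equivariant_def
    by (intro isomorphic_rep_finite_dimensionalI[OF tvs tvs W'(2) subrep_topspace[OF W'(1)]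
          subrep_topspace[OF V'(1)] _ f(2)]) auto
  then have "isomorphic_rep smul (subtopology T V) \<rho> smul (subtopology T W) \<rho>"
    by (rule isomorphic_rep_sym_subrep[OF W'(1)])
  then show ?thesis using W(2) isomorphic_rep_trans unfolding has_class_def by blast
qed

text \<open>
  Transporting the representation along coordinates with respect to a basis gives a representation on a space of
  tuples.
\<close>

theorem simple_has_class:
  assumes W: "simple W"
  obtains \<alpha> where "\<alpha> \<in> irrep_classes" "has_class W \<alpha>"
proof -
  note W' = simpleD[OF W]
  note subW = subrep_subspace[OF W'(1)] and WT = subrep_topspace[OF W'(1)] and inv = subrep_invariant[OF W'(1)]
  obtain B where B: "finite B" "independent B" "span B = W" "B \<subseteq> W"
    by (rule finite_dimensional_basis[OF W'(2)])
  define n where "n = card B"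
  obtain e where e: "bij_betw e {..<n} B"
    using ex_bij_betw_nat_finite[OF B(1)] unfolding n_def atLeast0LessThan by blast
  define r where "r = representation B"
  define C where "C = (coord_space n :: (nat \<Rightarrow> 'k) topology)"
  have topC: "topspace C = {c. \<forall>i\<ge>n. c i = 0}"
    unfolding C_def topspace_prod_tvs by (auto simp: not_less)
  define f where "f = (\<lambda>u i. if i < n then r u (e i) else 0)"
  define h where "h = (\<lambda>c. \<Sum>i<n. smul (c i) (e i))"
  have eB: "e i \<in> B" if "i < n" for i using e that by (auto simp: bij_betw_def)
  have hW: "h c \<in> W" for c
    unfolding h_def using eB B(4) subW by (intro subspace_sum subspace_scale) auto
  have hf: "h (f u) = u" if "u \<in> W" for u
  proof -
    have "h (f u) = (\<Sum>i<n. smul (r u (e i)) (e i))" unfolding h_def f_def by simp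
    also have "\<dots> = (\<Sum>b\<in>B. smul (r u b) b)" by (rule sum.reindex_bij_betw[OF e])
    also have "\<dots> = u"
      unfolding r_def using sum_representation_eq[OF B(2) _ B(1) order_refl] that B(3) by simp
    finally show ?thesis .
  qed
  have fh: "f (h c) = c" if "c \<in> topspace C" for c
  proof
    fix i
    have "r (h c) (e i) = c i" if i: "i < n"
    proof -
      have "r (h c) = (\<lambda>b. \<Sum>j<n. representation B (smul (c j) (e j)) b)"
        unfolding h_def r_def using B(2,3,4) eB subW
        by (intro representation_sum) (auto intro: subspace_scale)
      then have "r (h c) (e i) = (\<Sum>j<n. c j * representation B (e j) (e i))"
        using B(2) eB by (simp add: representation_scale span_base)
      also have "\<dots> = (\<Sum>j<n. if i = j then c j else 0)"
        using e i eB representation_basis[OF B(2)]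
        by (intro sum.cong) (auto simp: bij_betw_def inj_on_def)
      finally show ?thesis using i by simp
    qed
    then show "f (h c) i = c i" unfolding f_def using that topC by auto
  qed
  have fC: "f u \<in> topspace C" for u unfolding f_def topC by auto
  have bij: "bij_betw f W (topspace C)"
    using hf fh hW fC by (intro bij_betw_byWitness[where f' = h]) auto
  have bij': "bij_betw h (topspace C) W"
    using hf fh hW fC by (intro bij_betw_byWitness[where f' = f]) auto
  have f_lin: "linear_between smul W coord_scale f"
    unfolding linear_between_def f_def r_def scale_fun_def using B(2,3)
    by (auto simp: fun_eq_iff representation_add representation_scale)
  have h_lin: "linear_between coord_scale (topspace C) smul h"
    unfolding linear_between_def h_def scale_fun_def
    by (auto simp: scale_left_distrib sum.distrib scale_sum_right)
  have C: "tvs coord_scale C" unfolding C_def by (rule tvs_coord_space)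
  have f_cont: "continuous_map (subtopology T W) C f"
    using fC by (intro linear_between_continuous[OF C W'(2) WT f_lin]) auto
  have W_bij: "bij_betw (\<rho> g) W W" for g
    using inv WT rep_minus by (intro bij_betw_byWitness[where f' = "\<rho> (- g)"]) auto
  have C_fd: "finite_dimensional coord_scale (topspace C)"
    using finite_dimensional_linear_homeomorphism(2)[OF tvs C W'(2) WT order_refl f_lin bij] .
  define \<sigma> where "\<sigma> = (\<lambda>g c. f (\<rho> g (h c)))"
  have "Defs.representation coord_scale C \<sigma>"
    unfolding Defs.representation_def
  proof (intro conjI allI ballI)
    fix g
    have "linear_between coord_scale (topspace C) smul (\<lambda>c. \<rho> g (h c))"
      using hW WT by (intro linear_between_compose[OF h_lin rep_linear]) auto
    then show lin: "linear_between coord_scale (topspace C) coord_scale (\<sigma> g)"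
      unfolding \<sigma>_def using hW inv by (intro linear_between_compose[OF _ f_lin]) auto
    have "bij_betw (\<sigma> g) (topspace C) (topspace C)"
      using bij_betw_trans[OF bij_betw_trans[OF bij' W_bij[of g]] bij]
      unfolding \<sigma>_def by (simp add: o_def)
    from finite_dimensional_linear_homeomorphism(1)[OF C C C_fd order_refl order_refl lin this]
    show "homeomorphic_map C C (\<sigma> g)" by simp
  next
    fix g k c assume "c \<in> topspace C"
    show "\<sigma> (g + k) c = \<sigma> g (\<sigma> k c)"
      unfolding \<sigma>_def using hW[of c] WT rep_add[of "h c" g k] hf[OF inv[OF hW]] by auto
  next
    fix c assume "c \<in> topspace C"
    have "continuous_map euclidean (subtopology T W) (\<lambda>g. \<rho> g (h c))"
      using rep_orbit_continuous[of "h c"] hW inv WT by (auto simp: continuous_map_in_subtopology)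
    from continuous_map_compose[OF this f_cont]
    show "continuous_map euclidean C (\<lambda>g. \<sigma> g c)" unfolding \<sigma>_def by (simp add: o_def)
  qed
  moreover have "isomorphic_rep smul (subtopology T W) \<rho> coord_scale (subtopology C (topspace C)) \<sigma>"
    using hf by (intro isomorphic_rep_finite_dimensionalI[OF tvs C W'(2) WT order_refl f_lin bij]) (simp add: \<sigma>_def)
  then have iso: "isomorphic_rep smul (subtopology T W) \<rho> coord_scale C \<sigma>" by simp
  moreover have "irreducible_rep coord_scale C \<sigma>"
    using irreducible_rep_isomorphic[OF isomorphic_rep_sym_subrep[OF W'(1) iso] _
        coord_space_facts(1) vector_space_axioms] coord_space_facts(2)[of n] W
    unfolding simple_def C_def by blast
  ultimately have mem: "(n, \<sigma>) \<in> irreps" unfolding irreps_def C_def by blast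
  show thesis
  proof
    show "irrep_iso `` {(n, \<sigma>)} \<in> irrep_classes"
      unfolding irrep_classes_def using mem by (rule quotientI)
    have "(n, \<sigma>) \<in> irrep_iso `` {(n, \<sigma>)}"
      using equiv_class_self[OF equiv_irrep_iso mem] .
    then show "has_class W (irrep_iso `` {(n, \<sigma>)})"
      unfolding has_class_def using iso unfolding C_def by blast
  qed
qed

text \<open>
  The isotypic component, described by irreducible subrepresentations of the whole space instead of
  decompositions of orbit spans. In this form it is visibly an invariant subspace. The two descriptions agree by
  \<open>isotypic_component_eq_component\<close>.
\<close>

definition component :: "('g, 'k) coord_rep set \<Rightarrow> 'v set" where
  "component \<alpha> = span (\<Union>{W. simple W \<and> has_class W \<alpha>})"

lemma subrep_component: "subrep (component \<alpha>)"
  unfolding component_def using simpleD(1) by (intro subrep_span_Union) blast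

lemma subspace_component: "subspace (component \<alpha>)"
  using subrep_component by (rule subrep_subspace)

lemma simple_subset_component: "simple W \<Longrightarrow> has_class W \<alpha> \<Longrightarrow> W \<subseteq> component \<alpha>"
  unfolding component_def using span_superset[of "\<Union>{W. simple W \<and> has_class W \<alpha>}"] by blast

lemma simple_in_components:
  assumes "simple V" "V \<subseteq> span (\<Union>\<alpha>\<in>A. component \<alpha>)"
  shows "\<exists>\<alpha>\<in>A. has_class V \<alpha>"
proof -
  define \<W> where "\<W> = {W. simple W \<and> (\<exists>\<alpha>\<in>A. has_class W \<alpha>)}"
  have "component \<alpha> \<subseteq> span (\<Union>\<W>)" if "\<alpha> \<in> A" for \<alpha>
    unfolding component_def \<W>_def using that by (intro span_mono) blast
  then have "span (\<Union>\<alpha>\<in>A. component \<alpha>) \<subseteq> span (\<Union>\<W>)" by (intro span_minimal) auto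
  then have "V \<subseteq> span (\<Union>\<W>)" using assms(2) by blast
  then obtain W f where "W \<in> \<W>" "equivariant W f" "bij_betw f W V"
    using simple_in_span_Union[OF assms(1)] unfolding \<W>_def by blast
  then show ?thesis using has_class_equivariant[OF _ _ assms(1)] unfolding \<W>_def by blast
qed

lemma simple_in_component: "simple V \<Longrightarrow> V \<subseteq> component \<alpha> \<Longrightarrow> has_class V \<alpha>"
  using simple_in_components[of V "{\<alpha>}"] span_superset[of "component \<alpha>"] by auto

end

locale locally_finite_compact_rep = compact_rep smul T \<rho>
  for smul :: "'k::real_or_complex \<Rightarrow> 'v::ab_group_add \<Rightarrow> 'v" and T
    and \<rho> :: "'g::topological_group_add \<Rightarrow> 'v \<Rightarrow> 'v" +
  assumes locally_finite: "locally_finite_rep smul T \<rho>"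
begin

lemma fd_orbit_span: "v \<in> topspace T \<Longrightarrow> fd (orbit_span smul \<rho> v)"
  using locally_finite unfolding locally_finite_rep_def by blast

lemma isotypic_component_eq_component:
  assumes \<alpha>: "\<alpha> \<in> irrep_classes"
  shows "isotypic_component smul T \<rho> \<alpha> = component \<alpha>"
proof (intro equalityI subsetI)
  fix v assume "v \<in> isotypic_component smul T \<rho> \<alpha>"
  then obtain m :: nat and V where v: "v \<in> topspace T" and
    ds: "internal_direct_sum smul (subtopology T (orbit_span smul \<rho> v)) \<rho> {..<m} V" and
    cl: "\<And>i. i < m \<Longrightarrow> has_class (V i) \<alpha>"
    unfolding isotypic_component_def has_class_def by blast
  note O = subrep_orbit_span[OF v]
  have V: "subrep (V i)" "V i \<subseteq> orbit_span smul \<rho> v" if "i < m" for i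
    using ds that subrepresentation_subtopology[OF subrep_topspace[OF O]] unfolding internal_direct_sum_def by auto
  have "simple (V i)" if "i < m" for i
    unfolding simple_def
    using V[OF that] cl[OF that] \<alpha> has_class_irreducible
      finite_dimensional_subspace[OF fd_orbit_span[OF v] subrep_subspace] by blast
  then have Vc: "V i \<subseteq> component \<alpha>" if "i < m" for i using simple_subset_component cl that by blast
  have "(\<lambda>x. \<Sum>i<m. x i) ` topspace (product_topology (\<lambda>i. subtopology (subtopology T (orbit_span smul \<rho> v)) (V i)) {..<m})
      = topspace (subtopology T (orbit_span smul \<rho> v))"
    using ds homeomorphic_imp_surjective_map unfolding internal_direct_sum_def by blast
  moreover have "v \<in> topspace (subtopology T (orbit_span smul \<rho> v))"
    using orbit_span_self[OF v] v by simp
  ultimately obtain x where x: "v = (\<Sum>i<m. x i)"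
    "x \<in> topspace (product_topology (\<lambda>i. subtopology (subtopology T (orbit_span smul \<rho> v)) (V i)) {..<m})"
    by blast
  have "x i \<in> V i" if "i < m" for i using x(2) that by (auto simp: PiE_iff)
  then show "v \<in> component \<alpha>"
    unfolding x(1) using Vc by (intro subspace_sum[OF subspace_component]) auto
next
  fix v assume v: "v \<in> component \<alpha>"
  then have vT: "v \<in> topspace T" using subrep_topspace[OF subrep_component] by blast
  have O: "orbit_span smul \<rho> v \<subseteq> component \<alpha>" using v by (rule orbit_span_minimal[OF subrep_component])
  obtain m :: nat and V where V: "\<And>i. i < m \<Longrightarrow> simple (V i)" "\<And>i. i < m \<Longrightarrow> V i \<subseteq> orbit_span smul \<rho> v"
    "internal_direct_sum smul (subtopology T (orbit_span smul \<rho> v)) \<rho> {..<m} V"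
    using complete_reducibility[OF subrep_orbit_span[OF vT] fd_orbit_span[OF vT]] by metis
  have "has_class (V i) \<alpha>" if "i < m" for i
    using simple_in_component[OF V(1)[OF that]] V(2)[OF that] O by blast
  then show "v \<in> isotypic_component smul T \<rho> \<alpha>"
    unfolding isotypic_component_def has_class_def using vT fd_orbit_span[OF vT] V(3) by blast
qed

text \<open>
  If \<open>x \<beta>\<close> were non-zero, its orbit span would contain an irreducible subrepresentation. This would lie in the component
  of \<open>\<beta>\<close> and also in the sum of the other components, and so it would belong to two classes.
\<close>

lemma component_independent:
  assumes A: "finite A" "A \<subseteq> irrep_classes" and x: "\<And>\<alpha>. \<alpha> \<in> A \<Longrightarrow> x \<alpha> \<in> component \<alpha>"
    and sum: "(\<Sum>\<alpha>\<in>A. x \<alpha>) = 0" and \<beta>: "\<beta> \<in> A"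
  shows "x \<beta> = 0"
proof (rule ccontr)
  assume ne: "x \<beta> \<noteq> 0"
  have xT: "x \<beta> \<in> topspace T" using x[OF \<beta>] subrep_topspace[OF subrep_component] by blast
  have "orbit_span smul \<rho> (x \<beta>) \<noteq> {0}" using orbit_span_self[OF xT] ne by blast
  then obtain V where V: "simple V" "V \<subseteq> orbit_span smul \<rho> (x \<beta>)"
    using simple_subrep_exists subrep_orbit_span[OF xT] fd_orbit_span[OF xT] by metis
  have "has_class V \<beta>"
    using simple_in_component[OF V(1)] V(2) orbit_span_minimal[OF subrep_component x[OF \<beta>]] by blast
  let ?S = "span (\<Union>\<alpha>\<in>A - {\<beta>}. component \<alpha>)"
  have "x \<beta> = - (\<Sum>\<alpha>\<in>A - {\<beta>}. x \<alpha>)"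
    using sum sum.remove[OF A(1) \<beta>, of x] by (simp add: eq_neg_iff_add_eq_0)
  moreover have "\<dots> \<in> ?S"
    using x by (intro span_neg span_sum span_base) blast
  ultimately have "x \<beta> \<in> ?S" by simp
  moreover have "subrep (span (\<Union>(component ` (A - {\<beta>}))))"
    using subrep_component by (intro subrep_span_Union) auto
  ultimately have "V \<subseteq> ?S" using V(2) orbit_span_minimal by blast
  then obtain \<alpha> where "\<alpha> \<in> A - {\<beta>}" "has_class V \<alpha>" using simple_in_components[OF V(1)] by blast
  then show False
    using has_class_unique[OF simpleD(1)[OF V(1)] \<open>has_class V \<beta>\<close>] A(2) \<beta> by blast
qed

lemma component_decomposition:
  assumes v: "v \<in> topspace T"
  obtains A x where "finite A" "A \<subseteq> irrep_classes"
    "\<And>\<alpha>. \<alpha> \<in> A \<Longrightarrow> x \<alpha> \<in> component \<alpha> \<inter> orbit_span smul \<rho> v" "v = (\<Sum>\<alpha>\<in>A. x \<alpha>)"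
proof -
  let ?O = "orbit_span smul \<rho> v"
  note O = subrep_orbit_span[OF v]
  obtain m :: nat and V where V: "\<And>i. i < m \<Longrightarrow> simple (V i)" "\<And>i. i < m \<Longrightarrow> V i \<subseteq> ?O"
    "\<And>u. u \<in> ?O \<Longrightarrow> \<exists>x. (\<forall>i<m. x i \<in> V i) \<and> u = (\<Sum>i<m. x i)"
    using complete_reducibility[OF O fd_orbit_span[OF v]] by metis
  obtain y where y: "\<And>i. i < m \<Longrightarrow> y i \<in> V i" "v = (\<Sum>i<m. y i)"
    using V(3)[OF orbit_span_self[OF v]] by blast
  have "\<exists>\<alpha>. \<alpha> \<in> irrep_classes \<and> has_class (V i) \<alpha>" if "i < m" for i
    using simple_has_class[OF V(1)[OF that]] by blast
  then obtain c where c: "\<And>i. i < m \<Longrightarrow> c i \<in> irrep_classes \<and> has_class (V i) (c i)" by metis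
  define x where "x = (\<lambda>\<alpha>. \<Sum>i | i \<in> {..<m} \<and> c i = \<alpha>. y i)"
  have yc: "y i \<in> component (c i) \<inter> ?O" if "i < m" for i
    using simple_subset_component[OF V(1)] c y(1) V(2) that by blast
  show thesis
  proof
    show "v = (\<Sum>\<alpha>\<in>c ` {..<m}. x \<alpha>)"
      unfolding x_def y(2) by (rule sum.image_gen) simp
    fix \<alpha> assume "\<alpha> \<in> c ` {..<m}"
    show "x \<alpha> \<in> component \<alpha> \<inter> ?O"
      unfolding x_def using yc subspace_inter[OF subspace_component subrep_subspace[OF O]]
      by (intro subspace_sum) auto
  qed (use c in auto)
qed

text \<open>
  The orbit span of the sum is completely reducible, so it contains the components of each of its vectors. By
  independence these are the given summands.
\<close>

lemma component_in_orbit_span: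
  assumes A: "finite A" "A \<subseteq> irrep_classes" and x: "\<And>\<alpha>. \<alpha> \<in> A \<Longrightarrow> x \<alpha> \<in> component \<alpha>" and \<beta>: "\<beta> \<in> A"
  shows "x \<beta> \<in> orbit_span smul \<rho> (\<Sum>\<alpha>\<in>A. x \<alpha>)"
proof -
  define v where "v = (\<Sum>\<alpha>\<in>A. x \<alpha>)"
  have v: "v \<in> topspace T"
    unfolding v_def using x subrep_topspace[OF subrep_component] by (intro subspace_sum[OF subspace_topspace]) blast
  obtain A' y where y: "finite A'" "A' \<subseteq> irrep_classes"
    "\<And>\<alpha>. \<alpha> \<in> A' \<Longrightarrow> y \<alpha> \<in> component \<alpha> \<inter> orbit_span smul \<rho> v" "v = (\<Sum>\<alpha>\<in>A'. y \<alpha>)"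
    by (rule component_decomposition[OF v]) blast
  define z where "z = (\<lambda>\<alpha>. (if \<alpha> \<in> A then x \<alpha> else 0) - (if \<alpha> \<in> A' then y \<alpha> else 0))"
  have "(\<Sum>\<alpha>\<in>A \<union> A'. if \<alpha> \<in> A then x \<alpha> else 0) = v"
    unfolding v_def using A(1) y(1) by (intro sum.mono_neutral_cong_right) auto
  moreover have "(\<Sum>\<alpha>\<in>A \<union> A'. if \<alpha> \<in> A' then y \<alpha> else 0) = v"
    unfolding y(4) using A(1) y(1) by (intro sum.mono_neutral_cong_right) auto
  ultimately have "(\<Sum>\<alpha>\<in>A \<union> A'. z \<alpha>) = 0" unfolding z_def by (simp add: sum_subtractf)
  moreover have "z \<alpha> \<in> component \<alpha>" if "\<alpha> \<in> A \<union> A'" for \<alpha>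
    unfolding z_def using x y(3) subspace_component subspace_0 subspace_diff by auto
  ultimately have "z \<beta> = 0" using component_independent[of "A \<union> A'" z \<beta>] A y \<beta> by blast
  then have "x \<beta> = (if \<beta> \<in> A' then y \<beta> else 0)" unfolding z_def using \<beta> by simp
  then show ?thesis
    using y(3)[of \<beta>] subspace_0[OF subrep_subspace[OF subrep_orbit_span[OF v]]] unfolding v_def by auto
qed

end


section \<open>Products of complete metrizable topological vector spaces\<close>

lemma (in top_vec_space) small_neighbourhood:
  assumes reg: "regular_space T" and N: "openin T N" "0 \<in> N" and W: "openin T W" "x \<in> W"
  obtains V K where "openin T V" "closedin T K" "x \<in> V" "V \<subseteq> K" "K \<subseteq> W"
    "\<And>a b. a \<in> V \<Longrightarrow> b \<in> V \<Longrightarrow> a - b \<in> N"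
proof -
  obtain V1 K where V1: "openin T V1" "closedin T K" "x \<in> V1" "V1 \<subseteq> K" "K \<subseteq> W"
    using reg W unfolding neighbourhood_base_of_closedin[symmetric] neighbourhood_base_of by metis
  have x: "x \<in> topspace T" using W openin_subset by blast
  have "continuous_map (prod_topology T T) T (\<lambda>p. fst p - snd p)"
    by (intro continuous_map_diff continuous_map_fst continuous_map_snd)
  then have "openin (prod_topology T T) {p \<in> topspace (prod_topology T T). fst p - snd p \<in> N}"
    using N(1) by (rule openin_continuous_map_preimage)
  moreover have "(x, x) \<in> {p \<in> topspace (prod_topology T T). fst p - snd p \<in> N}"
    using x N(2) by simp
  ultimately have "\<exists>P Q. openin T P \<and> openin T Q \<and> x \<in> P \<and> x \<in> Q \<and>
    P \<times> Q \<subseteq> {p \<in> topspace (prod_topology T T). fst p - snd p \<in> N}"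
    unfolding openin_prod_topology_alt by (elim allE impE)
  then obtain P Q where PQ: "openin T P" "openin T Q" "x \<in> P" "x \<in> Q"
    "P \<times> Q \<subseteq> {p \<in> topspace (prod_topology T T). fst p - snd p \<in> N}"
    by (elim exE conjE)
  show thesis
  proof
    show "openin T (V1 \<inter> P \<inter> Q)" using V1 PQ by blast
    show "a - b \<in> N" if "a \<in> V1 \<inter> P \<inter> Q" "b \<in> V1 \<inter> P \<inter> Q" for a b
      using that PQ(5) by auto
  qed (use V1 PQ in auto)
qed

lemma (in top_vec_space) countable_neighbourhood_base_0:
  assumes "metrizable_space T"
  obtains N :: "nat \<Rightarrow> 'v set" where "\<And>n. openin T (N n)" "\<And>n. 0 \<in> N n" "decseq N"
    "\<And>U. openin T U \<Longrightarrow> 0 \<in> U \<Longrightarrow> \<exists>n. N n \<subseteq> U"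
proof -
  obtain M d where M: "Metric_space M d" "T = Metric_space.mtopology M d"
    using assms unfolding metrizable_space_def by blast
  interpret Metric_space M d by (rule M(1))
  have 0: "0 \<in> M" using zero_topspace unfolding M(2) by simp
  show thesis
  proof
    show "openin T (mball 0 (1 / real (Suc n)))" for n unfolding M(2) by simp
    show "0 \<in> mball 0 (1 / real (Suc n))" for n using 0 by simp
    show "decseq (\<lambda>n. mball 0 (1 / real (Suc n)))"
      unfolding decseq_def by (auto intro!: mball_subset_concentric frac_le)
    fix U assume "openin T U" "0 \<in> U"
    then obtain r where r: "r > 0" "mball 0 r \<subseteq> U" unfolding M(2) openin_mtopology by blast
    obtain n where n: "1 / real (Suc n) < r" using r(1) nat_approx_posE by metis
    then have "mball 0 (1 / real (Suc n)) \<subseteq> mball 0 r"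
      by (intro mball_subset_concentric) simp
    then show "\<exists>n. mball 0 (1 / real (Suc n)) \<subseteq> U" using r(2) by blast
  qed
qed

text \<open>
  The Baire category theorem for an arbitrary product. If no \<open>C k\<close> had interior, one could choose a decreasing
  sequence of boxes, the next one avoiding \<open>C k\<close>. Every box constrains only finitely many coordinates. In a constrained
  coordinate the closure of the next factor lies in the previous one, and the factors shrink, so by completeness they
  have a common point. In a coordinate that is never constrained any point will do. The resulting point of the product lies
  in none of the \<open>C k\<close>. Shrinking is measured by differences and not by a metric, because the completeness that is
  assumed belongs to the translation-invariant uniformity.
\<close>

theorem product_closed_cover_has_interior:
  fixes F :: "'j \<Rightarrow> 'v::ab_group_add topology" and C :: "nat \<Rightarrow> ('j \<Rightarrow> 'v) set"
  defines "P \<equiv> product_topology F UNIV"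
  assumes tvs: "\<And>j. tvs smul (F j)" and metr: "\<And>j. metrizable_space (F j)" and compl: "\<And>j. tvs_complete (F j)"
    and closed: "\<And>k. closedin P (C k)" and cover: "topspace P \<subseteq> (\<Union>k. C k)"
  shows "\<exists>k U. openin P U \<and> U \<noteq> {} \<and> U \<subseteq> C k"
proof (rule ccontr)
  assume no_interior: "\<not> ?thesis"
  have F: "top_vec_space smul (F j)" for j using tvs by (rule top_vec_spaceI)
  have topP: "topspace P = PiE UNIV (\<lambda>j. topspace (F j))" unfolding P_def by simp
  have "\<exists>N :: nat \<Rightarrow> 'v set. (\<forall>n. openin (F j) (N n)) \<and> (\<forall>n. 0 \<in> N n) \<and> decseq N \<and>
    (\<forall>U. openin (F j) U \<longrightarrow> 0 \<in> U \<longrightarrow> (\<exists>n. N n \<subseteq> U))" for j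
    using top_vec_space.countable_neighbourhood_base_0[OF F metr] by metis
  then obtain N :: "'j \<Rightarrow> nat \<Rightarrow> 'v set" where N: "\<And>j n. openin (F j) (N j n)" "\<And>j n. 0 \<in> N j n" "\<And>j. decseq (N j)"
    "\<And>j U. openin (F j) U \<Longrightarrow> 0 \<in> U \<Longrightarrow> \<exists>n. N j n \<subseteq> U" by metis
  define box where "box = (\<lambda>B :: 'j \<Rightarrow> 'v set.
    (\<forall>j. openin (F j) (B j) \<and> B j \<noteq> {}) \<and> finite {j. B j \<noteq> topspace (F j)})"
  \<comment> \<open>The closed set \<open>K\<close> between the factors keeps the limit inside;
    the condition on differences makes the factors of a constrained
     coordinate a Cauchy filter base.\<close>
  define step where "step = (\<lambda>k (B :: 'j \<Rightarrow> 'v set) B'.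
    (\<forall>j. \<exists>K. closedin (F j) K \<and> B' j \<subseteq> K \<and> K \<subseteq> B j) \<and>
    (\<forall>j. B' j \<noteq> topspace (F j) \<longrightarrow> (\<forall>a\<in>B' j. \<forall>b\<in>B' j. a - b \<in> N j k)) \<and>
    PiE UNIV B' \<inter> C k = {})"
  have step_ex: "\<exists>B'. box B' \<and> step k B B'" if "box B" for k B
  proof -
    have B: "openin P (PiE UNIV B)" "PiE UNIV B \<noteq> {}"
      using that unfolding P_def box_def by (auto simp: openin_PiE_gen PiE_eq_empty_iff)
    then obtain x where x: "x \<in> PiE UNIV B - C k" using no_interior by blast
    have "openin P (PiE UNIV B - C k)" using B(1) closed by (rule openin_diff)
    from bspec[OF this[unfolded P_def openin_product_topology_alt] x]
    obtain U where U': "finite {j \<in> UNIV. U j \<noteq> topspace (F j)}" "\<forall>j\<in>UNIV. openin (F j) (U j)"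
      and U_x: "x \<in> PiE UNIV U" "PiE UNIV U \<subseteq> PiE UNIV B - C k"
      by (elim exE conjE)
    have U: "finite {j. U j \<noteq> topspace (F j)}" "\<And>j. openin (F j) (U j)"
      "x \<in> PiE UNIV U" "PiE UNIV U \<subseteq> PiE UNIV B - C k"
      using U' U_x by simp_all
    have UB: "U j \<subseteq> B j" for j
    proof
      fix y assume "y \<in> U j"
      then have "x(j := y) \<in> PiE UNIV U" using U(3) by (auto simp: PiE_UNIV_domain Pi_iff)
      then have "x(j := y) \<in> PiE UNIV B" using U(4) by blast
      then show "y \<in> B j" by (auto simp: PiE_UNIV_domain Pi_iff dest: spec[of _ j])
    qed
    have "\<exists>V K. openin (F j) V \<and> V \<noteq> {} \<and> closedin (F j) K \<and> V \<subseteq> K \<and> K \<subseteq> U j \<and>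
      (V \<noteq> topspace (F j) \<longrightarrow> U j \<noteq> topspace (F j) \<and> (\<forall>a\<in>V. \<forall>b\<in>V. a - b \<in> N j k))" for j
    proof (cases "U j = topspace (F j)")
      case True
      then show ?thesis using U(2,3) by (intro exI[of _ "topspace (F j)"]) (auto simp: PiE_UNIV_domain Pi_iff)
    next
      case False
      have "x j \<in> U j" using U(3) by (auto simp: PiE_UNIV_domain Pi_iff)
      from top_vec_space.small_neighbourhood[OF F metrizable_imp_regular_space[OF metr] N(1,2) U(2) this]
      obtain V K where "openin (F j) V" "closedin (F j) K" "x j \<in> V" "V \<subseteq> K" "K \<subseteq> U j"
        "\<And>a b. a \<in> V \<Longrightarrow> b \<in> V \<Longrightarrow> a - b \<in> N j k" by metis
      then show ?thesis using False by (intro exI[of _ V] exI[of _ K]) auto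
    qed
    then obtain V K where VK: "\<And>j. openin (F j) (V j) \<and> V j \<noteq> {} \<and> closedin (F j) (K j) \<and> V j \<subseteq> K j \<and> K j \<subseteq> U j \<and>
      (V j \<noteq> topspace (F j) \<longrightarrow> U j \<noteq> topspace (F j) \<and> (\<forall>a\<in>V j. \<forall>b\<in>V j. a - b \<in> N j k))"
      by metis
    have "finite {j. V j \<noteq> topspace (F j)}"
      using VK by (intro finite_subset[OF _ U(1)]) blast
    then have "box V" unfolding box_def using VK by blast
    moreover have "PiE UNIV V \<subseteq> PiE UNIV U" using VK by (intro PiE_mono) blast
    then have "PiE UNIV V \<inter> C k = {}" using U(4) by blast
    then have "step k B V" unfolding step_def using VK UB by (meson order_trans)
    ultimately show ?thesis by blast
  qed
  have box0: "box (\<lambda>j. topspace (F j))"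
  proof -
    have "topspace (F j) \<noteq> {}" for j using top_vec_space.zero_topspace[OF F, of j] by blast
    then show ?thesis unfolding box_def by simp
  qed
  obtain B where B: "\<And>k. box (B k)" "\<And>k. step k (B k) (B (Suc k))"
    using dependent_nat_choice[of "\<lambda>k. box" "step"] box0 step_ex by metis
  have ne: "B k j \<noteq> {}" and sub: "B k j \<subseteq> topspace (F j)" for k j
    using B(1)[of k] openin_subset unfolding box_def by blast+
  have mono: "B l j \<subseteq> B k j" if "k \<le> l" for k l j
    using that
  proof (induction l rule: dec_induct)
    case (step l)
    then show ?case using B(2)[of l] unfolding step_def by (meson order_trans)
  qed simp
  have "\<exists>x. \<forall>k. x \<in> B k j" for j
  proof (cases "\<forall>k. B k j = topspace (F j)")
    case True
    then show ?thesis using top_vec_space.zero_topspace[OF F] by blast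
  next
    case False
    then obtain k0 where k0: "B k0 j \<noteq> topspace (F j)" by blast
    \<comment> \<open>Once constrained, a coordinate stays constrained, since the boxes decrease.\<close>
    have small: "a - b \<in> N j n" if "a \<in> B k j" "b \<in> B k j" "k > k0" "k > n" for a b k n
    proof -
      obtain l where l: "k = Suc l" using \<open>k > n\<close> by (cases k) auto
      have "B k j \<noteq> topspace (F j)" using mono[of k0 k j] \<open>k > k0\<close> k0 sub[of k0 j] by auto
      then have "a - b \<in> N j l" using B(2)[of l] that l unfolding step_def by blast
      moreover have "N j l \<subseteq> N j n" using N(3)[of j] that l unfolding decseq_def by auto
      ultimately show ?thesis by blast
    qed
    obtain y where y: "\<And>k. y k \<in> B k j" using ne by (meson ex_in_conv)
    define \<F> where "\<F> = filtermap y sequentially"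
    have "tvs_cauchy_filter (F j) \<F>"
      unfolding tvs_cauchy_filter_def
    proof (intro conjI allI impI)
      show "\<F> \<noteq> bot" unfolding \<F>_def by (simp add: filtermap_bot_iff)
      show "\<F> \<le> principal (topspace (F j))"
        unfolding \<F>_def le_principal eventually_filtermap using y sub by (intro always_eventually) blast
      fix U assume U: "openin (F j) U \<and> 0 \<in> U"
      then obtain n where n: "N j n \<subseteq> U" using N(4) by blast
      let ?k = "Suc (max k0 n)"
      have ev: "\<forall>\<^sub>F a in \<F>. a \<in> B ?k j"
        unfolding \<F>_def eventually_filtermap using eventually_ge_at_top[of ?k]
        by eventually_elim (use y mono in blast)
      show "\<forall>\<^sub>F (a, b) in \<F> \<times>\<^sub>F \<F>. a - b \<in> U"
        unfolding eventually_prod_filter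
      proof (intro exI conjI allI impI)
        fix a b assume "a \<in> B ?k j" "b \<in> B ?k j"
        then have "a - b \<in> N j n" by (rule small) auto
        then show "case (a, b) of (a, b) \<Rightarrow> a - b \<in> U" using n by auto
      qed (rule ev)+
    qed
    then obtain l where "limitin (F j) (\<lambda>x. x) l \<F>" using compl unfolding tvs_complete_def by blast
    then have l: "limitin (F j) y l sequentially"
      unfolding limitin_def \<F>_def eventually_filtermap by simp
    have "l \<in> B k j" for k
    proof -
      obtain K where K: "closedin (F j) K" "B (Suc k) j \<subseteq> K" "K \<subseteq> B k j"
        using B(2)[of k, unfolded step_def, THEN conjunct1, THEN spec, of j] by (elim exE conjE)
      have "\<forall>\<^sub>F i in sequentially. y i \<in> K"
        using eventually_ge_at_top[of "Suc k"] by eventually_elim (use y mono K(2) in blast)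
      then have "l \<in> K" using limitin_closedin[OF l K(1)] by simp
      then show ?thesis using K(3) by blast
    qed
    then show ?thesis by blast
  qed
  then obtain x where x: "\<And>j k. x j \<in> B k j" by metis
  then have "x \<in> topspace P" unfolding topP using subsetD[OF sub x] by (simp add: PiE_iff)
  then obtain k where "x \<in> C k" using cover by blast
  moreover have "x \<in> PiE UNIV (B (Suc k))" using x by (auto simp: PiE_UNIV_domain)
  ultimately show False using B(2)[of k] unfolding step_def by blast
qed


section \<open>Bounded orbit dimension\<close>

context locally_finite_compact_rep
begin

text \<open>
  The right-hand side refers to families indexed by group elements, not to sets of vectors: each such family depends
  continuously on \<open>v\<close>, and \<open>closedin_dependent_family\<close> applies.
\<close>

lemma orbit_dim_le_iff:
  assumes v: "v \<in> topspace T"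
  shows "dim (orbit_span smul \<rho> v) \<le> k \<longleftrightarrow>
    (\<forall>D. finite D \<and> card D = Suc k \<longrightarrow> (\<exists>c. (\<exists>g\<in>D. c g \<noteq> 0) \<and> (\<Sum>g\<in>D. smul (c g) (\<rho> g v)) = 0))"
    (is "?L \<longleftrightarrow> ?R")
proof
  assume L: ?L
  show ?R
  proof (intro allI impI, rule ccontr)
    fix D :: "'g set" assume D: "finite D \<and> card D = Suc k"
      and "\<not> (\<exists>c. (\<exists>g\<in>D. c g \<noteq> 0) \<and> (\<Sum>g\<in>D. smul (c g) (\<rho> g v)) = 0)"
    then have fam: "c g = 0" if "(\<Sum>g\<in>D. smul (c g) (\<rho> g v)) = 0" "g \<in> D" for c g using that by blast
    have ind: "inj_on (\<lambda>g. \<rho> g v) D" "independent ((\<lambda>g. \<rho> g v) ` D)"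
      using independent_familyI[of D "\<lambda>g. \<rho> g v"] D fam by blast+
    have "(\<lambda>g. \<rho> g v) ` D \<subseteq> orbit_span smul \<rho> v"
      unfolding orbit_span_def by (auto intro: span_base)
    then have "card ((\<lambda>g. \<rho> g v) ` D) \<le> dim (orbit_span smul \<rho> v)"
      using card_independent_le_dim[OF fd_orbit_span[OF v] ind(2)] by blast
    then show False using L D card_image[OF ind(1)] by simp
  qed
next
  assume R: ?R
  show ?L
  proof (rule ccontr)
    assume "\<not> ?L"
    obtain B where B: "B \<subseteq> range (\<lambda>g. \<rho> g v)" "independent B" "range (\<lambda>g. \<rho> g v) \<subseteq> span B"
      by (rule maximal_independent_subset)
    have "span B = orbit_span smul \<rho> v"
      unfolding orbit_span_def using B by (metis span_mono span_span subset_antisym)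
    then have "card B = dim (orbit_span smul \<rho> v)"
      using dim_span_eq_card_independent[OF B(2)] by simp
    then have "Suc k \<le> card B" using \<open>\<not> ?L\<close> by simp
    then obtain B' where B': "B' \<subseteq> B" "card B' = Suc k" "finite B'" by (rule obtain_subset_with_card_n)
    have "B' \<subseteq> range (\<lambda>g. \<rho> g v)" using B' B by blast
    then obtain D where D: "inj_on (\<lambda>g. \<rho> g v) D" "B' = (\<lambda>g. \<rho> g v) ` D" using subset_image_inj by metis
    have card: "finite D" "card D = Suc k" using B' D card_image[OF D(1)] finite_imageD by auto
    then obtain c g where c: "g \<in> D" "c g \<noteq> 0" "(\<Sum>g\<in>D. smul (c g) (\<rho> g v)) = 0" using R by blast
    have "independent ((\<lambda>g. \<rho> g v) ` D)" using B(2) B'(1) D(2) independent_mono by blast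
    then show False using independent_familyD[OF card(1) D(1) _ c(3) c(1)] c(2) by blast
  qed
qed

lemma closedin_orbit_dim_le:
  "closedin T {v \<in> topspace T. dim (orbit_span smul \<rho> v) \<le> k}"
proof -
  let ?Z = "\<lambda>D. {v \<in> topspace T. \<exists>c. (\<exists>g\<in>D. c g \<noteq> 0) \<and> (\<Sum>g\<in>D. smul (c g) (\<rho> g v)) = 0}"
  have "closedin T (?Z D)" if "finite D" for D
    using closedin_dependent_family[OF that, of T \<rho>] rep_continuous by blast
  then have "closedin T (\<Inter>(insert (topspace T) (?Z ` {D. finite D \<and> card D = Suc k})))"
    by (intro closedin_Inter) auto
  also have "\<Inter>(insert (topspace T) (?Z ` {D. finite D \<and> card D = Suc k})) =
      {v \<in> topspace T. dim (orbit_span smul \<rho> v) \<le> k}"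
    using orbit_dim_le_iff by auto
  finally show ?thesis .
qed

text \<open>
  Let \<open>x\<close> be an interior point of the set of vectors whose orbits span at most \<open>k\<close> dimensions. For
  every \<open>v\<close> there is a scalar \<open>t \<noteq> 0\<close> such that \<open>x + t v\<close> also lies in this set. The vector \<open>v\<close> is a
  combination of \<open>x + t v\<close> and \<open>x\<close>.
\<close>

lemma bounded_orbit_dim:
  assumes baire: "\<And>C :: nat \<Rightarrow> 'v set. (\<And>k. closedin T (C k)) \<Longrightarrow> topspace T \<subseteq> (\<Union>k. C k) \<Longrightarrow>
    \<exists>k U. openin T U \<and> U \<noteq> {} \<and> U \<subseteq> C k"
  obtains n where "\<And>v. v \<in> topspace T \<Longrightarrow> dim (orbit_span smul \<rho> v) \<le> n"
proof -
  define E where "E = (\<lambda>k. {v \<in> topspace T. dim (orbit_span smul \<rho> v) \<le> k})"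
  have "\<exists>k U. openin T U \<and> U \<noteq> {} \<and> U \<subseteq> E k"
    unfolding E_def by (rule baire[OF closedin_orbit_dim_le]) auto
  then obtain k U x where U: "openin T U" "x \<in> U" "U \<subseteq> E k" by blast
  have x: "x \<in> topspace T" using U openin_subset by blast
  have "dim (orbit_span smul \<rho> v) \<le> k + k" if v: "v \<in> topspace T" for v
  proof -
    have "continuous_map euclidean T (\<lambda>t. x + smul t v)"
      using x v by (intro continuous_map_add continuous_map_scale) auto
    then have "openin euclidean {t \<in> topspace euclidean. x + smul t v \<in> U}"
      using U(1) by (rule openin_continuous_map_preimage)
    then have "open {t. x + smul t v \<in> U}" by simp
    moreover have "0 \<in> {t. x + smul t v \<in> U}" using U(2) by simp
    ultimately obtain e where e: "e > 0" "ball 0 e \<subseteq> {t. x + smul t v \<in> U}"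
      by (meson open_contains_ball)
    define t :: 'k where "t = of_real (e / 2)"
    have "t \<in> ball 0 e" "t \<noteq> 0" unfolding t_def using e(1) by auto
    then have w: "x + smul t v \<in> U" using e(2) by blast
    define w where "w = x + smul t v"
    have wT: "w \<in> topspace T" using w U(1) openin_subset unfolding w_def by blast
    let ?S = "span (\<Union>{orbit_span smul \<rho> w, orbit_span smul \<rho> x})"
    have "subrep ?S" using subrep_orbit_span wT x by (intro subrep_span_Union) auto
    moreover have "v \<in> ?S"
    proof -
      have "w \<in> ?S" "x \<in> ?S" using orbit_span_self wT x by (auto intro: span_base)
      then have "smul (1 / t) (w - x) \<in> ?S" by (intro span_scale span_diff)
      then show ?thesis unfolding w_def using \<open>t \<noteq> 0\<close> by simp
    qed
    ultimately have "orbit_span smul \<rho> v \<subseteq> ?S" by (rule orbit_span_minimal)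
    then have "dim (orbit_span smul \<rho> v) \<le> dim ?S"
      using fd_orbit_span wT x by (intro dim_le_finite_dimensional finite_dimensional_span_Union) auto
    also have "\<dots> \<le> dim (orbit_span smul \<rho> w) + dim (orbit_span smul \<rho> x)"
      using finite_dimensional_span_Un(2)[OF fd_orbit_span[OF wT] fd_orbit_span[OF x]] by simp
    also have "\<dots> \<le> k + k"
      using w U unfolding E_def w_def by (intro add_mono) auto
    finally show ?thesis .
  qed
  then show thesis by (rule that)
qed

definition component_classes :: "('g, 'k) coord_rep set set" where
  "component_classes = {\<alpha> \<in> irrep_classes. component \<alpha> \<noteq> {0}}"

text \<open>
  A sum of non-zero vectors from \<open>m\<close> distinct components has these \<open>m\<close> independent vectors in its orbit span.
\<close>

lemma finite_component_classes:
  assumes n: "\<And>v. v \<in> topspace T \<Longrightarrow> dim (orbit_span smul \<rho> v) \<le> n"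
  shows "finite component_classes"
proof (rule finite_if_finite_subsets_card_bdd[THEN conjunct1])
  fix A assume A: "A \<subseteq> component_classes" "finite A"
  have "\<exists>x. x \<in> component \<alpha> \<and> x \<noteq> 0" if "\<alpha> \<in> A" for \<alpha>
    using that A(1) subspace_0[OF subspace_component] unfolding component_classes_def by blast
  then obtain x where x: "\<And>\<alpha>. \<alpha> \<in> A \<Longrightarrow> x \<alpha> \<in> component \<alpha> \<and> x \<alpha> \<noteq> 0" by metis
  have cls: "A \<subseteq> irrep_classes" using A(1) unfolding component_classes_def by blast
  define v where "v = (\<Sum>\<alpha>\<in>A. x \<alpha>)"
  have v: "v \<in> topspace T"
    unfolding v_def using x subrep_topspace[OF subrep_component] by (intro subspace_sum[OF subspace_topspace]) blast
  have zero: "c \<beta> = 0" if "(\<Sum>\<alpha>\<in>A. smul (c \<alpha>) (x \<alpha>)) = 0" "\<beta> \<in> A" for c \<beta>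
  proof -
    have "smul (c \<beta>) (x \<beta>) = 0"
      using component_independent[OF A(2) cls _ that(1) that(2)] x subspace_scale[OF subspace_component] by blast
    then show ?thesis using x that(2) by auto
  qed
  have ind: "inj_on x A" "independent (x ` A)"
    using independent_familyI[OF A(2), of x] zero by blast+
  have "x ` A \<subseteq> orbit_span smul \<rho> v"
    unfolding v_def using component_in_orbit_span[OF A(2) cls, of x] x by blast
  then have "card (x ` A) \<le> dim (orbit_span smul \<rho> v)"
    using card_independent_le_dim[OF fd_orbit_span[OF v] ind(2)] by blast
  then show "card A \<le> n" using n[OF v] card_image[OF ind(1)] by simp
qed

end


section \<open>Finite powers of a representation\<close>

text \<open>
  A vector of a finite power is a finite family of vectors on which the group acts simultaneously. A statement about
  the orbit span of one such vector is therefore a statement about one combination of group elements acting on finitely many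
  vectors at once.
\<close>

locale finite_power_rep = locally_finite_compact_rep smul T \<rho>
  for smul :: "'k::real_or_complex \<Rightarrow> 'v::ab_group_add \<Rightarrow> 'v" and T
    and \<rho> :: "'g::topological_group_add \<Rightarrow> 'v \<Rightarrow> 'v" +
  fixes I :: "'i set"
  assumes finite_I: "finite I"
begin

abbreviation powT :: "('i \<Rightarrow> 'v) topology" where
  "powT \<equiv> prod_tvs I (\<lambda>_. T)"

abbreviation pow\<rho> :: "'g \<Rightarrow> ('i \<Rightarrow> 'v) \<Rightarrow> 'i \<Rightarrow> 'v" where
  "pow\<rho> \<equiv> \<lambda>g x i. \<rho> g (x i)"

definition inj_at :: "'i \<Rightarrow> 'v \<Rightarrow> 'i \<Rightarrow> 'v" where
  "inj_at i v = (\<lambda>j. if j = i then v else 0)"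

lemma topspace_powT: "x \<in> topspace powT \<longleftrightarrow> (\<forall>i\<in>I. x i \<in> topspace T) \<and> (\<forall>i. i \<notin> I \<longrightarrow> x i = 0)"
  by (simp add: topspace_prod_tvs)

lemma powT_in: "x \<in> topspace powT \<Longrightarrow> x i \<in> topspace T"
  unfolding topspace_powT by (cases "i \<in> I") auto

lemma tvs_powT: "tvs (scale_fun smul) powT"
  using tvs vector_space_axioms by (intro tvs_prod_tvs) auto

lemma powT_component_continuous: "continuous_map powT (if i \<in> I then T else discrete_topology {0}) (\<lambda>x. x i)"
  unfolding prod_tvs_def by (rule continuous_map_product_projection) simp

lemma continuous_map_powT:
  assumes "\<And>i. i \<in> I \<Longrightarrow> continuous_map X T (\<lambda>x. f x i)"
    and "\<And>i x. i \<notin> I \<Longrightarrow> x \<in> topspace X \<Longrightarrow> f x i = 0"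
  shows "continuous_map X powT f"
  unfolding prod_tvs_def continuous_map_componentwise_UNIV
  using assms by (simp add: continuous_map_into_zero_space)

lemma pow\<rho>_continuous: "continuous_map powT powT (pow\<rho> g)"
proof (rule continuous_map_powT)
  fix i assume "i \<in> I"
  then have "continuous_map powT T (\<lambda>x. x i)" using powT_component_continuous[of i] by simp
  from continuous_map_compose[OF this rep_continuous]
  show "continuous_map powT T (\<lambda>x. \<rho> g (x i))" by (simp add: o_def)
qed (simp add: topspace_powT rep_zero)

lemma inj_at_linear: "linear_between smul V (scale_fun smul) (inj_at i)"
  unfolding linear_between_def inj_at_def scale_fun_def by (auto simp: fun_eq_iff)

lemma inj_at_powT: "i \<in> I \<Longrightarrow> v \<in> topspace T \<Longrightarrow> inj_at i v \<in> topspace powT"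
  unfolding topspace_powT inj_at_def by auto

lemma pow_sum_inj_at: "x \<in> topspace powT \<Longrightarrow> x = (\<Sum>i\<in>I. inj_at i (x i))"
  unfolding topspace_powT inj_at_def using finite_I
  by (auto simp: fun_eq_iff sum_fun_apply)

sublocale pow: compact_rep "scale_fun smul" powT pow\<rho>
proof (intro compact_rep.intro compact_rep_axioms.intro top_vec_spaceI tvs_powT compact_group)
  have pow_maps: "pow\<rho> g x \<in> topspace powT" if "x \<in> topspace powT" for g x
    using that rep_in unfolding topspace_powT by (auto simp: rep_zero)
  show "Defs.representation (scale_fun smul) powT pow\<rho>"
    unfolding Defs.representation_def
  proof (intro conjI allI ballI)
    fix g
    show "linear_between (scale_fun smul) (topspace powT) (scale_fun smul) (pow\<rho> g)"
      unfolding linear_between_def scale_fun_def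
      using powT_in by (auto simp: fun_eq_iff rep_plus rep_scale)
    have "homeomorphic_maps powT powT (pow\<rho> g) (pow\<rho> (- g))"
      unfolding homeomorphic_maps_def using pow\<rho>_continuous[of g] pow\<rho>_continuous[of "- g"] powT_in
      by (auto simp: fun_eq_iff rep_minus)
    then show "homeomorphic_map powT powT (pow\<rho> g)" using homeomorphic_map_maps by blast
  next
    fix g h x assume "x \<in> topspace powT"
    then show "pow\<rho> (g + h) x = pow\<rho> g (pow\<rho> h x)" using powT_in by (auto simp: fun_eq_iff rep_add)
  next
    fix x assume "x \<in> topspace powT"
    then show "continuous_map euclidean powT (\<lambda>g. pow\<rho> g x)"
      using powT_in by (intro continuous_map_powT) (auto simp: rep_orbit_continuous topspace_powT rep_zero)
  qed
qed

lemma pow_finite_dimensional: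
  assumes V: "\<And>i. i \<in> I \<Longrightarrow> finite_dimensional smul (V i)"
  shows "finite_dimensional (scale_fun smul) (pow.span (\<Union>i\<in>I. inj_at i ` V i))"
proof (rule pow.finite_dimensional_span_Union)
  show "finite ((\<lambda>i. inj_at i ` V i) ` I)" using finite_I by simp
  fix W assume "W \<in> (\<lambda>i. inj_at i ` V i) ` I"
  then obtain i where i: "i \<in> I" "W = inj_at i ` V i" by blast
  obtain S where S: "finite S" "V i = span S" using V[OF i(1)] unfolding finite_dimensional_def by blast
  have "inj_at i ` span S = pow.span (inj_at i ` S)"
    by (rule linear_between_image_span[OF vector_space_axioms pow.vector_space_axioms subspace_UNIV inj_at_linear]) simp
  then show "finite_dimensional (scale_fun smul) W"
    unfolding finite_dimensional_def i(2) S(2) using S(1) by blast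
qed

sublocale pow: locally_finite_compact_rep "scale_fun smul" powT pow\<rho>
proof unfold_locales
  show "locally_finite_rep (scale_fun smul) powT pow\<rho>"
    unfolding locally_finite_rep_def
  proof
    fix x assume x: "x \<in> topspace powT"
    let ?S = "pow.span (\<Union>i\<in>I. inj_at i ` orbit_span smul \<rho> (x i))"
    have "pow\<rho> g x \<in> ?S" for g
    proof -
      have "pow\<rho> g x \<in> topspace powT"
        using pow.rep_in[OF x] .
      then have eq: "pow\<rho> g x = (\<Sum>i\<in>I. inj_at i (\<rho> g (x i)))" by (rule pow_sum_inj_at)
      have "\<rho> g (x i) \<in> orbit_span smul \<rho> (x i)" for i
        unfolding orbit_span_def by (auto intro: span_base)
      then have "(\<Sum>i\<in>I. inj_at i (\<rho> g (x i))) \<in> ?S"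
        by (intro pow.span_sum pow.span_base) blast
      then show ?thesis by (simp only: eq[symmetric])
    qed
    then have "orbit_span (scale_fun smul) pow\<rho> x \<subseteq> ?S"
      unfolding orbit_span_def by (intro pow.span_minimal) auto
    moreover have "finite_dimensional (scale_fun smul) ?S"
      using fd_orbit_span powT_in[OF x] by (intro pow_finite_dimensional) auto
    ultimately show "finite_dimensional (scale_fun smul) (orbit_span (scale_fun smul) pow\<rho> x)"
      unfolding orbit_span_def by (meson pow.finite_dimensional_subspace pow.subspace_span)
  qed
qed

lemma inj_at_component:
  assumes W: "simple W" "has_class W \<alpha>" "\<alpha> \<in> irrep_classes" and w: "w \<in> W" and i: "i \<in> I"
  shows "inj_at i w \<in> pow.component \<alpha>"
proof -
  note W' = simpleD[OF W(1)]
  note WT = subrep_topspace[OF W'(1)]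
  have inj: "inj_on (inj_at i) W"
    unfolding inj_on_def inj_at_def by (metis (full_types))
  then have bij: "bij_betw (inj_at i) W (inj_at i ` W)" by (rule inj_on_imp_bij_betw)
  have sub: "inj_at i ` W \<subseteq> topspace powT" using inj_at_powT[OF i] WT by blast
  have equiv: "inj_at i (\<rho> g v) = pow\<rho> g (inj_at i v)" for g v
    unfolding inj_at_def by (auto simp: fun_eq_iff rep_zero)
  have "pow.subspace (inj_at i ` W)"
    using linear_between_image_span[OF vector_space_axioms pow.vector_space_axioms subspace_UNIV inj_at_linear, of W i]
      span_eq_iff subrep_subspace[OF W'(1)] pow.subspace_span by (metis subset_UNIV)
  moreover have "pow\<rho> g (inj_at i v) \<in> inj_at i ` W" if "v \<in> W" for g v
    using that subrep_invariant[OF W'(1)] unfolding equiv[symmetric] by blast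
  ultimately have srep: "pow.subrep (inj_at i ` W)"
    using sub unfolding subrepresentation_def by auto
  have "isomorphic_rep smul (subtopology T W) \<rho> (scale_fun smul) (subtopology powT (inj_at i ` W)) pow\<rho>"
    by (rule isomorphic_rep_finite_dimensionalI[OF tvs tvs_powT W'(2) WT sub inj_at_linear bij]) (rule equiv)
  from isomorphic_rep_sym_subrep[OF W'(1) this]
  have cls: "pow.has_class (inj_at i ` W) \<alpha>"
    using W(2) isomorphic_rep_trans unfolding has_class_def pow.has_class_def by blast
  have "pow.simple (inj_at i ` W)"
    unfolding pow.simple_def
    using srep pow.has_class_irreducible[OF srep cls W(3)]
      finite_dimensional_linear_homeomorphism(2)[OF tvs tvs_powT W'(2) WT sub inj_at_linear bij] by blast
  then show ?thesis using pow.simple_subset_component cls w by blast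
qed

end


section \<open>The projections onto the isotypic components\<close>

context locally_finite_compact_rep
begin

text \<open>
  The action of the element \<open>\<Sum>\<^sub>g c\<^sub>g g\<close> of the group ring with support in \<open>S\<close>.
\<close>

definition group_ring_op :: "'g set \<Rightarrow> ('g \<Rightarrow> 'k) \<Rightarrow> 'v \<Rightarrow> 'v" where
  "group_ring_op S c v = (\<Sum>g\<in>S. smul (c g) (\<rho> g v))"

lemma group_ring_op_continuous: "continuous_map T T (group_ring_op S c)"
  unfolding group_ring_op_def using rep_continuous
  by (intro continuous_map_Sum continuous_map_scale) auto

lemma group_ring_op_linear: "linear_between smul (topspace T) smul (group_ring_op S c)"
  unfolding linear_between_def group_ring_op_def
  by (auto simp: rep_plus rep_scale scale_right_distrib sum.distrib scale_sum_right mult.commute)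

lemmas group_ring_op_lincomb =
  linear_between_lincomb[OF vector_space_axioms vector_space_axioms subspace_topspace group_ring_op_linear]

lemma group_ring_op_span:
  assumes B: "B \<subseteq> topspace T" and d: "\<And>b. b \<in> B \<Longrightarrow> group_ring_op S c b = smul d b" and v: "v \<in> span B"
  shows "group_ring_op S c v = smul d v"
proof -
  obtain t r where t: "finite t" "t \<subseteq> B" "v = (\<Sum>a\<in>t. smul (r a) a)"
    using v unfolding span_explicit by blast
  have "group_ring_op S c v = (\<Sum>a\<in>t. smul (r a) (group_ring_op S c a))"
    unfolding t(3) using t(2) B by (intro group_ring_op_lincomb) auto
  also have "\<dots> = (\<Sum>a\<in>t. smul d (smul (r a) a))"
    using t(2) d by (intro sum.cong) (auto simp: mult.commute)
  also have "\<dots> = smul d v" unfolding t(3) by (simp only: scale_sum_right)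
  finally show ?thesis .
qed

lemma group_ring_op_equivariant:
  assumes W: "subrep W" and f: "equivariant W f" and w: "w \<in> W"
  shows "group_ring_op S c (f w) = f (group_ring_op S c w)"
proof -
  have lin: "linear_between smul W smul f" and eq: "\<And>g. f (\<rho> g w) = \<rho> g (f w)"
    using f w unfolding equivariant_def by auto
  show ?thesis
    unfolding group_ring_op_def
    using linear_between_lincomb[OF vector_space_axioms vector_space_axioms subrep_subspace[OF W] lin,
        of S "\<lambda>g. \<rho> g w" c] subrep_invariant[OF W w] eq by simp
qed

text \<open>
  This is the density theorem for pairwise non-isomorphic irreducible representations. Pairs of a class and a
  basis vector index a finite power; the tautological vector \<open>\<Sum>\<^sub>\<beta> x \<beta>\<close> has entry \<open>e\<close> at \<open>(\<beta>, e)\<close>, and \<open>x \<beta>\<close>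
  is its component of class \<open>\<beta>\<close>. The coefficients are read off from
  \<open>x \<alpha>\<close> being in the span of the orbit of the tautological vector.
\<close>

lemma separating_group_ring_op:
  assumes A: "finite A" "A \<subseteq> irrep_classes" and W: "\<And>\<beta>. \<beta> \<in> A \<Longrightarrow> simple (W \<beta>) \<and> has_class (W \<beta>) \<beta>"
    and \<alpha>: "\<alpha> \<in> A"
  obtains S c where "\<And>\<beta> w. \<beta> \<in> A \<Longrightarrow> w \<in> W \<beta> \<Longrightarrow> group_ring_op S c w = (if \<beta> = \<alpha> then w else 0)"
proof -
  have "\<exists>B. finite B \<and> span B = W \<beta> \<and> B \<subseteq> W \<beta>" if "\<beta> \<in> A" for \<beta>
    using finite_dimensional_basis[of "W \<beta>"] W[OF that] simpleD(2) by metis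
  then obtain b where b: "\<And>\<beta>. \<beta> \<in> A \<Longrightarrow> finite (b \<beta>) \<and> span (b \<beta>) = W \<beta> \<and> b \<beta> \<subseteq> W \<beta>" by metis
  have WT: "W \<beta> \<subseteq> topspace T" if "\<beta> \<in> A" for \<beta>
    using W[OF that] simpleD(1) subrep_topspace by blast
  define I where "I = (SIGMA \<beta>:A. b \<beta>)"
  have "finite I" unfolding I_def using A(1) b by blast
  then interpret finite_power_rep smul T \<rho> I by unfold_locales
  define x where "x = (\<lambda>\<beta>. \<Sum>e\<in>b \<beta>. inj_at (\<beta>, e) e)"
  have x_comp: "x \<beta> \<in> pow.component \<beta>" if "\<beta> \<in> A" for \<beta>
    unfolding x_def
  proof (rule pow.subspace_sum[OF pow.subspace_component])
    fix e assume "e \<in> b \<beta>"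
    then show "inj_at (\<beta>, e) e \<in> pow.component \<beta>"
      using that A(2) W[OF that] b[OF that] by (intro inj_at_component[of "W \<beta>"]) (auto simp: I_def)
  qed
  have x_at: "x \<beta> (\<gamma>, e) = (if \<gamma> = \<beta> then e else 0)" if "\<beta> \<in> A" "\<gamma> \<in> A" "e \<in> b \<gamma>" for \<beta> \<gamma> e
    unfolding x_def sum_fun_apply inj_at_def using that b by (auto simp: if_distrib cong: if_cong)
  have "x \<alpha> \<in> orbit_span (scale_fun smul) pow\<rho> (\<Sum>\<beta>\<in>A. x \<beta>)"
    by (rule pow.component_in_orbit_span[OF A x_comp \<alpha>])
  then obtain S c where Sc: "x \<alpha> = (\<Sum>g\<in>S. scale_fun smul (c g) (pow\<rho> g (\<Sum>\<beta>\<in>A. x \<beta>)))"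
    unfolding orbit_span_def using pow.span_range_explicit[of "x \<alpha>" "\<lambda>g. pow\<rho> g (\<Sum>\<beta>\<in>A. x \<beta>)"] by blast
  have "group_ring_op S c e = smul (if \<gamma> = \<alpha> then 1 else 0) e" if \<gamma>: "\<gamma> \<in> A" "e \<in> b \<gamma>" for \<gamma> e
  proof -
    have "(\<Sum>\<beta>\<in>A. x \<beta>) (\<gamma>, e) = (\<Sum>\<beta>\<in>A. if \<gamma> = \<beta> then e else 0)"
      unfolding sum_fun_apply using x_at \<gamma> by (intro sum.cong) auto
    also have "\<dots> = e" using A(1) \<gamma>(1) by simp
    finally have "x \<alpha> (\<gamma>, e) = group_ring_op S c e"
      using fun_cong[OF Sc, of "(\<gamma>, e)"] unfolding sum_fun_apply[of _ S] scale_fun_def group_ring_op_def by simp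
    then have "group_ring_op S c e = (if \<gamma> = \<alpha> then e else 0)" using x_at[OF \<alpha> \<gamma>] by metis
    then show ?thesis by (cases "\<gamma> = \<alpha>") simp_all
  qed
  then have "group_ring_op S c w = smul (if \<gamma> = \<alpha> then 1 else 0) w" if "\<gamma> \<in> A" "w \<in> W \<gamma>" for \<gamma> w
    using group_ring_op_span[of "b \<gamma>" S c _ w] b[OF that(1)] WT[OF that(1)] that by blast
  then have "group_ring_op S c w = (if \<gamma> = \<alpha> then w else 0)" if "\<gamma> \<in> A" "w \<in> W \<gamma>" for \<gamma> w
    using that by auto
  then show thesis by (rule that)
qed

text \<open>
  An element of the group ring acts alike on isomorphic representations. So the one that separates the chosen
  irreducible subrepresentations acts correctly on all irreducible subrepresentations of these classes, and these span
  the components.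
\<close>

lemma component_projection:
  assumes A: "finite A" "A \<subseteq> component_classes" and \<alpha>: "\<alpha> \<in> A"
  obtains p where "continuous_map T T p" "linear_between smul (topspace T) smul p"
    "\<And>\<beta> v. \<beta> \<in> A \<Longrightarrow> v \<in> component \<beta> \<Longrightarrow> p v = (if \<beta> = \<alpha> then v else 0)"
proof -
  have cls: "A \<subseteq> irrep_classes" using A(2) unfolding component_classes_def by blast
  have "\<exists>W. simple W \<and> has_class W \<beta>" if "\<beta> \<in> A" for \<beta>
  proof (rule ccontr)
    assume "\<not> ?thesis"
    then have none: "{W. simple W \<and> has_class W \<beta>} = {}" by blast
    have "component \<beta> = {0}" unfolding component_def none by simp
    then show False using that A(2) unfolding component_classes_def by blast
  qed
  then obtain W where W: "\<And>\<beta>. \<beta> \<in> A \<Longrightarrow> simple (W \<beta>) \<and> has_class (W \<beta>) \<beta>" by metis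
  obtain S c where Sc: "\<And>\<beta> w. \<beta> \<in> A \<Longrightarrow> w \<in> W \<beta> \<Longrightarrow> group_ring_op S c w = (if \<beta> = \<alpha> then w else 0)"
    using separating_group_ring_op[OF A(1) cls W \<alpha>] by metis
  have "group_ring_op S c v = (if \<beta> = \<alpha> then v else 0)" if \<beta>: "\<beta> \<in> A" and v: "v \<in> component \<beta>" for \<beta> v
  proof -
    have "group_ring_op S c w = smul (if \<beta> = \<alpha> then 1 else 0) w"
      if w: "w \<in> \<Union>{V. simple V \<and> has_class V \<beta>}" for w
    proof -
      obtain V where V: "simple V" "has_class V \<beta>" "w \<in> V" using w by blast
      obtain n \<sigma> where 1: "(n, \<sigma>) \<in> \<beta>" "isomorphic_rep smul (subtopology T V) \<rho> coord_scale (coord_space n) \<sigma>"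
        using V(2) unfolding has_class_def by blast
      obtain m \<tau> where 2: "(m, \<tau>) \<in> \<beta>" "isomorphic_rep smul (subtopology T (W \<beta>)) \<rho> coord_scale (coord_space m) \<tau>"
        using W[OF \<beta>] unfolding has_class_def by blast
      have "((m, \<tau>), (n, \<sigma>)) \<in> irrep_iso"
        using quotient_eq_iff[OF equiv_irrep_iso, of \<beta> \<beta>] 1(1) 2(1) cls \<beta> unfolding irrep_classes_def by blast
      then have 3: "isomorphic_rep coord_scale (coord_space m) \<tau> coord_scale (coord_space n) \<sigma>"
        unfolding irrep_iso_def by blast
      have WV: "subrep (W \<beta>)" "subrep V" using W[OF \<beta>] V simpleD(1) by blast+
      have "isomorphic_rep smul (subtopology T (W \<beta>)) \<rho> smul (subtopology T V) \<rho>"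
        using isomorphic_rep_trans[OF isomorphic_rep_trans[OF 2(2) 3] isomorphic_rep_sym_subrep[OF WV(2) 1(2)]] .
      then obtain f where f: "linear_between smul (W \<beta>) smul f" "homeomorphic_map (subtopology T (W \<beta>)) (subtopology T V) f"
        "\<And>g x. x \<in> W \<beta> \<Longrightarrow> f (\<rho> g x) = \<rho> g (f x)"
        unfolding isomorphic_rep_def topspace_subrep[OF WV(1)] by blast
      have "f ` W \<beta> = V"
        using homeomorphic_imp_surjective_map[OF f(2)] topspace_subrep WV by simp
      then obtain u where u: "u \<in> W \<beta>" "w = f u" using V(3) by blast
      have "equivariant (W \<beta>) f" unfolding equivariant_def using f by blast
      then have "group_ring_op S c w = f (group_ring_op S c u)"
        unfolding u(2) by (rule group_ring_op_equivariant[OF WV(1) _ u(1)])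
      also have "\<dots> = smul (if \<beta> = \<alpha> then 1 else 0) w"
        using Sc[OF \<beta> u(1)] u(2)
          linear_between_0[OF vector_space_axioms vector_space_axioms subrep_subspace[OF WV(1)] f(1)] by simp
      finally show ?thesis .
    qed
    moreover have "\<Union>{V. simple V \<and> has_class V \<beta>} \<subseteq> topspace T"
      using simpleD(1) subrep_topspace by blast
    ultimately have "group_ring_op S c v = smul (if \<beta> = \<alpha> then 1 else 0) v"
      using group_ring_op_span v[unfolded component_def] by blast
    then show ?thesis by simp
  qed
  then show thesis using that group_ring_op_continuous group_ring_op_linear by blast
qed

theorem isotypic_direct_sum:
  assumes fin: "finite component_classes"
  shows "internal_direct_sum smul T \<rho> component_classes (isotypic_component smul T \<rho>)"
proof -
  let ?A = component_classes
  have cls: "?A \<subseteq> irrep_classes" unfolding component_classes_def by blast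
  have c: "isotypic_component smul T \<rho> \<alpha> = component \<alpha>" if "\<alpha> \<in> ?A" for \<alpha>
    using that cls by (intro isotypic_component_eq_component) blast
  have "\<forall>\<alpha>\<in>?A. \<exists>p. continuous_map T T p \<and> linear_between smul (topspace T) smul p \<and>
      (\<forall>\<beta>\<in>?A. \<forall>v\<in>component \<beta>. p v = (if \<beta> = \<alpha> then v else 0))"
    using component_projection[OF fin order_refl] by metis
  from bchoice[OF this] obtain p where p':
    "\<forall>\<alpha>\<in>?A. continuous_map T T (p \<alpha>) \<and> linear_between smul (topspace T) smul (p \<alpha>) \<and>
      (\<forall>\<beta>\<in>?A. \<forall>v\<in>component \<beta>. p \<alpha> v = (if \<beta> = \<alpha> then v else 0))" by blast
  have p: "\<And>\<alpha>. \<alpha> \<in> ?A \<Longrightarrow> continuous_map T T (p \<alpha>)"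
    "\<And>\<alpha>. \<alpha> \<in> ?A \<Longrightarrow> linear_between smul (topspace T) smul (p \<alpha>)"
    "\<And>\<alpha> \<beta> v. \<alpha> \<in> ?A \<Longrightarrow> \<beta> \<in> ?A \<Longrightarrow> v \<in> component \<beta> \<Longrightarrow> p \<alpha> v = (if \<beta> = \<alpha> then v else 0)"
    using p' by blast+
  have decomp: "\<exists>x. (\<forall>\<alpha>\<in>?A. x \<alpha> \<in> component \<alpha>) \<and> v = (\<Sum>\<alpha>\<in>?A. x \<alpha>)" if v: "v \<in> topspace T" for v
  proof -
    obtain A' x where x: "finite A'" "A' \<subseteq> irrep_classes"
      "\<And>\<alpha>. \<alpha> \<in> A' \<Longrightarrow> x \<alpha> \<in> component \<alpha> \<inter> orbit_span smul \<rho> v" "v = (\<Sum>\<alpha>\<in>A'. x \<alpha>)"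
      by (rule component_decomposition[OF v]) blast
    have zero: "x \<alpha> = 0" if "\<alpha> \<in> A'" "\<alpha> \<notin> ?A" for \<alpha>
      using x(2,3) that unfolding component_classes_def by blast
    have "v = (\<Sum>\<alpha>\<in>A' \<inter> ?A. x \<alpha>)"
      unfolding x(4) using x(1) zero by (intro sum.mono_neutral_right) auto
    also have "\<dots> = (\<Sum>\<alpha>\<in>?A. if \<alpha> \<in> A' then x \<alpha> else 0)"
      using fin by (intro sum.mono_neutral_cong_left) auto
    finally show ?thesis
      using x(3) subspace_0[OF subspace_component] by (intro exI[of _ "\<lambda>\<alpha>. if \<alpha> \<in> A' then x \<alpha> else 0"]) auto
  qed
  have p_decomp: "p \<alpha> v = x \<alpha>" if "\<alpha> \<in> ?A" "\<And>\<alpha>. \<alpha> \<in> ?A \<Longrightarrow> x \<alpha> \<in> component \<alpha>" "v = (\<Sum>\<alpha>\<in>?A. x \<alpha>)" for \<alpha> v x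
  proof -
    have "p \<alpha> v = (\<Sum>\<beta>\<in>?A. p \<alpha> (x \<beta>))"
      unfolding that(3) using that(2) subrep_topspace[OF subrep_component]
      by (intro linear_between_sum[OF vector_space_axioms vector_space_axioms subspace_topspace p(2)[OF that(1)]]) blast
    also have "\<dots> = (\<Sum>\<beta>\<in>?A. if \<alpha> = \<beta> then x \<beta> else 0)"
      using p(3)[OF that(1)] that(2) by (intro sum.cong) auto
    finally show ?thesis using fin that(1) by simp
  qed
  show ?thesis
  proof (rule internal_direct_sumI[OF fin _ p(1)])
    fix \<alpha> assume "\<alpha> \<in> ?A"
    then show "subrep (isotypic_component smul T \<rho> \<alpha>)" using c subrep_component by simp
  next
    fix \<alpha> v assume "\<alpha> \<in> ?A" "v \<in> topspace T"
    then show "p \<alpha> v \<in> isotypic_component smul T \<rho> \<alpha>" using decomp[of v] p_decomp c by metis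
  next
    fix v assume "v \<in> topspace T"
    then obtain x where x: "\<forall>\<alpha>\<in>?A. x \<alpha> \<in> component \<alpha>" "v = (\<Sum>\<alpha>\<in>?A. x \<alpha>)" using decomp by blast
    have "(\<Sum>\<alpha>\<in>?A. p \<alpha> v) = (\<Sum>\<alpha>\<in>?A. x \<alpha>)" using p_decomp[OF _ _ x(2)] x(1) by simp
    then show "(\<Sum>\<alpha>\<in>?A. p \<alpha> v) = v" using x(2) by simp
  next
    fix x \<alpha> assume "\<And>\<alpha>. \<alpha> \<in> ?A \<Longrightarrow> x \<alpha> \<in> isotypic_component smul T \<rho> \<alpha>" "(\<Sum>\<alpha>\<in>?A. x \<alpha>) = 0" "\<alpha> \<in> ?A"
    then show "x \<alpha> = 0" using component_independent[OF fin cls, of x \<alpha>] c by blast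
  qed
qed

text \<open>
  The result for a single topological vector space. The hypothesis says that the space is not a countable union of
  closed sets without interior.
\<close>

theorem finite_isotypic_direct_sum:
  assumes baire: "\<And>C :: nat \<Rightarrow> 'v set. (\<And>k. closedin T (C k)) \<Longrightarrow> topspace T \<subseteq> (\<Union>k. C k) \<Longrightarrow>
    \<exists>k U. openin T U \<and> U \<noteq> {} \<and> U \<subseteq> C k"
  shows "finite (nonzero_isotypic_classes smul T \<rho>)"
    and "internal_direct_sum smul T \<rho> (nonzero_isotypic_classes smul T \<rho>) (isotypic_component smul T \<rho>)"
proof -
  have eq: "nonzero_isotypic_classes smul T \<rho> = component_classes"
    unfolding nonzero_isotypic_classes_def component_classes_def using isotypic_component_eq_component by blast
  obtain n where "\<And>v. v \<in> topspace T \<Longrightarrow> dim (orbit_span smul \<rho> v) \<le> n"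
    using bounded_orbit_dim[OF baire] by blast
  then have fin: "finite component_classes" by (rule finite_component_classes)
  then show "finite (nonzero_isotypic_classes smul T \<rho>)" unfolding eq .
  show "internal_direct_sum smul T \<rho> (nonzero_isotypic_classes smul T \<rho>) (isotypic_component smul T \<rho>)"
    unfolding eq using fin by (rule isotypic_direct_sum)
qed

end

theorem theoremD:
  fixes smul :: "'k::real_or_complex \<Rightarrow> 'v::ab_group_add \<Rightarrow> 'v"
    and J :: "'j set"
    and F :: "'j \<Rightarrow> 'v topology"
    and \<rho> :: "'g::{topological_group_add, t2_space} \<Rightarrow> ('j \<Rightarrow> 'v) \<Rightarrow> 'j \<Rightarrow> 'v"
  assumes "compact (UNIV :: 'g set)"
    and "vector_space smul"
    and "\<And>j. j \<in> J \<Longrightarrow> frechet_space smul (F j)"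
    and "representation (scale_fun smul) (prod_tvs J F) \<rho>"
    and "locally_finite_rep (scale_fun smul) (prod_tvs J F) \<rho>"
  shows "finite (nonzero_isotypic_classes (scale_fun smul) (prod_tvs J F) \<rho>) \<and>
         internal_direct_sum (scale_fun smul) (prod_tvs J F) \<rho>
           (nonzero_isotypic_classes (scale_fun smul) (prod_tvs J F) \<rho>)
           (isotypic_component (scale_fun smul) (prod_tvs J F) \<rho>)"
proof -
  have T: "tvs (scale_fun smul) (prod_tvs J F)"
    using assms(2,3) by (intro tvs_prod_tvs) (auto simp: frechet_space_def)
  interpret locally_finite_compact_rep "scale_fun smul" "prod_tvs J F" \<rho>
    using assms(1,4,5)
    by (intro locally_finite_compact_rep.intro compact_rep.intro compact_rep_axioms.intro
        locally_finite_compact_rep_axioms.intro top_vec_spaceI[OF T])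
  \<comment> \<open>The coordinates off \<open>J\<close> range over the zero space, which is complete and metrizable as well.\<close>
  define F' where "F' = (\<lambda>j. if j \<in> J then F j else discrete_topology {0})"
  have F': "tvs smul (F' j) \<and> metrizable_space (F' j) \<and> tvs_complete (F' j)" for j
  proof (cases "j \<in> J")
    case True
    then show ?thesis using assms(3) unfolding F'_def frechet_space_def by simp
  next
    case False
    have "tvs_complete (discrete_topology {0 :: 'v})"
      unfolding tvs_complete_def
    proof (intro allI impI)
      fix \<F> :: "'v filter" assume "tvs_cauchy_filter (discrete_topology {0}) \<F>"
      then have "\<forall>\<^sub>F x in \<F>. x \<in> {0}" unfolding tvs_cauchy_filter_def le_principal by simp
      then have "limitin (discrete_topology {0}) (\<lambda>x. x) 0 \<F>"
        unfolding limitin_def by (auto elim!: eventually_mono)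
      then show "\<exists>l. limitin (discrete_topology {0}) (\<lambda>x. x) l \<F>" by blast
    qed
    then show ?thesis
      unfolding F'_def using False tvs_zero_space[OF assms(2)] metrizable_space_discrete_topology by simp
  qed
  have P: "prod_tvs J F = product_topology F' UNIV" unfolding prod_tvs_def F'_def ..
  have "\<exists>k U. openin (prod_tvs J F) U \<and> U \<noteq> {} \<and> U \<subseteq> C k"
    if "\<And>k. closedin (prod_tvs J F) (C k)" "topspace (prod_tvs J F) \<subseteq> (\<Union>k. C k)" for C :: "nat \<Rightarrow> _"
    using that F' unfolding P by (intro product_closed_cover_has_interior[where smul = smul]) auto
  from finite_isotypic_direct_sum[OF this] show ?thesis by blast
qed

end
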